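(* Let $\mathcal K$ be the sub-wheeled PROP of the wheeled PROP $\mathcal H$ of stable cohomology generated by the class $h_1\in\mathcal H(2,1)$. For $p\ge1$, the classes $h_{p+1}\in\mathcal K(p+2,1)$ defined inductively by $$h_{p+1}=h_1\circ(h_p\otimes1)$$ and the classes $\overline{h_p}\in\mathcal K(p,0)$ defined by $$\overline{h_p}=\xi^1_1(h_p)$$ are, in the stable range (i.e. for $n$ large), the cohomology classes $h_{p+1}^{\mathrm{Kaw}}\in H^{p+1}(\mathrm{Aut}(\mathbb Z^{*n});\mathrm{Hom}(\Bbbk^n,(\Bbbk^n)^{\otimes p+2}))$ and $\overline{h_p}^{\mathrm{Kaw}}\in H^p(\mathrm{Aut}(\mathbb Z^{*n});(\Bbbk^n)^{\otimes p})$ introduced by Kawazumi.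
   Context: $\Bbbk$ is a commutative ring; $\mathbb Z^{*n}$ is the free group of rank $n$; $H=\Bbbk^n=(\mathbb Z^{*n})^{ab}\otimes\Bbbk$. The wheeled PROP $\mathcal H$. $\mathcal H(q,l)=\lim_nH^*(\mathrm{Aut}(\mathbb Z^{*n});B_{l,q}(\mathbb Z^{*n},\mathbb Z^{*n}))$ (morphisms from $q$ to $l$), where $B_{l,q}(\mathbb Z^{*n},\mathbb Z^{*n})=((\Bbbk^n)^* )^{\otimes l}\otimes(\Bbbk^n)^{\otimes q}\cong\mathrm{Hom}((\Bbbk^n)^{\otimes l},(\Bbbk^n)^{\otimes q})$ with the diagonal action, the limit being over the maps induced by $-*\mathbb Z:\mathrm{Aut}(\mathbb Z^{*n})\to\mathrm{Aut}(\mathbb Z^{*n+1})$ and the inclusion/projection of the first $n$ generators. In each degree these maps are isomorphisms for $n$ large (Randal-Williams–Wahl), so $\mathcal H(q,l)$ is identified degreewise with the cohomology for $n$ large ("stable range"). Horizontal composition $\otimes$ is the cup product followed by $\mathrm{Hom}(M_1,M_2)\otimes\mathrm{Hom}(N_1,N_2)\cong\mathrm{Hom}(M_1\otimes N_1,M_2\otimes N_2)$; vertical composition $\circ:\mathcal H(l,m)\otimes\mathcal H(q,l)\to\mathcal H(q,m)$ is the cup product followed by the map induced by composition of linear maps; contractions $\xi^i_j:\mathcal H(q,l)\to\mathcal H(q-1,l-1)$ are induced, for $n$ large, by evaluating the $j$-th factor $(\Bbbk^n)^*$ on the $i$-th factor $\Bbbk^n$. $1\in\mathcal H(1,1)$ is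 the identity. The class $h_1$. A Magnus expansion is a multiplicative map $\theta:\mathbb Z^{*n}\to\prod_{k\ge0}H^{\otimes k}$ with $\theta(\gamma)=1+[\gamma]+\theta_2(\gamma)+\cdots$. For $\psi\in\mathrm{Aut}(\mathbb Z^{*n})$, with induced automorphism $|\psi|$ of $H$, $\tau^\theta_1(\psi)([\gamma])=\theta_2(\gamma)-|\psi|^{\otimes2}\theta_2(\psi^{-1}(\gamma))$ defines a $1$-cocycle with values in $\mathrm{Hom}(H,H^{\otimes2})$ whose class $h_1$ is independent of $\theta$; it gives $h_1\in\mathcal H(2,1)$ of degree $1$. Kawazumi's classes. $h_1^{\mathrm{Kaw}}=h_1$. Let $\varsigma_p:\mathrm{Hom}(H,H^{\otimes2})^{\otimes p}\to\mathrm{Hom}(H,H^{\otimes p+1})$ be $$\varsigma_p(u_1\otimes\cdots\otimes u_p)=(u_1\otimes1_{H^{\otimes p-1}})\circ(u_2\otimes1_{H^{\otimes p-2}})\circ\cdots\circ(u_{p-1}\otimes1_H)\circ u_p .$$ Then $h_p^{\mathrm{Kaw}}=(\varsigma_p)_*(h_1^{\cup p})\in H^p(\mathrm{Aut}(\mathbb Z^{*n});\mathrm{Hom}(H,H^{\otimes p+1}))$, and $\overline{h_p}^{\mathrm{Kaw}}\in H^p(\mathrm{Aut}(\mathbb Z^{*n});H^{\otimes p})$ is the image of $h_p^{\mathrm{Kaw}}$ under the map induced by $H^*\otimes H^{\otimes p+1}\to H^{\otimes p}$, $f\otimes v_1\otimes\cdots\otimes v_{p+1}\mapsto f(v_1)\,v_2\otimes\cdots\otimes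 v_{p+1}$. *)

theory Defs
  imports
    Complex_Main
    "HOL-Algebra.Bij"
    "HOL-Combinatorics.Permutations"
    "HOL-Library.Function_Algebras"
begin

text \<open>
  The ground ring \<open>\<Bbbk>\<close> is a type of sort \<open>{comm_ring, comm_monoid_mult}\<close>. This is the class
  \<open>comm_ring_1\<close> without \<open>0 \<noteq> 1\<close>: the commutative rings with unit, the zero ring included.
\<close>

section \<open>Group cohomology\<close>

record ('g, 'm) gmodule =
  grp :: "'g monoid"
  coeffs :: "'m set"
  act :: "'g \<Rightarrow> 'm \<Rightarrow> 'm"

definition tuples :: "('g, 'b) monoid_scheme \<Rightarrow> nat \<Rightarrow> 'g list set" where
  "tuples G i = {gs. length gs = i \<and> set gs \<subseteq> carrier G}"

text \<open>Inhomogeneous cochains, made extensional by the value 0 off the \<open>i\<close>-tuples of the group.\<close>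

definition cochains :: "('g, 'm::ab_group_add) gmodule \<Rightarrow> nat \<Rightarrow> ('g list \<Rightarrow> 'm) set" where
  "cochains M i = {f. (\<forall>gs \<in> tuples (grp M) i. f gs \<in> coeffs M) \<and>
                      (\<forall>gs. gs \<notin> tuples (grp M) i \<longrightarrow> f gs = 0)}"

definition on_tuples ::
  "('g, 'b) monoid_scheme \<Rightarrow> nat \<Rightarrow> ('g list \<Rightarrow> 'm::zero) \<Rightarrow> 'g list \<Rightarrow> 'm" where
  "on_tuples G i f = (\<lambda>gs. if gs \<in> tuples G i then f gs else 0)"

definition alt :: "nat \<Rightarrow> 'm::ab_group_add \<Rightarrow> 'm" where
  "alt j x = (if even j then x else - x)"

text \<open>Positions count from 0: the entries \<open>gs ! j\<close> and \<open>gs ! (j + 1)\<close> are multiplied.\<close>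

definition merge :: "('g, 'b) monoid_scheme \<Rightarrow> nat \<Rightarrow> 'g list \<Rightarrow> 'g list" where
  "merge G j gs = take j gs @ (gs ! j \<otimes>\<^bsub>G\<^esub> gs ! Suc j) # drop (j + 2) gs"

definition coboundary ::
  "('g, 'm::ab_group_add) gmodule \<Rightarrow> nat \<Rightarrow> ('g list \<Rightarrow> 'm) \<Rightarrow> 'g list \<Rightarrow> 'm" where
  "coboundary M i f = on_tuples (grp M) (Suc i) (\<lambda>gs.
     act M (hd gs) (f (tl gs))
     + (\<Sum>j<i. alt (Suc j) (f (merge (grp M) j gs)))
     + alt (Suc i) (f (butlast gs)))"

definition cocycles :: "('g, 'm::ab_group_add) gmodule \<Rightarrow> nat \<Rightarrow> ('g list \<Rightarrow> 'm) set" where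
  "cocycles M i = {f \<in> cochains M i. coboundary M i f = 0}"

definition coboundaries :: "('g, 'm::ab_group_add) gmodule \<Rightarrow> nat \<Rightarrow> ('g list \<Rightarrow> 'm) set" where
  "coboundaries M i = (case i of 0 \<Rightarrow> {0} | Suc k \<Rightarrow> coboundary M k ` cochains M k)"

definition coho_class ::
  "('g, 'm::ab_group_add) gmodule \<Rightarrow> nat \<Rightarrow> ('g list \<Rightarrow> 'm) \<Rightarrow> ('g list \<Rightarrow> 'm) set" where
  "coho_class M i f = (\<lambda>b. f + b) ` coboundaries M i"

definition cohomology :: "('g, 'm::ab_group_add) gmodule \<Rightarrow> nat \<Rightarrow> ('g list \<Rightarrow> 'm) set set" where
  "cohomology M i = coho_class M i ` cocycles M i"

text \<open>
  Operations on classes are unions over representatives of the classes of the results; when the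
  operation is well defined, all members of the union coincide.
\<close>

definition coho_map ::
  "('g, 'm::ab_group_add) gmodule \<Rightarrow> nat \<Rightarrow> (('h list \<Rightarrow> 'l) \<Rightarrow> 'g list \<Rightarrow> 'm)
     \<Rightarrow> ('h list \<Rightarrow> 'l) set \<Rightarrow> ('g list \<Rightarrow> 'm) set" where
  "coho_map P i F X = (\<Union>f\<in>X. coho_class P i (F f))"

definition coef_map ::
  "('g, 'm::ab_group_add) gmodule \<Rightarrow> nat \<Rightarrow> ('l \<Rightarrow> 'm)
     \<Rightarrow> ('g list \<Rightarrow> 'l) set \<Rightarrow> ('g list \<Rightarrow> 'm) set" where
  "coef_map P i u = coho_map P i (\<lambda>f gs. u (f gs))"

definition coho_add ::
  "('g, 'm::ab_group_add) gmodule \<Rightarrow> nat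
     \<Rightarrow> ('g list \<Rightarrow> 'm) set \<Rightarrow> ('g list \<Rightarrow> 'm) set \<Rightarrow> ('g list \<Rightarrow> 'm) set" where
  "coho_add M i X Y = (\<Union>f\<in>X. \<Union>g\<in>Y. coho_class M i (f + g))"

text \<open>
  The cup product \<open>H\<^sup>i(G; M) \<times> H\<^sup>j(G; N) \<rightarrow> H\<^sup>i\<^sup>+\<^sup>j(G; M \<otimes> N)\<close> followed by the map
  \<open>M \<otimes> N \<rightarrow> P\<close> given by an equivariant bilinear pairing \<open>\<mu>\<close>.
\<close>

definition cup_cochain ::
  "('g, 'n) gmodule \<Rightarrow> nat \<Rightarrow> nat \<Rightarrow> ('m \<Rightarrow> 'n \<Rightarrow> 'p::zero)
     \<Rightarrow> ('g list \<Rightarrow> 'm) \<Rightarrow> ('g list \<Rightarrow> 'n) \<Rightarrow> 'g list \<Rightarrow> 'p" where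
  "cup_cochain N i j \<mu> f g = on_tuples (grp N) (i + j) (\<lambda>gs.
     \<mu> (f (take i gs))
       (act N (foldr (\<lambda>x y. x \<otimes>\<^bsub>grp N\<^esub> y) (take i gs) \<one>\<^bsub>grp N\<^esub>) (g (drop i gs))))"

definition cup ::
  "('g, 'n) gmodule \<Rightarrow> ('g, 'p::ab_group_add) gmodule \<Rightarrow> nat \<Rightarrow> nat \<Rightarrow> ('m \<Rightarrow> 'n \<Rightarrow> 'p)
     \<Rightarrow> ('g list \<Rightarrow> 'm) set \<Rightarrow> ('g list \<Rightarrow> 'n) set \<Rightarrow> ('g list \<Rightarrow> 'p) set" where
  "cup N P i j \<mu> X Y = (\<Union>f\<in>X. \<Union>g\<in>Y. coho_class P (i + j) (cup_cochain N i j \<mu> f g))"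

section \<open>Free groups and their automorphism groups\<close>

text \<open>The letter \<open>(i, True)\<close> is the generator \<open>x\<^sub>i\<close>, and \<open>(i, False)\<close> its inverse.\<close>

type_synonym letter = "nat \<times> bool"

fun cancel_cons :: "letter \<Rightarrow> letter list \<Rightarrow> letter list" where
  "cancel_cons x [] = [x]"
| "cancel_cons x (y # w) = (if fst x = fst y \<and> snd x \<noteq> snd y then w else x # y # w)"

definition reduce :: "letter list \<Rightarrow> letter list" where
  "reduce w = foldr cancel_cons w []"

definition free_group :: "nat \<Rightarrow> letter list monoid" where
  "free_group n =
     \<lparr>carrier = {w. reduce w = w \<and> fst ` set w \<subseteq> {..<n}},
      monoid.mult = (\<lambda>v w. reduce (v @ w)),
      one = []\<rparr>"

abbreviation Aut :: "nat \<Rightarrow> (letter list \<Rightarrow> letter list) monoid" where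
  "Aut n \<equiv> AutoGroup (free_group n)"

abbreviation gen :: "nat \<Rightarrow> letter list" where
  "gen i \<equiv> [(i, True)]"

text \<open>The homomorphism \<open>- * \<int> : Aut n \<rightarrow> Aut (n + 1)\<close>, on reduced words.\<close>

definition aut_ext :: "nat \<Rightarrow> (letter list \<Rightarrow> letter list) \<Rightarrow> letter list \<Rightarrow> letter list" where
  "aut_ext n \<psi> = (\<lambda>w \<in> carrier (free_group (Suc n)).
     reduce (concat (map (\<lambda>x. if fst x < n then \<psi> [x] else [x]) w)))"

text \<open>
  The coordinates of the class \<open>[\<gamma>]\<close> in \<open>H = \<Bbbk>\<^sup>n\<close>, the abelianisation tensored with \<open>\<Bbbk>\<close>:
  exponent sums.
\<close>

definition ab_coord :: "letter list \<Rightarrow> nat \<Rightarrow> 'k::{comm_ring, comm_monoid_mult}" where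
  "ab_coord \<gamma> i = (\<Sum>x\<leftarrow>\<gamma>. if fst x = i then (if snd x then 1 else - 1) else 0)"

section \<open>Bivariant coefficients\<close>

text \<open>
  \<open>(\<Bbbk>\<^sup>n)\<^sup>\<otimes>\<^sup>q\<close> has the basis \<open>words n q\<close>. An array \<open>T\<close> stands for the element of
  \<open>((\<Bbbk>\<^sup>n)\<^sup>*)\<^sup>\<otimes>\<^sup>l \<otimes> (\<Bbbk>\<^sup>n)\<^sup>\<otimes>\<^sup>q = Hom((\<Bbbk>\<^sup>n)\<^sup>\<otimes>\<^sup>l, (\<Bbbk>\<^sup>n)\<^sup>\<otimes>\<^sup>q)\<close> whose matrix has the entry \<open>T b a\<close>
  in row \<open>b\<close> (of length \<open>q\<close>) and column \<open>a\<close> (of length \<open>l\<close>).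
\<close>

type_synonym 'k arr = "nat list \<Rightarrow> nat list \<Rightarrow> 'k"

definition words :: "nat \<Rightarrow> nat \<Rightarrow> nat list set" where
  "words n q = {w. length w = q \<and> set w \<subseteq> {..<n}}"

definition truncate :: "nat \<Rightarrow> nat \<Rightarrow> nat \<Rightarrow> 'k::zero arr \<Rightarrow> 'k arr" where
  "truncate n q l T = (\<lambda>b a. if b \<in> words n q \<and> a \<in> words n l then T b a else 0)"

definition arrays :: "nat \<Rightarrow> nat \<Rightarrow> nat \<Rightarrow> 'k::zero arr set" where
  "arrays n q l = {T. truncate n q l T = T}"

definition id_arr :: "nat \<Rightarrow> nat \<Rightarrow> 'k::{comm_ring, comm_monoid_mult} arr" where
  "id_arr n q = truncate n q q (\<lambda>b a. if b = a then 1 else 0)"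

text \<open>\<open>comp_arr n r S T\<close> is \<open>S \<circ> T\<close>, with \<open>r\<close> the number of tensor factors in the middle.\<close>

definition comp_arr ::
  "nat \<Rightarrow> nat \<Rightarrow> 'k::{comm_ring, comm_monoid_mult} arr \<Rightarrow> 'k arr \<Rightarrow> 'k arr" where
  "comp_arr n r S T = (\<lambda>b a. \<Sum>c \<in> words n r. S b c * T c a)"

text \<open>\<open>S \<otimes> T\<close>, where \<open>S\<close> has \<open>q\<close> row indices and \<open>l\<close> column indices.\<close>

definition tensor_arr ::
  "nat \<Rightarrow> nat \<Rightarrow> 'k::{comm_ring, comm_monoid_mult} arr \<Rightarrow> 'k arr \<Rightarrow> 'k arr" where
  "tensor_arr q l S T = (\<lambda>b a. S (take q b) (take l a) * T (drop q b) (drop l a))"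

definition scale_arr :: "'k::{comm_ring, comm_monoid_mult} \<Rightarrow> 'k arr \<Rightarrow> 'k arr" where
  "scale_arr c T = (\<lambda>b a. c * T b a)"

text \<open>
  Evaluation of the \<open>j\<close>-th factor \<open>(\<Bbbk>\<^sup>n)\<^sup>*\<close> on the \<open>i\<close>-th factor \<open>\<Bbbk>\<^sup>n\<close>; the factors are
  numbered from 1.
\<close>

definition contract_arr ::
  "nat \<Rightarrow> nat \<Rightarrow> nat \<Rightarrow> 'k::{comm_ring, comm_monoid_mult} arr \<Rightarrow> 'k arr" where
  "contract_arr n i j T = (\<lambda>b a. \<Sum>c<n.
     T (take (i - 1) b @ c # drop (i - 1) b) (take (j - 1) a @ c # drop (j - 1) a))"

definition perm_arr ::
  "(nat \<Rightarrow> nat) \<Rightarrow> (nat \<Rightarrow> nat) \<Rightarrow> 'k arr \<Rightarrow> 'k arr" where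
  "perm_arr \<sigma> \<rho> T = (\<lambda>b a. T (permute_list \<sigma> b) (permute_list \<rho> a))"

text \<open>\<open>|\<psi>|\<^sup>\<otimes>\<^sup>q\<close>, where \<open>|\<psi>|\<close> is the automorphism of \<open>H\<close> induced by \<open>\<psi>\<close>.\<close>

definition ind_pow ::
  "nat \<Rightarrow> nat \<Rightarrow> (letter list \<Rightarrow> letter list) \<Rightarrow> 'k::{comm_ring, comm_monoid_mult} arr" where
  "ind_pow n q \<psi> = truncate n q q (\<lambda>b a. \<Prod>i<q. ab_coord (\<psi> (gen (a ! i))) (b ! i))"

definition act_arr ::
  "nat \<Rightarrow> nat \<Rightarrow> nat \<Rightarrow> (letter list \<Rightarrow> letter list)
     \<Rightarrow> 'k::{comm_ring, comm_monoid_mult} arr \<Rightarrow> 'k arr" where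
  "act_arr n q l \<psi> T =
     comp_arr n q (ind_pow n q \<psi>) (comp_arr n l T (ind_pow n l (inv\<^bsub>Aut n\<^esub> \<psi>)))"

text \<open>The module \<open>B\<^sub>l\<^sub>,\<^sub>q(\<int>\<^sup>*\<^sup>n, \<int>\<^sup>*\<^sup>n)\<close>, coefficients of \<open>\<H>(q, l)\<close>.\<close>

definition coef ::
  "nat \<Rightarrow> nat \<Rightarrow> nat \<Rightarrow>
     (letter list \<Rightarrow> letter list, 'k::{comm_ring, comm_monoid_mult} arr) gmodule" where
  "coef n q l = \<lparr>grp = Aut n, coeffs = arrays n q l, act = act_arr n q l\<rparr>"

type_synonym 'k coho = "((letter list \<Rightarrow> letter list) list \<Rightarrow> 'k arr) set"

section \<open>Stable cohomology\<close>

text \<open>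
  \<open>H\<^sup>d(Aut (n + 1)) \<rightarrow> H\<^sup>d(Aut n)\<close>: pull back along \<open>- * \<int>\<close>, precompose with the inclusion
  \<open>\<Bbbk>\<^sup>n \<rightarrow> \<Bbbk>\<^sup>n\<^sup>+\<^sup>1\<close> and postcompose with the projection \<open>\<Bbbk>\<^sup>n\<^sup>+\<^sup>1 \<rightarrow> \<Bbbk>\<^sup>n\<close>.
\<close>

definition stab ::
  "nat \<Rightarrow> nat \<Rightarrow> nat \<Rightarrow> nat \<Rightarrow> 'k::{comm_ring, comm_monoid_mult} coho \<Rightarrow> 'k coho" where
  "stab n q l d = coho_map (coef n q l) d
     (\<lambda>f. on_tuples (Aut n) d (\<lambda>gs. truncate n q l (f (map (aut_ext n) gs))))"

type_synonym 'k stable = "nat \<Rightarrow> 'k coho"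

text \<open>The degree \<open>d\<close> part of \<open>\<H>(q, l)\<close>, as an inverse limit.\<close>

definition stable_coho ::
  "nat \<Rightarrow> nat \<Rightarrow> nat \<Rightarrow> 'k::{comm_ring, comm_monoid_mult} stable set" where
  "stable_coho q l d = {x. \<forall>n. x n \<in> cohomology (coef n q l) d \<and> stab n q l d (x (Suc n)) = x n}"

text \<open>
  \<open>z \<in> \<H>(q, l)\<close> coincides with the classes \<open>s n\<close> for \<open>n\<close> large. There is at most one such \<open>z\<close>,
  because \<open>z n\<close> determines \<open>z m\<close> for all \<open>m \<le> n\<close>. Composition and contraction do not commute
  with the maps of the inverse system, so they have to be defined for \<open>n\<close> large in this way.
\<close>

definition stable_value ::
  "nat \<Rightarrow> nat \<Rightarrow> nat \<Rightarrow> (nat \<Rightarrow> 'k::{comm_ring, comm_monoid_mult} coho) \<Rightarrow> 'k stable \<Rightarrow> bool" where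
  "stable_value q l d s z \<longleftrightarrow> z \<in> stable_coho q l d \<and> (\<forall>\<^sub>F n in sequentially. z n = s n)"

definition stable_lim ::
  "nat \<Rightarrow> nat \<Rightarrow> nat \<Rightarrow> (nat \<Rightarrow> 'k::{comm_ring, comm_monoid_mult} coho) \<Rightarrow> 'k stable" where
  "stable_lim q l d s = (THE z. stable_value q l d s z)"

section \<open>The wheeled PROP of stable cohomology\<close>

definition id_st :: "nat \<Rightarrow> 'k::{comm_ring, comm_monoid_mult} stable" where
  "id_st q = (\<lambda>n. coho_class (coef n q q) 0 (on_tuples (Aut n) 0 (\<lambda>_. id_arr n q)))"

definition zero_st :: "nat \<Rightarrow> nat \<Rightarrow> nat \<Rightarrow> 'k::{comm_ring, comm_monoid_mult} stable" where
  "zero_st q l d = (\<lambda>n. coho_class (coef n q l) d 0)"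

definition add_st ::
  "nat \<Rightarrow> nat \<Rightarrow> nat \<Rightarrow> 'k::{comm_ring, comm_monoid_mult} stable \<Rightarrow> 'k stable \<Rightarrow> 'k stable" where
  "add_st q l d x y = (\<lambda>n. coho_add (coef n q l) d (x n) (y n))"

definition scale_st ::
  "nat \<Rightarrow> nat \<Rightarrow> nat \<Rightarrow> 'k::{comm_ring, comm_monoid_mult} \<Rightarrow> 'k stable \<Rightarrow> 'k stable" where
  "scale_st q l d c x = (\<lambda>n. coef_map (coef n q l) d (scale_arr c) (x n))"

definition perm_st ::
  "nat \<Rightarrow> nat \<Rightarrow> nat \<Rightarrow> (nat \<Rightarrow> nat) \<Rightarrow> (nat \<Rightarrow> nat)
     \<Rightarrow> 'k::{comm_ring, comm_monoid_mult} stable \<Rightarrow> 'k stable" where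
  "perm_st q l d \<sigma> \<rho> x = (\<lambda>n. coef_map (coef n q l) d (perm_arr \<sigma> \<rho>) (x n))"

text \<open>\<open>x \<otimes> y\<close> for \<open>x \<in> \<H>(q, l)\<close> of degree \<open>d\<close> and \<open>y \<in> \<H>(q', l')\<close> of degree \<open>d'\<close>.\<close>

definition tensor_st ::
  "nat \<Rightarrow> nat \<Rightarrow> nat \<Rightarrow> nat \<Rightarrow> nat \<Rightarrow> nat
     \<Rightarrow> 'k::{comm_ring, comm_monoid_mult} stable \<Rightarrow> 'k stable \<Rightarrow> 'k stable" where
  "tensor_st q l d q' l' d' x y =
     (\<lambda>n. cup (coef n q' l') (coef n (q + q') (l + l')) d d' (tensor_arr q l) (x n) (y n))"

text \<open>
  \<open>x \<circ> y\<close> for \<open>x \<in> \<H>(l, m)\<close> of degree \<open>d\<close> and \<open>y \<in> \<H>(q, l)\<close> of degree \<open>d'\<close>. The values of \<open>x\<close>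
  are linear maps \<open>H\<^sup>\<otimes>\<^sup>m \<rightarrow> H\<^sup>\<otimes>\<^sup>l\<close> and those of \<open>y\<close> linear maps \<open>H\<^sup>\<otimes>\<^sup>l \<rightarrow> H\<^sup>\<otimes>\<^sup>q\<close>, so the linear
  maps are composed as \<open>y \<circ> x\<close>. Composition of linear maps is the pairing
  \<open>Hom(H\<^sup>\<otimes>\<^sup>l, H\<^sup>\<otimes>\<^sup>q) \<otimes> Hom(H\<^sup>\<otimes>\<^sup>m, H\<^sup>\<otimes>\<^sup>l) \<rightarrow> Hom(H\<^sup>\<otimes>\<^sup>m, H\<^sup>\<otimes>\<^sup>q)\<close>, and the cup product is taken in
  that order: \<open>y \<union> x\<close>. The other order differs by the sign \<open>(-1)\<^sup>d\<^sup>d\<^sup>'\<close>.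
\<close>

definition comp_at ::
  "nat \<Rightarrow> nat \<Rightarrow> nat \<Rightarrow> nat \<Rightarrow> nat
     \<Rightarrow> 'k::{comm_ring, comm_monoid_mult} stable \<Rightarrow> 'k stable \<Rightarrow> nat \<Rightarrow> 'k coho" where
  "comp_at q l m d d' x y n = cup (coef n l m) (coef n q m) d' d (comp_arr n l) (y n) (x n)"

definition comp_st ::
  "nat \<Rightarrow> nat \<Rightarrow> nat \<Rightarrow> nat \<Rightarrow> nat
     \<Rightarrow> 'k::{comm_ring, comm_monoid_mult} stable \<Rightarrow> 'k stable \<Rightarrow> 'k stable" where
  "comp_st q l m d d' x y = stable_lim q m (d + d') (comp_at q l m d d' x y)"

text \<open>\<open>\<xi>\<^sup>i\<^sub>j\<close> on \<open>\<H>(q, l)\<close>, for \<open>1 \<le> i \<le> q\<close> and \<open>1 \<le> j \<le> l\<close>.\<close>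

definition contract_at ::
  "nat \<Rightarrow> nat \<Rightarrow> nat \<Rightarrow> nat \<Rightarrow> nat
     \<Rightarrow> 'k::{comm_ring, comm_monoid_mult} stable \<Rightarrow> nat \<Rightarrow> 'k coho" where
  "contract_at q l d i j x n = coef_map (coef n (q - 1) (l - 1)) d (contract_arr n i j) (x n)"

definition contract_st ::
  "nat \<Rightarrow> nat \<Rightarrow> nat \<Rightarrow> nat \<Rightarrow> nat
     \<Rightarrow> 'k::{comm_ring, comm_monoid_mult} stable \<Rightarrow> 'k stable" where
  "contract_st q l d i j x = stable_lim (q - 1) (l - 1) d (contract_at q l d i j x)"

text \<open>
  The sub-wheeled PROP generated by a set \<open>S\<close> of homogeneous elements \<open>(q, l, d, x)\<close>: the smallest
  family of submodules containing \<open>S\<close> and the identities (the one on \<open>0\<close> is the unit of the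
  horizontal composition), and closed under the two compositions, the contractions and the actions
  of the symmetric groups. The rules for composition and contraction produce the stable value where
  it exists; the contraction of \<open>1 \<in> \<H>(1, 1)\<close> is the constant \<open>n\<close> at stage \<open>n\<close> and has none.
\<close>

inductive generated ::
  "(nat \<times> nat \<times> nat \<times> 'k::{comm_ring, comm_monoid_mult} stable) set
     \<Rightarrow> nat \<Rightarrow> nat \<Rightarrow> nat \<Rightarrow> 'k stable \<Rightarrow> bool"
  for S where
  base: "(q, l, d, x) \<in> S \<Longrightarrow> generated S q l d x"
| id: "generated S q q 0 (id_st q)"
| zero: "generated S q l d (zero_st q l d)"
| add: "generated S q l d x \<Longrightarrow> generated S q l d y \<Longrightarrow> generated S q l d (add_st q l d x y)"
| scale: "generated S q l d x \<Longrightarrow> generated S q l d (scale_st q l d c x)"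
| perm: "generated S q l d x \<Longrightarrow> \<sigma> permutes {..<q} \<Longrightarrow> \<rho> permutes {..<l} \<Longrightarrow>
    generated S q l d (perm_st q l d \<sigma> \<rho> x)"
| tensor: "generated S q l d x \<Longrightarrow> generated S q' l' d' y \<Longrightarrow>
    generated S (q + q') (l + l') (d + d') (tensor_st q l d q' l' d' x y)"
| comp: "generated S l m d x \<Longrightarrow> generated S q l d' y \<Longrightarrow>
    stable_value q m (d + d') (comp_at q l m d d' x y) z \<Longrightarrow> generated S q m (d + d') z"
| contract: "generated S q l d x \<Longrightarrow> 1 \<le> i \<Longrightarrow> i \<le> q \<Longrightarrow> 1 \<le> j \<Longrightarrow> j \<le> l \<Longrightarrow>
    stable_value (q - 1) (l - 1) d (contract_at q l d i j x) z \<Longrightarrow>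
    generated S (q - 1) (l - 1) d z"

section \<open>The class \<open>h\<^sub>1\<close>\<close>

text \<open>An element of \<open>\<Prod>\<^sub>k H\<^sup>\<otimes>\<^sup>k\<close> is given by its coefficients at the words of all lengths.\<close>

definition series_mult ::
  "(nat list \<Rightarrow> 'k::{comm_ring, comm_monoid_mult}) \<Rightarrow> (nat list \<Rightarrow> 'k) \<Rightarrow> nat list \<Rightarrow> 'k" where
  "series_mult f g = (\<lambda>w. \<Sum>i\<le>length w. f (take i w) * g (drop i w))"

definition magnus_expansion ::
  "nat \<Rightarrow> (letter list \<Rightarrow> nat list \<Rightarrow> 'k::{comm_ring, comm_monoid_mult}) \<Rightarrow> bool" where
  "magnus_expansion n \<theta> \<longleftrightarrow>
     (\<forall>\<gamma> \<in> carrier (free_group n).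
        (\<forall>w. \<not> set w \<subseteq> {..<n} \<longrightarrow> \<theta> \<gamma> w = 0) \<and>
        \<theta> \<gamma> [] = 1 \<and>
        (\<forall>i<n. \<theta> \<gamma> [i] = ab_coord \<gamma> i)) \<and>
     (\<forall>\<gamma> \<in> carrier (free_group n). \<forall>\<delta> \<in> carrier (free_group n).
        \<theta> (\<gamma> \<otimes>\<^bsub>free_group n\<^esub> \<delta>) = series_mult (\<theta> \<gamma>) (\<theta> \<delta>))"

text \<open>
  The linear map \<open>[\<gamma>] \<mapsto> \<theta>\<^sub>2(\<gamma>) - |\<psi>|\<^sup>\<otimes>\<^sup>2 \<theta>\<^sub>2(\<psi>\<^sup>-\<^sup>1(\<gamma>))\<close>, given by its values on the basis
  \<open>[\<gamma>] = [x\<^sub>a]\<close> of \<open>H\<close>.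
\<close>

definition tau1 ::
  "nat \<Rightarrow> (letter list \<Rightarrow> nat list \<Rightarrow> 'k::{comm_ring, comm_monoid_mult})
     \<Rightarrow> (letter list \<Rightarrow> letter list) \<Rightarrow> 'k arr" where
  "tau1 n \<theta> \<psi> = truncate n 2 1 (\<lambda>b a.
     \<theta> (gen (hd a)) b
     - (\<Sum>c \<in> words n 2. ind_pow n 2 \<psi> b c * \<theta> ((inv\<^bsub>Aut n\<^esub> \<psi>) (gen (hd a))) c))"

text \<open>The common class of the cocycles \<open>tau1 n \<theta>\<close> for all Magnus expansions \<open>\<theta>\<close>.\<close>

definition h1 :: "'k::{comm_ring, comm_monoid_mult} stable" where
  "h1 n = (THE X. \<forall>\<theta>. magnus_expansion n \<theta> \<longrightarrow>
     X = coho_class (coef n 2 1) 1 (on_tuples (Aut n) 1 (\<lambda>gs. tau1 n \<theta> (hd gs))))"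

definition K :: "nat \<Rightarrow> nat \<Rightarrow> nat \<Rightarrow> 'k::{comm_ring, comm_monoid_mult} stable set" where
  "K q l d = {x. generated {(2, 1, 1, h1)} q l d x}"

text \<open>\<open>h_st p\<close> is only meant for \<open>p \<ge> 1\<close>.\<close>

fun h_st :: "nat \<Rightarrow> 'k::{comm_ring, comm_monoid_mult} stable" where
  "h_st 0 = id_st 1"
| "h_st (Suc 0) = h1"
| "h_st (Suc (Suc p)) =
     comp_st (p + 3) 2 1 1 (p + 1) h1 (tensor_st (p + 2) 1 (p + 1) 1 1 0 (h_st (Suc p)) (id_st 1))"

definition h_bar_st :: "nat \<Rightarrow> 'k::{comm_ring, comm_monoid_mult} stable" where
  "h_bar_st p = contract_st (p + 1) 1 p 1 1 (h_st p)"

section \<open>Kawazumi's classes\<close>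

text \<open>\<open>(u\<^sub>1 \<otimes> 1) \<circ> (u\<^sub>2 \<otimes> 1) \<circ> \<dots> \<circ> u\<^sub>p\<close> for a list \<open>u\<^sub>1, \<dots>, u\<^sub>p\<close> of maps \<open>H \<rightarrow> H \<otimes> H\<close>.\<close>

fun varsigma_list :: "nat \<Rightarrow> 'k::{comm_ring, comm_monoid_mult} arr list \<Rightarrow> 'k arr" where
  "varsigma_list n [] = id_arr n 1"
| "varsigma_list n (u # us) =
     comp_arr n (length us + 1) (tensor_arr 2 1 u (id_arr n (length us))) (varsigma_list n us)"

definition unit_arr :: "nat list \<Rightarrow> nat list \<Rightarrow> 'k::{comm_ring, comm_monoid_mult} arr" where
  "unit_arr b a = (\<lambda>b' a'. if b' = b \<and> a' = a then 1 else 0)"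

text \<open>
  The tensor power \<open>Hom(H, H\<^sup>\<otimes>\<^sup>2)\<^sup>\<otimes>\<^sup>p\<close> is realised as \<open>Hom(H\<^sup>\<otimes>\<^sup>p, H\<^sup>\<otimes>\<^sup>2\<^sup>p)\<close>, where
  \<open>u\<^sub>1 \<otimes> \<dots> \<otimes> u\<^sub>p\<close> is the tensor product of linear maps; its basis consists of the tensor products of
  matrix units. \<open>varsigma n p\<close> is the linear extension of the formula from this basis.
\<close>

definition varsigma ::
  "nat \<Rightarrow> nat \<Rightarrow> 'k::{comm_ring, comm_monoid_mult} arr \<Rightarrow> 'k arr" where
  "varsigma n p T = (\<Sum>b \<in> words n (2 * p). \<Sum>a \<in> words n p.
     scale_arr (T b a)
       (varsigma_list n (map (\<lambda>i. unit_arr [b ! (2 * i), b ! (2 * i + 1)] [a ! i]) [0..<p])))"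

primrec h1_cup_pow :: "nat \<Rightarrow> nat \<Rightarrow> 'k::{comm_ring, comm_monoid_mult} coho" where
  "h1_cup_pow n 0 = id_st 0 n"
| "h1_cup_pow n (Suc p) =
     cup (coef n 2 1) (coef n (2 * p + 2) (p + 1)) p 1 (tensor_arr (2 * p) p)
       (h1_cup_pow n p) (h1 n)"

definition h_Kaw :: "nat \<Rightarrow> nat \<Rightarrow> 'k::{comm_ring, comm_monoid_mult} coho" where
  "h_Kaw n p = coef_map (coef n (p + 1) 1) p (varsigma n p) (h1_cup_pow n p)"

text \<open>\<open>f \<otimes> v\<^sub>1 \<otimes> \<dots> \<otimes> v\<^sub>p\<^sub>+\<^sub>1 \<mapsto> f(v\<^sub>1) v\<^sub>2 \<otimes> \<dots> \<otimes> v\<^sub>p\<^sub>+\<^sub>1\<close>\<close>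

definition eval_first :: "nat \<Rightarrow> 'k::{comm_ring, comm_monoid_mult} arr \<Rightarrow> 'k arr" where
  "eval_first n T = (\<lambda>b a. \<Sum>c<n. T (c # b) (c # a))"

definition h_bar_Kaw :: "nat \<Rightarrow> nat \<Rightarrow> 'k::{comm_ring, comm_monoid_mult} coho" where
  "h_bar_Kaw n p = coef_map (coef n p 0) p (eval_first n) (h_Kaw n p)"

end

theory Submission
  imports Defs
begin

text \<open>
  With the Magnus expansion given by \<open>x\<^sub>i \<mapsto> 1 + x\<^sub>i\<close>, the cocycle of \<open>h\<^sub>1\<close> is stable on the nose: at
  \<open>\<psi> * \<int>\<close> it vanishes on the last generator and takes no value involving it. Hence so are the
  cocycles obtained from it by cup products, composition and contraction, because the last index
  then contributes nothing to the sums over indices. So the compositions and contractions of the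
  statement are defined at every stage \<open>n\<close>, without appeal to homological stability. The
  comparison with Kawazumi's classes is the equality of cochains coming from
  \<open>\<varsigma>\<^sub>p\<^sub>+\<^sub>1(S \<otimes> u) = (\<varsigma>\<^sub>p(S) \<otimes> 1) \<circ> u\<close>.
\<close>

section \<open>Cup products of cochains\<close>

text \<open>The comparison can be made on cochains because both constructions add the new
  \<open>h1\<close> at the same end. In Kawazumi's formula the last factor is the innermost map; in
  \<open>comp_at\<close> the cup product is taken with the tensor factor first and \<open>h1\<close>
  last. So no factor is moved past another, and neither a sign nor a correcting coboundary appears.
  The obstacle is composition: passing from \<open>n\<close> to \<open>n + 1\<close> adds a summand
  for every middle word containing the index \<open>n\<close>, and truncating the result does not
  remove these. Compatibility with the inverse system is therefore too weak an induction hypothesis.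
  What is carried along is equality of the untruncated arrays at \<open>n + 1\<close> and at
  \<open>n\<close>, so that the values on extended automorphisms are supported on the first
  \<open>n\<close> indices. Identity arrays do not have this property, and the contraction of the
  one on \<open>H\<close> is the scalar \<open>n\<close>. Hence the induction starts in degree one,
  and the identity factor that widens \<open>h_st p\<close> does no harm only because the cocycle
  composed with it has values supported on the first \<open>n\<close> indices.\<close>

abbreviation list_mult :: "('g, 'b) monoid_scheme \<Rightarrow> 'g list \<Rightarrow> 'g" where
  "list_mult G gs \<equiv> foldr (\<lambda>x y. x \<otimes>\<^bsub>G\<^esub> y) gs \<one>\<^bsub>G\<^esub>"

lemma (in monoid) list_mult_closed: "set gs \<subseteq> carrier G \<Longrightarrow> list_mult G gs \<in> carrier G"
  by (induction gs) auto

lemma (in monoid) list_mult_append: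
  "set gs \<subseteq> carrier G \<Longrightarrow> set hs \<subseteq> carrier G \<Longrightarrow>
    list_mult G (gs @ hs) = list_mult G gs \<otimes> list_mult G hs"
  by (induction gs) (auto simp: m_assoc list_mult_closed)

section \<open>Merging neighbouring entries of a tuple\<close>

lemma merge_0: "merge G 0 (g # h # gs) = (g \<otimes>\<^bsub>G\<^esub> h) # gs"
  by (simp add: merge_def)

lemma merge_Suc: "merge G (Suc k) (g # gs) = g # merge G k gs"
  by (simp add: merge_def)

lemma length_merge: "Suc k < length gs \<Longrightarrow> length (merge G k gs) = length gs - 1"
  by (auto simp: merge_def)

lemma (in monoid) merge_closed:
  "set gs \<subseteq> carrier G \<Longrightarrow> Suc k < length gs \<Longrightarrow> set (merge G k gs) \<subseteq> carrier G"
proof (induction k arbitrary: gs)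
  case 0
  then obtain g h hs where "gs = g # h # hs"
    by (metis Suc_less_eq2 length_Suc_conv less_Suc_eq_0_disj not_less_zero less_nat_zero_code list.exhaust list.size(3))
  with 0 show ?case by (auto simp: merge_0)
next
  case (Suc k)
  then obtain g hs where "gs = g # hs" by (cases gs) auto
  with Suc show ?case by (auto simp: merge_Suc)
qed

lemma (in monoid) list_mult_merge:
  "set gs \<subseteq> carrier G \<Longrightarrow> Suc k < length gs \<Longrightarrow> list_mult G (merge G k gs) = list_mult G gs"
proof (induction k arbitrary: gs)
  case 0
  then obtain g h hs where "gs = g # h # hs"
    by (metis Suc_less_eq2 length_Suc_conv less_Suc_eq_0_disj not_less_zero less_nat_zero_code list.exhaust list.size(3))
  with 0 show ?case by (auto simp: merge_0 m_assoc list_mult_closed)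
next
  case (Suc k)
  then obtain g hs where "gs = g # hs" by (cases gs) auto
  with Suc show ?case by (auto simp: merge_Suc)
qed

lemma (in monoid) merge_tuples:
  "gs \<in> tuples G (Suc i) \<Longrightarrow> k < i \<Longrightarrow> merge G k gs \<in> tuples G i"
  using merge_closed by (auto simp: tuples_def length_merge)

text \<open>This and the next three lemmas sort the faces of a tuple that is cut after
  \<open>i\<close> entries: a merge at a position below \<open>i\<close> takes place in the first
  block, which then uses up one more entry of \<open>gs\<close>; a merge at \<open>i\<close> or
  later takes place in the second block.\<close>

lemma take_merge_less:
  "k < i \<Longrightarrow> i < length gs \<Longrightarrow> take i (merge G k gs) = merge G k (take (Suc i) gs)"
  by (auto simp: merge_def take_Cons' drop_take min_def)

lemma drop_merge_less:
  "k < i \<Longrightarrow> i < length gs \<Longrightarrow> drop i (merge G k gs) = drop (Suc i) gs"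
  by (auto simp: merge_def drop_Cons' min_def)

lemma take_merge_ge:
  "i \<le> k \<Longrightarrow> Suc k < length gs \<Longrightarrow> take i (merge G k gs) = take i gs"
  by (auto simp: merge_def min_def)

lemma drop_merge_ge:
  "Suc (i + k) < length gs \<Longrightarrow> drop i (merge G (i + k) gs) = merge G k (drop i gs)"
  by (auto simp: merge_def min_def drop_take add.commute add.left_commute)

section \<open>Modules over a group and their coboundaries\<close>

lemma alt_add: "alt k (x + y) = alt k x + alt k y"
  by (simp add: alt_def)

lemma alt_0 [simp]: "alt k 0 = 0"
  by (simp add: alt_def)

lemma alt_alt: "alt k (alt l x) = alt (k + l) x"
  by (simp add: alt_def)

lemma alt_sum: "alt k (sum f A) = (\<Sum>a\<in>A. alt k (f a))"
  by (simp add: alt_def sum_negf)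

text \<open>The action is additive on the whole type and not just on \<open>coeffs\<close>. This
  makes \<open>coboundary\<close> additive on arbitrary functions, so that sums of cochains can be
  rewritten without side conditions.\<close>

locale gmod =
  fixes M :: "('g, 'm::ab_group_add) gmodule"
  assumes group_grp: "group (grp M)"
    and zero_closed: "0 \<in> coeffs M"
    and add_closed: "x \<in> coeffs M \<Longrightarrow> y \<in> coeffs M \<Longrightarrow> x + y \<in> coeffs M"
    and minus_closed: "x \<in> coeffs M \<Longrightarrow> - x \<in> coeffs M"
    and act_closed: "g \<in> carrier (grp M) \<Longrightarrow> x \<in> coeffs M \<Longrightarrow> act M g x \<in> coeffs M"
    and act_add: "act M g (x + y) = act M g x + act M g y"
    and act_mult: "g \<in> carrier (grp M) \<Longrightarrow> h \<in> carrier (grp M) \<Longrightarrow> x \<in> coeffs M \<Longrightarrow>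
      act M (g \<otimes>\<^bsub>grp M\<^esub> h) x = act M g (act M h x)"
begin

sublocale group "grp M" by (rule group_grp)

lemma act_additive: "additive (act M g)"
  by standard (rule act_add)

lemmas act_0 = additive.zero [OF act_additive]
lemmas act_minus = additive.minus [OF act_additive]
lemmas act_diff = additive.diff [OF act_additive]
lemmas act_sum = additive.sum [OF act_additive]

lemma act_alt: "act M g (alt k x) = alt k (act M g x)"
  by (simp add: alt_def act_minus)

lemma alt_closed: "x \<in> coeffs M \<Longrightarrow> alt k x \<in> coeffs M"
  by (simp add: alt_def minus_closed)

lemma sum_closed: "(\<And>a. a \<in> A \<Longrightarrow> f a \<in> coeffs M) \<Longrightarrow> sum f A \<in> coeffs M"
  by (induction A rule: infinite_finite_induct) (auto simp: zero_closed add_closed)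

lemma cochainsD: "f \<in> cochains M i \<Longrightarrow> gs \<in> tuples (grp M) i \<Longrightarrow> f gs \<in> coeffs M"
  by (simp add: cochains_def)

lemma on_tuples_cochain:
  "(\<And>gs. gs \<in> tuples (grp M) i \<Longrightarrow> f gs \<in> coeffs M) \<Longrightarrow> on_tuples (grp M) i f \<in> cochains M i"
  by (simp add: cochains_def on_tuples_def)

lemma cochains_0: "0 \<in> cochains M i"
  by (simp add: cochains_def zero_closed)

lemma cochains_add: "f \<in> cochains M i \<Longrightarrow> g \<in> cochains M i \<Longrightarrow> f + g \<in> cochains M i"
  by (simp add: cochains_def add_closed)

lemma cochains_minus: "f \<in> cochains M i \<Longrightarrow> - f \<in> cochains M i"
  by (simp add: cochains_def minus_closed)

lemma coboundary_add: "coboundary M i (f + g) = coboundary M i f + coboundary M i g"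
  by (auto simp: coboundary_def on_tuples_def fun_eq_iff act_add alt_add sum.distrib algebra_simps)

lemma coboundary_additive: "additive (coboundary M i)"
  by standard (rule coboundary_add)

lemmas coboundary_0 = additive.zero [OF coboundary_additive]
lemmas coboundary_minus = additive.minus [OF coboundary_additive]

lemma coboundary_cochain:
  assumes f: "f \<in> cochains M i"
  shows "coboundary M i f \<in> cochains M (Suc i)"
  unfolding coboundary_def
proof (rule on_tuples_cochain)
  fix gs assume gs: "gs \<in> tuples (grp M) (Suc i)"
  then obtain g hs where "gs = g # hs" "g \<in> carrier (grp M)" "hs \<in> tuples (grp M) i"
    by (cases gs) (auto simp: tuples_def)
  moreover have "butlast gs \<in> tuples (grp M) i"
    using gs by (auto simp: tuples_def dest: in_set_butlastD)
  ultimately show "act M (hd gs) (f (tl gs)) + (\<Sum>j<i. alt (Suc j) (f (merge (grp M) j gs)))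
      + alt (Suc i) (f (butlast gs)) \<in> coeffs M"
    using gs by (auto intro!: add_closed act_closed alt_closed sum_closed
        simp: cochainsD [OF f] merge_tuples)
qed

lemma coboundaries_0: "0 \<in> coboundaries M i"
  by (auto simp: coboundaries_def cochains_0 coboundary_0 split: nat.split intro!: image_eqI [of _ _ 0])

lemma coboundaries_add:
  "f \<in> coboundaries M i \<Longrightarrow> g \<in> coboundaries M i \<Longrightarrow> f + g \<in> coboundaries M i"
  by (auto simp: coboundaries_def split: nat.splits)
    (metis cochains_add coboundary_add image_eqI)

lemma coboundaries_minus: "f \<in> coboundaries M i \<Longrightarrow> - f \<in> coboundaries M i"
  by (auto simp: coboundaries_def split: nat.splits)
    (metis cochains_minus coboundary_minus image_eqI)

lemma coho_class_eqI:
  assumes "f - g \<in> coboundaries M i"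
  shows "coho_class M i f = coho_class M i g"
proof -
  have "coho_class M i f \<subseteq> coho_class M i g" if "f - g \<in> coboundaries M i" for f g
  proof
    fix x assume "x \<in> coho_class M i f"
    then obtain b where b: "b \<in> coboundaries M i" "x = f + b"
      by (auto simp: coho_class_def)
    then have "x = g + ((f - g) + b)" by simp
    with b that show "x \<in> coho_class M i g"
      unfolding coho_class_def using coboundaries_add by blast
  qed
  moreover have "g - f \<in> coboundaries M i"
    using coboundaries_minus [OF assms] by simp
  ultimately show ?thesis using assms by blast
qed

lemma coho_class_self: "f \<in> coho_class M i f"
  by (auto simp: coho_class_def coboundaries_0 intro!: image_eqI [of _ _ 0])

lemma coho_class_nonempty: "coho_class M i f \<noteq> {}"
  using coho_class_self by fast

lemma cocycleI: "f \<in> cochains M i \<Longrightarrow> coboundary M i f = 0 \<Longrightarrow> f \<in> cocycles M i"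
  by (simp add: cocycles_def)

lemma coboundary_tuple:
  "gs \<in> tuples (grp M) (Suc i) \<Longrightarrow> coboundary M i f gs = act M (hd gs) (f (tl gs))
     + (\<Sum>j<i. alt (Suc j) (f (merge (grp M) j gs))) + alt (Suc i) (f (butlast gs))"
  by (simp add: coboundary_def on_tuples_def)

lemma coboundaries_0_cocycles: "coboundaries M 0 \<subseteq> cocycles M 0"
  by (auto simp: coboundaries_def cocycles_def cochains_0 coboundary_0)

lemma coboundaries_1_cocycles: "coboundaries M (Suc 0) \<subseteq> cocycles M (Suc 0)"
proof
  fix b assume "b \<in> coboundaries M (Suc 0)"
  then obtain f where f: "f \<in> cochains M 0" and b: "b = coboundary M 0 f"
    by (auto simp: coboundaries_def)
  have "coboundary M (Suc 0) b = 0"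
  proof
    fix gs
    show "coboundary M (Suc 0) b gs = 0 gs"
    proof (cases "gs \<in> tuples (grp M) (Suc (Suc 0))")
      case False
      then show ?thesis by (simp add: coboundary_def on_tuples_def)
    next
      case True
      then obtain g h where gs: "gs = [g, h]" and gh: "g \<in> carrier (grp M)" "h \<in> carrier (grp M)"
        by (auto simp: tuples_def length_Suc_conv numeral_2_eq_2)
      have "f [] \<in> coeffs M" using f by (auto intro: cochainsD simp: tuples_def)
      with True gh show ?thesis
        unfolding coboundary_tuple [OF True]
        by (simp add: gs b coboundary_def on_tuples_def tuples_def merge_def alt_def
            act_diff act_mult)
    qed
  qed
  then show "b \<in> cocycles M (Suc 0)"
    by (intro cocycleI) (simp_all add: b coboundary_cochain f)
qed

end

section \<open>Equivariant maps of coefficients\<close>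

locale gmod_map = M: gmod M + P: gmod P
  for M :: "('g, 'l::ab_group_add) gmodule" and P :: "('g, 'm::ab_group_add) gmodule" +
  fixes u :: "'l \<Rightarrow> 'm"
  assumes grp_eq: "grp P = grp M"
    and map_closed: "x \<in> coeffs M \<Longrightarrow> u x \<in> coeffs P"
    and map_add: "u (x + y) = u x + u y"
    and map_act: "g \<in> carrier (grp M) \<Longrightarrow> x \<in> coeffs M \<Longrightarrow> u (act M g x) = act P g (u x)"
begin

lemma map_additive: "additive u"
  by standard (rule map_add)

lemmas map_0 = additive.zero [OF map_additive]
lemmas map_minus = additive.minus [OF map_additive]
lemmas map_sum = additive.sum [OF map_additive]

lemma map_alt: "u (alt k x) = alt k (u x)"
  by (simp add: alt_def map_minus)

lemma cochains_map: "f \<in> cochains M i \<Longrightarrow> (\<lambda>gs. u (f gs)) \<in> cochains P i"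
  by (simp add: cochains_def grp_eq map_closed map_0)

lemma coboundary_map:
  assumes f: "f \<in> cochains M i"
  shows "coboundary P i (\<lambda>gs. u (f gs)) = (\<lambda>gs. u (coboundary M i f gs))"
proof
  fix gs
  \<comment> \<open>The action enters a coboundary through its leading term alone; this is where
    equivariance comes in, and additivity handles the other terms.\<close>
  have "act P (hd gs) (u (f (tl gs))) = u (act M (hd gs) (f (tl gs)))"
    if "gs \<in> tuples (grp M) (Suc i)"
    using that by (cases gs) (auto simp: tuples_def intro!: map_act [symmetric] M.cochainsD [OF f])
  then show "coboundary P i (\<lambda>gs. u (f gs)) gs = u (coboundary M i f gs)"
    by (simp add: coboundary_def on_tuples_def grp_eq map_0 map_add map_sum map_alt)
qed

lemma cocycles_map: "f \<in> cocycles M i \<Longrightarrow> (\<lambda>gs. u (f gs)) \<in> cocycles P i"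
  by (auto simp: cocycles_def cochains_map coboundary_map map_0 fun_eq_iff)

text \<open>The union over representatives collapses: \<open>u\<close> carries coboundaries to
  coboundaries, so every representative contributes the same class.\<close>

lemma coef_map_class: "coef_map P i u (coho_class M i f) = coho_class P i (\<lambda>gs. u (f gs))"
proof -
  have "coho_class P i (\<lambda>gs. u (f' gs)) = coho_class P i (\<lambda>gs. u (f gs))"
    if f': "f' \<in> coho_class M i f" for f'
  proof (rule P.coho_class_eqI)
    obtain b where b: "b \<in> coboundaries M i" "f' = f + b"
      using f' by (auto simp: coho_class_def)
    have "(\<lambda>gs. u (b gs)) \<in> coboundaries P i"
      using b(1) by (auto simp: coboundaries_def map_0 zero_fun_def coboundary_map [symmetric] cochains_map
          split: nat.splits)
    then show "(\<lambda>gs. u (f' gs)) - (\<lambda>gs. u (f gs)) \<in> coboundaries P i"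
      by (simp add: b(2) map_add fun_diff_def)
  qed
  then show ?thesis
    by (auto simp only: coef_map_def coho_map_def intro!: SUP_eq_const M.coho_class_nonempty)
qed

end

section \<open>Equivariant pairings and the cup product\<close>

locale gpairing = M: gmod M + N: gmod N + P: gmod P
  for M :: "('g, 'm::ab_group_add) gmodule" and N :: "('g, 'n::ab_group_add) gmodule"
    and P :: "('g, 'p::ab_group_add) gmodule" +
  fixes \<mu> :: "'m \<Rightarrow> 'n \<Rightarrow> 'p"
  assumes grp_N: "grp N = grp M" and grp_P: "grp P = grp M"
    and pair_closed: "x \<in> coeffs M \<Longrightarrow> y \<in> coeffs N \<Longrightarrow> \<mu> x y \<in> coeffs P"
    and pair_add_left: "\<mu> (x + x') y = \<mu> x y + \<mu> x' y"
    and pair_add_right: "\<mu> x (y + y') = \<mu> x y + \<mu> x y'"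
    and pair_act: "g \<in> carrier (grp M) \<Longrightarrow> x \<in> coeffs M \<Longrightarrow> y \<in> coeffs N \<Longrightarrow>
      \<mu> (act M g x) (act N g y) = act P g (\<mu> x y)"
begin

lemma additive_left: "additive (\<lambda>x. \<mu> x y)" and additive_right: "additive (\<mu> x)"
  by (auto intro: additive.intro simp: pair_add_left pair_add_right)

lemmas pair_0_left = additive.zero [OF additive_left]
lemmas pair_0_right = additive.zero [OF additive_right]
lemmas pair_minus_left = additive.minus [OF additive_left]
lemmas pair_minus_right = additive.minus [OF additive_right]
lemmas pair_sum_left = additive.sum [OF additive_left]
lemmas pair_sum_right = additive.sum [OF additive_right]

lemma pair_alt_left: "\<mu> (alt k x) y = alt k (\<mu> x y)"
  by (simp add: alt_def pair_minus_left)

lemma pair_alt_right: "\<mu> x (alt k y) = alt k (\<mu> x y)"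
  by (simp add: alt_def pair_minus_right)

abbreviation "cupc i j \<equiv> cup_cochain N i j \<mu>"

lemma cup_cochain_tuple:
  "gs \<in> tuples (grp M) (i + j) \<Longrightarrow>
    cupc i j f g gs = \<mu> (f (take i gs)) (act N (list_mult (grp M) (take i gs)) (g (drop i gs)))"
  by (simp add: cup_cochain_def on_tuples_def grp_N)

lemma cup_cochain_off: "gs \<notin> tuples (grp M) (i + j) \<Longrightarrow> cupc i j f g gs = 0"
  by (simp add: cup_cochain_def on_tuples_def grp_N)

lemma take_tuples: "gs \<in> tuples (grp M) (i + j) \<Longrightarrow> take i gs \<in> tuples (grp M) i"
  by (auto simp: tuples_def dest: in_set_takeD)

lemma drop_tuples: "gs \<in> tuples (grp M) (i + j) \<Longrightarrow> drop i gs \<in> tuples (grp M) j"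
  by (auto simp: tuples_def dest: in_set_dropD)

lemma tuple_mult_closed: "gs \<in> tuples (grp M) i \<Longrightarrow> list_mult (grp M) gs \<in> carrier (grp M)"
  by (simp add: tuples_def M.list_mult_closed)

lemma cup_cochain_cochain:
  assumes "f \<in> cochains M i" "g \<in> cochains N j"
  shows "cupc i j f g \<in> cochains P (i + j)"
  unfolding cup_cochain_def grp_N grp_P [symmetric]
proof (rule P.on_tuples_cochain)
  fix gs assume "gs \<in> tuples (grp P) (i + j)"
  then have gs: "gs \<in> tuples (grp M) (i + j)" by (simp add: grp_P)
  show "\<mu> (f (take i gs)) (act N (list_mult (grp P) (take i gs)) (g (drop i gs))) \<in> coeffs P"
    using assms tuple_mult_closed [OF take_tuples [OF gs]] take_tuples [OF gs] drop_tuples [OF gs]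
    by (intro pair_closed N.act_closed M.cochainsD [of f] N.cochainsD [of g]) (simp_all add: grp_P grp_N)
qed

lemma cup_cochain_add_left: "cupc i j (f + f') g = cupc i j f g + cupc i j f' g"
  by (auto simp: cup_cochain_def on_tuples_def fun_eq_iff pair_add_left)

lemma cup_cochain_add_right: "cupc i j f (g + g') = cupc i j f g + cupc i j f g'"
  by (auto simp: cup_cochain_def on_tuples_def fun_eq_iff N.act_add pair_add_right)

lemma cup_cochain_0_left: "cupc i j 0 g = 0" and cup_cochain_0_right: "cupc i j f 0 = 0"
  by (auto simp: cup_cochain_def on_tuples_def fun_eq_iff N.act_0 pair_0_left pair_0_right)

text \<open>The merges of the whole tuple below position \<open>i\<close> are those in the
  coboundary of \<open>f\<close>, the later ones those in the coboundary of \<open>g\<close>. Two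
  terms on the right have no counterpart on the left: the face of \<open>f\<close> that drops the
  entry \<open>gs ! i\<close>, and the term of \<open>g\<close> in which that entry acts. They agree
  up to opposite signs and cancel.\<close>

lemma cup_leibniz:
  assumes f: "f \<in> cochains M i" and g: "g \<in> cochains N j"
  shows "coboundary P (i + j) (cupc i j f g)
    = cupc (Suc i) j (coboundary M i f) g
      + (\<lambda>gs. alt i (cupc i (Suc j) f (coboundary N j g) gs))"
proof
  fix gs
  let ?G = "grp M"
  show "coboundary P (i + j) (cupc i j f g) gs = (cupc (Suc i) j (coboundary M i f) g
      + (\<lambda>gs. alt i (cupc i (Suc j) f (coboundary N j g) gs))) gs"
  proof (cases "gs \<in> tuples ?G (Suc (i + j))")
    case False
    then show ?thesis
      by (simp add: cup_cochain_off coboundary_def on_tuples_def grp_P)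
  next
    case True
    then have len: "length gs = Suc (i + j)" and sub: "set gs \<subseteq> carrier ?G"
      by (auto simp: tuples_def)
    from len obtain g0 hs where gs: "gs = g0 # hs" by (cases gs) auto
    have g0: "g0 \<in> carrier ?G" and hs: "hs \<in> tuples ?G (i + j)"
      using len sub by (auto simp: gs tuples_def)
    have T': "gs \<in> tuples ?G (Suc i + j)" "gs \<in> tuples ?G (i + Suc j)"
      using True by simp_all
    have tk: "take (Suc i) gs \<in> tuples ?G (Suc i)" and dr: "drop (Suc i) gs \<in> tuples ?G j"
      and tk': "take i gs \<in> tuples ?G i" and dr': "drop i gs \<in> tuples ?G (Suc j)"
      using take_tuples [OF T'(1)] drop_tuples [OF T'(1)]
        take_tuples [OF T'(2)] drop_tuples [OF T'(2)] by auto
    define p where "p = list_mult ?G (take i gs)"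
    define p1 where "p1 = list_mult ?G (take (Suc i) gs)"
    have p: "p \<in> carrier ?G" "p1 \<in> carrier ?G"
      using tuple_mult_closed tk tk' by (auto simp: p_def p1_def)
    have gi: "gs ! i \<in> carrier ?G"
      using sub len by (auto intro: subsetD)
    have p1_eq: "p1 = p \<otimes>\<^bsub>?G\<^esub> gs ! i"
    proof -
      have "take (Suc i) gs = take i gs @ [gs ! i]"
        using len by (simp add: take_Suc_conv_app_nth)
      moreover have "set (take i gs) \<subseteq> carrier ?G" "set [gs ! i] \<subseteq> carrier ?G"
        using tk' gi by (simp_all add: tuples_def)
      ultimately have "p1 = p \<otimes>\<^bsub>?G\<^esub> list_mult ?G [gs ! i]"
        unfolding p1_def p_def by (simp only: M.list_mult_append)
      then show ?thesis using gi by simp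
    qed
    \<comment> \<open>The common second factor of the leading term, of the merges below
      \<open>i\<close> and of the two cancelling terms.\<close>
    define x where "x = act N p1 (g (drop (Suc i) gs))"
    have first: "act P g0 (cupc i j f g hs) = \<mu> (act M g0 (f (take i hs))) x"
    proof -
      have "act P g0 (cupc i j f g hs)
          = \<mu> (act M g0 (f (take i hs))) (act N g0 (act N (list_mult ?G (take i hs)) (g (drop i hs))))"
        using hs take_tuples [OF hs] drop_tuples [OF hs]
        by (auto simp: cup_cochain_tuple [OF hs] intro!: pair_act [symmetric] g0 M.cochainsD [OF f]
            N.act_closed N.cochainsD [OF g] simp: grp_N tuple_mult_closed)
      also have "act N g0 (act N (list_mult ?G (take i hs)) (g (drop i hs))) = x"
        using hs take_tuples [OF hs] drop_tuples [OF hs] g0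
        by (auto simp: x_def p1_def gs grp_N tuple_mult_closed
            intro!: N.act_mult [symmetric, unfolded grp_N] N.cochainsD [OF g])
      finally show ?thesis .
    qed
    have low: "cupc i j f g (merge ?G k gs) = \<mu> (f (merge ?G k (take (Suc i) gs))) x" if "k < i" for k
    proof -
      have "merge ?G k gs \<in> tuples ?G (i + j)"
        using True that by (intro M.merge_tuples) auto
      then show ?thesis
        using that len tk
        by (simp add: cup_cochain_tuple take_merge_less drop_merge_less x_def p1_def
            M.list_mult_merge tuples_def)
    qed
    have high: "cupc i j f g (merge ?G (i + k) gs)
        = \<mu> (f (take i gs)) (act N p (g (merge ?G k (drop i gs))))" if "k < j" for k
    proof -
      have "merge ?G (i + k) gs \<in> tuples ?G (i + j)"
        using True that by (intro M.merge_tuples) auto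
      then show ?thesis
        using that len by (simp add: cup_cochain_tuple take_merge_ge drop_merge_ge p_def)
    qed
    have last: "cupc i j f g (butlast gs) = \<mu> (f (take i gs)) (act N p (g (butlast (drop i gs))))"
    proof -
      have "butlast gs \<in> tuples ?G (i + j)"
        using True by (auto simp: tuples_def dest: in_set_butlastD)
      then show ?thesis
        using len by (simp add: cup_cochain_tuple p_def take_butlast drop_butlast)
    qed
    have split: "(\<Sum>k<i + j. F k) = (\<Sum>k<i. F k) + (\<Sum>k<j. F (i + k))"
      for F :: "nat \<Rightarrow> 'p"
      using sum.atLeastLessThan_concat [of 0 i "i + j" F] sum.shift_bounds_nat_ivl [of F 0 i j]
      by (simp add: atLeast0LessThan add.commute)
    have L: "coboundary P (i + j) (cupc i j f g) gs
      = \<mu> (act M g0 (f (take i hs))) x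
        + ((\<Sum>k<i. alt (Suc k) (\<mu> (f (merge ?G k (take (Suc i) gs))) x))
          + (\<Sum>k<j. alt (Suc (i + k)) (\<mu> (f (take i gs)) (act N p (g (merge ?G k (drop i gs)))))))
        + alt (Suc (i + j)) (\<mu> (f (take i gs)) (act N p (g (butlast (drop i gs)))))"
      using True
      by (subst P.coboundary_tuple) (simp_all add: grp_P first low high last split gs [symmetric],
        simp add: gs first)
    have df: "coboundary M i f (take (Suc i) gs)
      = act M g0 (f (take i hs)) + (\<Sum>k<i. alt (Suc k) (f (merge ?G k (take (Suc i) gs))))
        + alt (Suc i) (f (take i gs))"
    proof -
      have "hd (take (Suc i) gs) = g0" "tl (take (Suc i) gs) = take i hs"
        "butlast (take (Suc i) gs) = take i gs"
        using len butlast_take [of "Suc i" gs] by (simp_all add: gs del: butlast.simps)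
      then show ?thesis using tk by (simp only: M.coboundary_tuple)
    qed
    have dg: "coboundary N j g (drop i gs)
      = act N (gs ! i) (g (drop (Suc i) gs))
        + (\<Sum>k<j. alt (Suc k) (g (merge ?G k (drop i gs)))) + alt (Suc j) (g (butlast (drop i gs)))"
      using dr' len by (subst N.coboundary_tuple) (auto simp: grp_N hd_drop_conv_nth tl_drop drop_Suc [symmetric])
    have px: "act N p (act N (gs ! i) (g (drop (Suc i) gs))) = x"
      using p gi N.cochainsD [OF g] dr
      by (simp add: x_def p1_eq N.act_mult [unfolded grp_N] grp_N)
    have R1: "cupc (Suc i) j (coboundary M i f) g gs
      = \<mu> (act M g0 (f (take i hs))) x
        + (\<Sum>k<i. alt (Suc k) (\<mu> (f (merge ?G k (take (Suc i) gs))) x))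
        + alt (Suc i) (\<mu> (f (take i gs)) x)"
      unfolding cup_cochain_tuple [OF T'(1)] df
      by (simp add: x_def [symmetric] p1_def [symmetric] pair_add_left pair_sum_left pair_alt_left)
    have R2: "cupc i (Suc j) f (coboundary N j g) gs
      = \<mu> (f (take i gs)) x
        + (\<Sum>k<j. alt (Suc k) (\<mu> (f (take i gs)) (act N p (g (merge ?G k (drop i gs))))))
        + alt (Suc j) (\<mu> (f (take i gs)) (act N p (g (butlast (drop i gs)))))"
      unfolding cup_cochain_tuple [OF T'(2)] dg
      by (simp add: p_def [symmetric] N.act_add px pair_add_right N.act_sum pair_sum_right
          N.act_alt pair_alt_right)
    show ?thesis
      unfolding plus_fun_def L R1 R2
      by (simp add: alt_add alt_sum alt_alt) (simp add: alt_def)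
  qed
qed

lemma cup_cocycle:
  assumes f: "f \<in> cocycles M i" and g: "g \<in> cocycles N j"
  shows "cupc i j f g \<in> cocycles P (i + j)"
proof (rule P.cocycleI)
  show "coboundary P (i + j) (cupc i j f g) = 0"
    using assms
    by (intro ext) (simp add: cocycles_def cup_leibniz cup_cochain_0_left cup_cochain_0_right)
qed (use assms in \<open>simp add: cocycles_def cup_cochain_cochain\<close>)

lemma cup_coboundary_left:
  assumes b: "b \<in> coboundaries M i" and g: "g \<in> cocycles N j"
  shows "cupc i j b g \<in> coboundaries P (i + j)"
proof (cases i)
  case 0
  then show ?thesis using b P.coboundaries_0 by (simp add: coboundaries_def cup_cochain_0_left)
next
  case (Suc k)
  then obtain a where a: "a \<in> cochains M k" "b = coboundary M k a"
    using b by (auto simp: coboundaries_def)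
  have "cupc i j b g = coboundary P (k + j) (cupc k j a g)"
    using g by (intro ext) (simp add: cup_leibniz a cocycles_def cup_cochain_0_right Suc)
  then show ?thesis
    using g by (auto simp: coboundaries_def Suc cocycles_def intro!: imageI cup_cochain_cochain a)
qed

lemma cup_coboundary_right:
  assumes f: "f \<in> cocycles M i" and b: "b \<in> coboundaries N j"
  shows "cupc i j f b \<in> coboundaries P (i + j)"
proof (cases j)
  case 0
  then show ?thesis using b P.coboundaries_0 by (simp add: coboundaries_def cup_cochain_0_right)
next
  case (Suc k)
  then obtain a where a: "a \<in> cochains N k" "b = coboundary N k a"
    using b by (auto simp: coboundaries_def)
  \<comment> \<open>Since \<open>f\<close> is a cocycle, only the second term of the Leibniz rule
    survives. It carries the sign of degree \<open>i\<close>, which is absorbed because coboundaries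
    are closed under negation.\<close>
  have *: "coboundary P (i + k) (cupc i k f a) = (\<lambda>gs. alt i (cupc i j f b gs))"
    using f by (intro ext) (simp add: cup_leibniz a cocycles_def cup_cochain_0_left Suc)
  have mem: "coboundary P (i + k) (cupc i k f a) \<in> coboundaries P (i + j)"
    using f by (auto simp: coboundaries_def Suc cocycles_def intro!: imageI cup_cochain_cochain a)
  show ?thesis
    using mem P.coboundaries_minus [OF mem]
    by (cases "even i") (simp_all add: * alt_def fun_Compl_def)
qed

text \<open>
  The assumption on \<open>N\<close> is \<open>d \<circ> d = 0\<close>. It is proved above for \<open>j \<le> 1\<close> only, which suffices since the
  second factor is always \<open>h\<^sub>1\<close> or an identity.
\<close>

lemma cup_class:
  assumes f: "f \<in> cocycles M i" and g: "g \<in> cocycles N j"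
    and B: "coboundaries N j \<subseteq> cocycles N j"
  shows "cup N P i j \<mu> (coho_class M i f) (coho_class N j g) = coho_class P (i + j) (cupc i j f g)"
proof -
  have "coho_class P (i + j) (cupc i j f' g') = coho_class P (i + j) (cupc i j f g)"
    if fg: "f' \<in> coho_class M i f" "g' \<in> coho_class N j g" for f' g'
  proof (rule P.coho_class_eqI)
    obtain a where a: "a \<in> coboundaries M i" "f' = f + a"
      using fg by (auto simp: coho_class_def)
    obtain b where b: "b \<in> coboundaries N j" "g' = g + b"
      using fg by (auto simp: coho_class_def)
    have "g' \<in> cocycles N j"
      using g b B by (auto simp: cocycles_def N.cochains_add N.coboundary_add)
    then have "cupc i j f b + cupc i j a g' \<in> coboundaries P (i + j)"
      by (intro P.coboundaries_add cup_coboundary_left cup_coboundary_right f a b)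
    then show "cupc i j f' g' - cupc i j f g \<in> coboundaries P (i + j)"
      by (simp add: a b cup_cochain_add_left cup_cochain_add_right algebra_simps)
  qed
  then show ?thesis
    by (auto simp only: cup_def intro!: SUP_eq_const M.coho_class_nonempty N.coho_class_nonempty)
qed

end

section \<open>Free groups\<close>

definition flip :: "letter \<Rightarrow> letter" where
  "flip x = (fst x, \<not> snd x)"

lemma fst_flip [simp]: "fst (flip x) = fst x" and snd_flip [simp]: "snd (flip x) = (\<not> snd x)"
  and flip_flip [simp]: "flip (flip x) = x"
  by (auto simp: flip_def prod_eq_iff)

lemma cancels_iff: "fst x = fst y \<and> snd x \<noteq> snd y \<longleftrightarrow> y = flip x"
  by (auto simp: flip_def prod_eq_iff)

lemma cancel_cons_Cons: "cancel_cons x (y # w) = (if y = flip x then w else x # y # w)"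
  unfolding cancels_iff [symmetric] by simp

declare cancel_cons.simps(2) [simp del]

lemma reduce_Nil [simp]: "reduce [] = []"
  by (simp add: reduce_def)

lemma reduce_Cons: "reduce (x # w) = cancel_cons x (reduce w)"
  by (simp add: reduce_def)

lemma reduce_append: "reduce (v @ w) = foldr cancel_cons v (reduce w)"
  by (simp add: reduce_def)

lemma length_cancel_cons: "length (cancel_cons x w) \<le> Suc (length w)"
  by (cases w) (auto simp: cancel_cons_Cons)

lemma length_reduce: "length (reduce w) \<le> length w"
proof (induction w)
  case (Cons x w)
  then show ?case
    using length_cancel_cons [of x "reduce w"] by (simp add: reduce_Cons)
qed simp

lemma reduced_tl:
  assumes "reduce (x # w) = x # w"
  shows "reduce w = w"
proof (cases "reduce w")
  case Nil
  then show ?thesis using assms by (simp add: reduce_Cons)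
next
  case (Cons y v)
  \<comment> \<open>If \<open>x\<close> cancelled against the first letter of
    \<open>reduce w\<close>, then \<open>reduce w\<close> would be longer than
    \<open>w\<close>.\<close>
  then show ?thesis
    using assms length_reduce [of w] by (auto simp: reduce_Cons cancel_cons_Cons split: if_splits)
qed

lemma reduced_cancel_cons: "reduce w = w \<Longrightarrow> reduce (cancel_cons x w) = cancel_cons x w"
proof (cases w)
  case (Cons y v)
  then show "reduce w = w \<Longrightarrow> ?thesis"
    using reduced_tl [of y v] by (auto simp: cancel_cons_Cons reduce_Cons)
qed (simp add: reduce_Cons)

lemma reduce_reduce [simp]: "reduce (reduce w) = reduce w"
  by (induction w) (simp_all add: reduce_Cons reduced_cancel_cons)

lemma cancel_cons_flip:
  assumes "reduce w = w"
  shows "cancel_cons x (cancel_cons (flip x) w) = w"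
proof (cases w)
  case Nil
  then show ?thesis by (simp add: cancel_cons_Cons)
next
  case (Cons y v)
  \<comment> \<open>If \<open>flip x\<close> cancels the first letter \<open>y\<close>, then
    \<open>y = x\<close>, and as \<open>w\<close> is reduced, putting \<open>x\<close> back in front
    of \<open>v\<close> cancels nothing.\<close>
  then show ?thesis
    using assms reduced_tl [of y v] reduce_Cons [of y v] by (auto simp: cancel_cons_Cons)
qed

lemma reduce_flip: "reduce (x # flip x # w) = reduce w"
  by (simp add: reduce_Cons cancel_cons_flip)

text \<open>Reduction proceeds from the right, and each step either prefixes a letter or removes a
  cancelling pair at the front; the two assumptions cover these cases. This is the form in which the
  universal property of the free group enters: for the product itself, for exponent sums, for
  extended automorphisms and for the Magnus expansion.\<close>

lemma reduce_invariant:
  assumes cancel: "\<And>x w. \<Phi> (x # flip x # w) = \<Phi> w"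
    and cong: "\<And>x v w. \<Phi> v = \<Phi> w \<Longrightarrow> \<Phi> (x # v) = \<Phi> (x # w)"
  shows "\<Phi> (reduce w) = \<Phi> w"
proof (induction w)
  case (Cons x w)
  have "\<Phi> (cancel_cons x v) = \<Phi> (x # v)" for v
    by (cases v) (auto simp: cancel_cons_Cons cancel)
  then show ?case using cong [OF Cons] by (simp add: reduce_Cons)
qed simp

lemma reduce_append_right: "reduce (v @ reduce w) = reduce (v @ w)"
  by (simp add: reduce_append)

lemma reduce_append_left: "reduce (reduce v @ w) = reduce (v @ w)"
  by (rule reduce_invariant [of "\<lambda>v. reduce (v @ w)"]) (simp_all add: reduce_Cons cancel_cons_flip)

lemma set_reduce: "set (reduce w) \<subseteq> set w"
proof (induction w)
  case (Cons x w)
  moreover have "set (cancel_cons x v) \<subseteq> insert x (set v)" for v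
    by (cases v) (auto simp: cancel_cons_Cons)
  ultimately show ?case by (auto simp: reduce_Cons)
qed simp

lemma reduce_inverse: "reduce (rev (map flip w) @ w) = []"
proof (induction w)
  case (Cons x w)
  then show ?case
    using reduce_flip [of "flip x" w] by (simp add: reduce_append)
qed simp

lemma carrier_free_group: "w \<in> carrier (free_group n) \<longleftrightarrow> reduce w = w \<and> fst ` set w \<subseteq> {..<n}"
  by (simp add: free_group_def)

lemma mult_free_group: "v \<otimes>\<^bsub>free_group n\<^esub> w = reduce (v @ w)"
  by (simp add: free_group_def)

lemma one_free_group: "\<one>\<^bsub>free_group n\<^esub> = []"
  by (simp add: free_group_def)

lemma reduce_carrier: "fst ` set w \<subseteq> {..<n} \<Longrightarrow> reduce w \<in> carrier (free_group n)"
  using set_reduce [of w] by (auto simp: carrier_free_group)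

lemma group_free_group: "group (free_group n)"
proof (rule groupI)
  fix u v w
  assume u: "u \<in> carrier (free_group n)" and v: "v \<in> carrier (free_group n)"
  show "u \<otimes>\<^bsub>free_group n\<^esub> v \<in> carrier (free_group n)"
    using u v unfolding mult_free_group by (intro reduce_carrier) (auto simp: carrier_free_group)
  show "u \<otimes>\<^bsub>free_group n\<^esub> v \<otimes>\<^bsub>free_group n\<^esub> w = u \<otimes>\<^bsub>free_group n\<^esub> (v \<otimes>\<^bsub>free_group n\<^esub> w)"
    by (simp add: mult_free_group reduce_append_left reduce_append_right)
  show "\<one>\<^bsub>free_group n\<^esub> \<otimes>\<^bsub>free_group n\<^esub> u = u"
    using u by (simp add: mult_free_group one_free_group carrier_free_group)
  have "reduce (rev (map flip u)) \<in> carrier (free_group n)"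
    using u by (intro reduce_carrier) (auto simp: carrier_free_group)
  moreover have "reduce (rev (map flip u)) \<otimes>\<^bsub>free_group n\<^esub> u = \<one>\<^bsub>free_group n\<^esub>"
    by (simp add: mult_free_group one_free_group reduce_append_left reduce_inverse)
  ultimately show "\<exists>y\<in>carrier (free_group n). y \<otimes>\<^bsub>free_group n\<^esub> u = \<one>\<^bsub>free_group n\<^esub>"
    by blast
qed (simp add: one_free_group carrier_free_group)

lemma letter_carrier: "fst x < n \<Longrightarrow> [x] \<in> carrier (free_group n)"
  by (simp add: carrier_free_group reduce_Cons)

text \<open>A tail of a reduced word is reduced, so prefixing its letter again is a product in the
  group without cancellation. The third premise records this so that homomorphisms can be evaluated
  letter by letter.\<close>

lemma free_group_induct [consumes 1, case_names Nil Cons]: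
  assumes "w \<in> carrier (free_group n)" and "P []"
    and "\<And>x w. fst x < n \<Longrightarrow> w \<in> carrier (free_group n) \<Longrightarrow>
      [x] \<otimes>\<^bsub>free_group n\<^esub> w = x # w \<Longrightarrow> P w \<Longrightarrow> P (x # w)"
  shows "P w"
  using assms(1)
proof (induction w)
  case (Cons x w)
  have "w \<in> carrier (free_group n)"
    using Cons.prems reduced_tl [of x w] by (auto simp: carrier_free_group)
  then show ?case
    using Cons by (intro assms(3)) (auto simp: mult_free_group carrier_free_group)
qed (rule assms(2))

lemma letter_flip_mult: "[x] \<otimes>\<^bsub>free_group n\<^esub> [flip x] = \<one>\<^bsub>free_group n\<^esub>"
  by (simp add: mult_free_group one_free_group reduce_flip)

lemma inv_letter: "fst x < n \<Longrightarrow> inv\<^bsub>free_group n\<^esub> [x] = [flip x]"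
  using letter_flip_mult [of n "flip x"]
  by (intro group.inv_equality [OF group_free_group]) (simp_all add: letter_carrier)

lemma free_hom_eq:
  assumes H: "group H" and f: "f \<in> hom (free_group n) H" and g: "g \<in> hom (free_group n) H"
    and eq: "\<And>i. i < n \<Longrightarrow> f (gen i) = g (gen i)"
    and w: "w \<in> carrier (free_group n)"
  shows "f w = g w"
proof -
  interpret f: group_hom "free_group n" H f
    using H f by (simp add: group_hom_def group_hom_axioms_def group_free_group)
  interpret g: group_hom "free_group n" H g
    using H g by (simp add: group_hom_def group_hom_axioms_def group_free_group)
  have letter: "f [x] = g [x]" if "fst x < n" for x
  proof (cases "snd x")
    case True
    then have "x = (fst x, True)" by (simp add: prod_eq_iff)
    then show ?thesis using eq [OF that] by metis
  next
    case False
    then have "[x] = inv\<^bsub>free_group n\<^esub> gen (fst x)"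
      using that by (simp add: inv_letter flip_def prod_eq_iff)
    then show ?thesis using eq [OF that] that by (simp add: letter_carrier)
  qed
  from w show ?thesis
  proof (induction w rule: free_group_induct)
    case Nil
    then show ?case using f.hom_one g.hom_one by (simp add: one_free_group)
  next
    case (Cons x w)
    then show ?case
      using f.hom_mult [of "[x]" w] g.hom_mult [of "[x]" w] letter [of x] by (simp add: letter_carrier)
  qed
qed

section \<open>Exponent sums and additive functions\<close>

lemma ab_coord_Nil [simp]: "ab_coord [] i = 0"
  by (simp add: ab_coord_def)

lemma ab_coord_Cons:
  "ab_coord (x # w) i = (if fst x = i then if snd x then 1 else - 1 else 0) + ab_coord w i"
  by (simp add: ab_coord_def)

lemma ab_coord_append: "ab_coord (v @ w) i = ab_coord v i + ab_coord w i"
  by (simp add: ab_coord_def)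

lemma ab_coord_reduce: "ab_coord (reduce w) i = ab_coord w i"
  by (rule reduce_invariant) (auto simp: ab_coord_Cons)

lemma ab_coord_mult: "ab_coord (v \<otimes>\<^bsub>free_group n\<^esub> w) i = ab_coord v i + ab_coord w i"
  by (simp add: mult_free_group ab_coord_reduce ab_coord_append)

lemma ab_coord_gen: "ab_coord (gen k) i = (if k = i then 1 else 0)"
  by (simp add: ab_coord_Cons)

lemma ab_coord_off: "w \<in> carrier (free_group n) \<Longrightarrow> n \<le> i \<Longrightarrow> ab_coord w i = 0"
  by (induction w rule: free_group_induct) (auto simp: ab_coord_Cons)

text \<open>An additive function factors through the abelianisation, where the exponent sums are the
  coordinates of a class in the basis of generators. This is what turns values prescribed on
  generators into a linear map on \<open>H\<close>.\<close>

lemma additive_free_group: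
  fixes F :: "letter list \<Rightarrow> 'k::{comm_ring, comm_monoid_mult}"
  assumes F: "\<And>v w. v \<in> carrier (free_group n) \<Longrightarrow> w \<in> carrier (free_group n) \<Longrightarrow>
      F (v \<otimes>\<^bsub>free_group n\<^esub> w) = F v + F w"
    and w: "w \<in> carrier (free_group n)"
  shows "F w = (\<Sum>k<n. ab_coord w k * F (gen k))"
proof -
  have "F [] = F [] + F []"
    using F [of "[]" "[]"] by (simp add: mult_free_group carrier_free_group)
  then have Nil: "F [] = 0" by simp
  have letter: "F [x] = (if snd x then 1 else - 1) * F (gen (fst x))" if x: "fst x < n" for x
  proof (cases "snd x")
    case True
    then have "x = (fst x, True)" by (simp add: prod_eq_iff)
    with True show ?thesis by (metis mult_1)
  next
    case False
    then have "flip x = (fst x, True)" by (simp add: flip_def)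
    moreover have "F [x] + F [flip x] = 0"
      using F [of "[x]" "[flip x]"] x Nil
      by (simp add: letter_carrier letter_flip_mult one_free_group)
    ultimately have "F [x] = - F (gen (fst x))"
      by (simp add: eq_neg_iff_add_eq_0)
    then show ?thesis using False by simp
  qed
  from w show ?thesis
  proof (induction w rule: free_group_induct)
    case Nil
    then show ?case by (simp add: \<open>F [] = 0\<close>)
  next
    case (Cons x w)
    have "(\<Sum>k<n. ab_coord (x # w) k * F (gen k))
        = (\<Sum>k<n. if k = fst x then (if snd x then 1 else - 1) * F (gen k) else 0)
          + (\<Sum>k<n. ab_coord w k * F (gen k))"
      unfolding sum.distrib [symmetric]
      by (rule sum.cong) (auto simp: ab_coord_Cons algebra_simps)
    also have "\<dots> = F [x] + F w"
      using Cons by (simp add: letter [of x] sum.delta')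
    also have "\<dots> = F (x # w)"
      using F [of "[x]" w] Cons by (simp add: letter_carrier)
    finally show ?case by simp
  qed
qed

section \<open>Automorphisms of free groups and their stabilisation\<close>

lemma carrier_Aut:
  "\<psi> \<in> carrier (Aut n) \<longleftrightarrow> \<psi> \<in> hom (free_group n) (free_group n) \<and>
    \<psi> \<in> extensional (carrier (free_group n)) \<and>
    bij_betw \<psi> (carrier (free_group n)) (carrier (free_group n))"
  by (auto simp: AutoGroup_def auto_def Bij_def)

lemma group_Aut: "group (Aut n)"
  by (rule group.AutoGroup [OF group_free_group])

lemma Aut_hom: "\<psi> \<in> carrier (Aut n) \<Longrightarrow> \<psi> \<in> hom (free_group n) (free_group n)"
  by (simp add: carrier_Aut)

lemma Aut_closed:
  "\<psi> \<in> carrier (Aut n) \<Longrightarrow> w \<in> carrier (free_group n) \<Longrightarrow> \<psi> w \<in> carrier (free_group n)"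
  by (auto simp: carrier_Aut hom_def)

lemma Aut_apply_mult:
  "\<psi> \<in> carrier (Aut n) \<Longrightarrow> v \<in> carrier (free_group n) \<Longrightarrow> w \<in> carrier (free_group n) \<Longrightarrow>
    \<psi> (v \<otimes>\<^bsub>free_group n\<^esub> w) = \<psi> v \<otimes>\<^bsub>free_group n\<^esub> \<psi> w"
  by (auto simp: carrier_Aut hom_def)

lemma mult_Aut:
  "\<psi> \<in> carrier (Aut n) \<Longrightarrow> \<phi> \<in> carrier (Aut n) \<Longrightarrow>
    \<psi> \<otimes>\<^bsub>Aut n\<^esub> \<phi> = compose (carrier (free_group n)) \<psi> \<phi>"
  by (auto simp: AutoGroup_def auto_def BijGroup_def)

lemma mult_Aut_apply:
  "\<psi> \<in> carrier (Aut n) \<Longrightarrow> \<phi> \<in> carrier (Aut n) \<Longrightarrow> w \<in> carrier (free_group n) \<Longrightarrow>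
    (\<psi> \<otimes>\<^bsub>Aut n\<^esub> \<phi>) w = \<psi> (\<phi> w)"
  by (simp add: mult_Aut compose_def)

lemma one_Aut_apply: "w \<in> carrier (free_group n) \<Longrightarrow> \<one>\<^bsub>Aut n\<^esub> w = w"
  by (simp add: AutoGroup_def BijGroup_def)

lemma inv_Aut_closed: "\<psi> \<in> carrier (Aut n) \<Longrightarrow> inv\<^bsub>Aut n\<^esub> \<psi> \<in> carrier (Aut n)"
  by (rule group.inv_closed [OF group_Aut])

lemma Aut_apply_inv:
  "\<psi> \<in> carrier (Aut n) \<Longrightarrow> w \<in> carrier (free_group n) \<Longrightarrow> \<psi> ((inv\<^bsub>Aut n\<^esub> \<psi>) w) = w"
  using group.r_inv [OF group_Aut, of \<psi> n]
  by (metis mult_Aut_apply one_Aut_apply inv_Aut_closed)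

lemma ab_coord_Aut:
  assumes "\<psi> \<in> carrier (Aut n)" "w \<in> carrier (free_group n)"
  shows "(ab_coord (\<psi> w) i :: 'k::{comm_ring, comm_monoid_mult})
    = (\<Sum>k<n. ab_coord w k * ab_coord (\<psi> (gen k)) i)"
  using assms by (intro additive_free_group) (simp_all add: Aut_apply_mult ab_coord_mult)

text \<open>The substitution before reduction. Unlike \<open>aut_ext\<close> it is compatible with
  concatenation of arbitrary words, so that cancellation can be treated separately.\<close>

definition ext_word :: "nat \<Rightarrow> (letter list \<Rightarrow> letter list) \<Rightarrow> letter list \<Rightarrow> letter list" where
  "ext_word n \<psi> w = concat (map (\<lambda>x. if fst x < n then \<psi> [x] else [x]) w)"

lemma ext_word_simps:
  "ext_word n \<psi> [] = []"
  "ext_word n \<psi> (x # w) = (if fst x < n then \<psi> [x] else [x]) @ ext_word n \<psi> w"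
  "ext_word n \<psi> (v @ w) = ext_word n \<psi> v @ ext_word n \<psi> w"
  by (simp_all add: ext_word_def)

lemma aut_ext_eq:
  "aut_ext n \<psi> = (\<lambda>w \<in> carrier (free_group (Suc n)). reduce (ext_word n \<psi> w))"
  by (simp add: aut_ext_def ext_word_def)

lemma reduce_ext_word:
  assumes \<psi>: "\<psi> \<in> carrier (Aut n)"
  shows "reduce (ext_word n \<psi> (reduce w)) = reduce (ext_word n \<psi> w)"
proof (rule reduce_invariant [of "\<lambda>w. reduce (ext_word n \<psi> w)"])
  fix x v w
  show "reduce (ext_word n \<psi> (x # flip x # w)) = reduce (ext_word n \<psi> w)"
  proof (cases "fst x < n")
    case True
    then have "reduce (\<psi> [x] @ \<psi> [flip x]) = \<psi> ([x] \<otimes>\<^bsub>free_group n\<^esub> [flip x])"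
      using \<psi> by (simp add: Aut_apply_mult letter_carrier mult_free_group [symmetric])
    also have "\<dots> = []"
      using hom_one [OF Aut_hom [OF \<psi>] group_free_group group_free_group]
      by (simp add: letter_flip_mult one_free_group)
    finally show ?thesis
      using True reduce_append_left [of "\<psi> [x] @ \<psi> [flip x]" "ext_word n \<psi> w"]
      by (simp add: ext_word_simps)
  qed (simp add: ext_word_simps reduce_flip)
  show "reduce (ext_word n \<psi> (x # v)) = reduce (ext_word n \<psi> (x # w))"
    if "reduce (ext_word n \<psi> v) = reduce (ext_word n \<psi> w)"
    using that by (simp add: ext_word_simps reduce_append)
qed

lemma free_group_mono: "w \<in> carrier (free_group n) \<Longrightarrow> w \<in> carrier (free_group (Suc n))"
  by (auto simp: carrier_free_group)

lemma ext_word_letters: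
  assumes \<psi>: "\<psi> \<in> carrier (Aut n)"
  shows "fst ` set w \<subseteq> {..<Suc n} \<Longrightarrow> fst ` set (ext_word n \<psi> w) \<subseteq> {..<Suc n}"
proof (induction w)
  case (Cons x w)
  have "fst ` set (\<psi> [x]) \<subseteq> {..<Suc n}" if "fst x < n"
    using free_group_mono [OF Aut_closed [OF \<psi> letter_carrier [OF that]]]
    by (simp add: carrier_free_group)
  with Cons show ?case by (auto simp: ext_word_simps)
qed (simp add: ext_word_simps)

lemma aut_ext_closed:
  assumes "\<psi> \<in> carrier (Aut n)" "w \<in> carrier (free_group (Suc n))"
  shows "aut_ext n \<psi> w \<in> carrier (free_group (Suc n))"
  using assms(2) reduce_carrier [OF ext_word_letters [OF assms(1), of w]]
  by (simp add: aut_ext_eq carrier_free_group [of w])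

lemma aut_ext_hom:
  assumes \<psi>: "\<psi> \<in> carrier (Aut n)"
  shows "aut_ext n \<psi> \<in> hom (free_group (Suc n)) (free_group (Suc n))"
proof (rule homI)
  fix v w
  assume vw: "v \<in> carrier (free_group (Suc n))" "w \<in> carrier (free_group (Suc n))"
  then have "v \<otimes>\<^bsub>free_group (Suc n)\<^esub> w \<in> carrier (free_group (Suc n))"
    by (simp add: group.is_monoid group_free_group monoid.m_closed)
  with vw show "aut_ext n \<psi> (v \<otimes>\<^bsub>free_group (Suc n)\<^esub> w)
      = aut_ext n \<psi> v \<otimes>\<^bsub>free_group (Suc n)\<^esub> aut_ext n \<psi> w"
    by (simp add: aut_ext_eq mult_free_group reduce_ext_word [OF \<psi>] ext_word_simps
        reduce_append_left reduce_append_right)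
qed (rule aut_ext_closed [OF \<psi>])

lemma aut_ext_letter:
  assumes "\<psi> \<in> carrier (Aut n)" "fst x < n"
  shows "aut_ext n \<psi> [x] = \<psi> [x]"
  using Aut_closed [OF assms(1) letter_carrier [OF assms(2)]] assms(2)
    letter_carrier [of x "Suc n"]
  by (simp add: aut_ext_eq ext_word_simps carrier_free_group)

lemma aut_ext_last: "aut_ext n \<psi> (gen n) = gen n"
  using letter_carrier [of "(n, True)" "Suc n"] by (simp add: aut_ext_eq ext_word_simps reduce_Cons)

lemma aut_ext_apply:
  assumes \<psi>: "\<psi> \<in> carrier (Aut n)" and w: "w \<in> carrier (free_group n)"
  shows "aut_ext n \<psi> w = \<psi> w"
proof (rule free_hom_eq [OF group_free_group _ _ _ w])
  show "aut_ext n \<psi> \<in> hom (free_group n) (free_group (Suc n))"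
    using aut_ext_hom [OF \<psi>] free_group_mono by (auto simp: hom_def mult_free_group)
  show "\<psi> \<in> hom (free_group n) (free_group (Suc n))"
    using Aut_hom [OF \<psi>] free_group_mono by (auto simp: hom_def mult_free_group)
qed (simp add: aut_ext_letter [OF \<psi>])

lemma aut_ext_compose:
  assumes \<psi>: "\<psi> \<in> carrier (Aut n)" and \<phi>: "\<phi> \<in> carrier (Aut n)"
    and w: "w \<in> carrier (free_group (Suc n))"
  shows "aut_ext n (\<psi> \<otimes>\<^bsub>Aut n\<^esub> \<phi>) w = aut_ext n \<psi> (aut_ext n \<phi> w)"
proof (rule free_hom_eq [OF group_free_group _ _ _ w])
  have \<psi>\<phi>: "\<psi> \<otimes>\<^bsub>Aut n\<^esub> \<phi> \<in> carrier (Aut n)"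
    using \<psi> \<phi> by (simp add: group.is_monoid [OF group_Aut] monoid.m_closed)
  show "aut_ext n (\<psi> \<otimes>\<^bsub>Aut n\<^esub> \<phi>) \<in> hom (free_group (Suc n)) (free_group (Suc n))"
    by (rule aut_ext_hom [OF \<psi>\<phi>])
  show "(\<lambda>w. aut_ext n \<psi> (aut_ext n \<phi> w)) \<in> hom (free_group (Suc n)) (free_group (Suc n))"
    using aut_ext_hom [OF \<psi>] aut_ext_hom [OF \<phi>] by (auto simp: hom_def)
  fix i assume "i < Suc n"
  then show "aut_ext n (\<psi> \<otimes>\<^bsub>Aut n\<^esub> \<phi>) (gen i) = aut_ext n \<psi> (aut_ext n \<phi> (gen i))"
    by (cases "i = n") (simp_all add: aut_ext_last aut_ext_letter \<psi> \<phi> \<psi>\<phi> mult_Aut_apply letter_carrier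
        aut_ext_apply Aut_closed)
qed

lemma aut_ext_one:
  assumes w: "w \<in> carrier (free_group (Suc n))"
  shows "aut_ext n \<one>\<^bsub>Aut n\<^esub> w = w"
proof (rule free_hom_eq [OF group_free_group _ _ _ w])
  have one: "\<one>\<^bsub>Aut n\<^esub> \<in> carrier (Aut n)"
    by (simp add: group.is_monoid [OF group_Aut] monoid.one_closed)
  show "aut_ext n \<one>\<^bsub>Aut n\<^esub> \<in> hom (free_group (Suc n)) (free_group (Suc n))"
    by (rule aut_ext_hom [OF one])
  show "(\<lambda>w. w) \<in> hom (free_group (Suc n)) (free_group (Suc n))"
    by (simp add: hom_def)
  fix i assume "i < Suc n"
  then show "aut_ext n \<one>\<^bsub>Aut n\<^esub> (gen i) = gen i"
    by (cases "i = n") (simp_all add: aut_ext_last aut_ext_letter one one_Aut_apply letter_carrier)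
qed

lemma aut_ext_Aut:
  assumes \<psi>: "\<psi> \<in> carrier (Aut n)"
  shows "aut_ext n \<psi> \<in> carrier (Aut (Suc n))"
proof -
  let ?C = "carrier (free_group (Suc n))"
  have "bij_betw (aut_ext n \<psi>) ?C ?C"
  proof (rule bij_betw_byWitness [where f' = "aut_ext n (inv\<^bsub>Aut n\<^esub> \<psi>)"])
    show "\<forall>w\<in>?C. aut_ext n (inv\<^bsub>Aut n\<^esub> \<psi>) (aut_ext n \<psi> w) = w"
      using \<psi> by (simp add: aut_ext_compose [symmetric] inv_Aut_closed group.l_inv [OF group_Aut] aut_ext_one)
    show "\<forall>w\<in>?C. aut_ext n \<psi> (aut_ext n (inv\<^bsub>Aut n\<^esub> \<psi>) w) = w"
      using \<psi> by (simp add: aut_ext_compose [symmetric] inv_Aut_closed group.r_inv [OF group_Aut] aut_ext_one)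
  qed (use \<psi> in \<open>auto simp: aut_ext_closed inv_Aut_closed\<close>)
  then show ?thesis
    using aut_ext_hom [OF \<psi>] by (simp add: carrier_Aut) (simp add: aut_ext_eq)
qed

lemma aut_ext_mult:
  assumes "\<psi> \<in> carrier (Aut n)" "\<phi> \<in> carrier (Aut n)"
  shows "aut_ext n (\<psi> \<otimes>\<^bsub>Aut n\<^esub> \<phi>) = aut_ext n \<psi> \<otimes>\<^bsub>Aut (Suc n)\<^esub> aut_ext n \<phi>"
proof
  fix w
  show "aut_ext n (\<psi> \<otimes>\<^bsub>Aut n\<^esub> \<phi>) w = (aut_ext n \<psi> \<otimes>\<^bsub>Aut (Suc n)\<^esub> aut_ext n \<phi>) w"
  proof (cases "w \<in> carrier (free_group (Suc n))")
    case True
    with assms show ?thesis by (simp add: aut_ext_compose mult_Aut_apply aut_ext_Aut)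
  next
    case False
    with assms show ?thesis
      by (simp add: mult_Aut aut_ext_Aut compose_def) (simp add: aut_ext_eq)
  qed
qed

lemma aut_ext_group_hom: "group_hom (Aut n) (Aut (Suc n)) (aut_ext n)"
  by (auto simp: group_hom_def group_hom_axioms_def group_Aut intro!: homI aut_ext_Aut aut_ext_mult)

lemmas aut_ext_inv = group_hom.hom_inv [OF aut_ext_group_hom, symmetric]
lemmas aut_ext_hom_one = group_hom.hom_one [OF aut_ext_group_hom]

section \<open>Equivariance of tensor operations\<close>

lemma finite_words [simp]: "finite (words n q)"
  using finite_lists_length_eq [of "{..<n}" q] by (simp add: words_def conj_commute)

lemma words_0: "words n 0 = {[]}"
  by (auto simp: words_def)

lemma words_Cons: "x # w \<in> words n (Suc q) \<longleftrightarrow> x < n \<and> w \<in> words n q"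
  by (auto simp: words_def)

lemma Nil_words: "[] \<notin> words n (Suc q)"
  by (simp add: words_def)

lemma words_1: "words n (Suc 0) = (\<lambda>k. [k]) ` {..<n}"
  by (auto simp: words_def length_Suc_conv)

lemma words_mono: "words n q \<subseteq> words (Suc n) q"
  by (auto simp: words_def)

lemma words_append_iff: "w \<in> words n (q + r) \<longleftrightarrow> take q w \<in> words n q \<and> drop q w \<in> words n r"
  using set_append [of "take q w" "drop q w"] by (auto simp: words_def simp del: set_append)

lemma sum_words_append:
  "(\<Sum>w\<in>words n (q + r). F w) = (\<Sum>u\<in>words n q. \<Sum>v\<in>words n r. F (u @ v))"
proof -
  have "(\<Sum>u\<in>words n q. \<Sum>v\<in>words n r. F (u @ v)) = (\<Sum>(u, v)\<in>words n q \<times> words n r. F (u @ v))"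
    by (simp add: sum.cartesian_product)
  also have "\<dots> = (\<Sum>w\<in>words n (q + r). F w)"
    by (rule sum.reindex_bij_witness [of _ "\<lambda>w. (take q w, drop q w)" "\<lambda>(u, v). u @ v"])
      (auto simp: words_def dest: in_set_takeD in_set_dropD)
  finally show ?thesis by simp
qed

lemma sum_words_1: "(\<Sum>w\<in>words n (Suc 0). F w) = (\<Sum>k<n. F [k])"
  by (simp add: words_1 sum.reindex inj_on_def)

lemma sum_words_Suc: "(\<Sum>w\<in>words n (Suc q). F w) = (\<Sum>k<n. \<Sum>v\<in>words n q. F (k # v))"
  using sum_words_append [of F n "Suc 0" q] by (simp add: sum_words_1)

section \<open>Arrays as linear maps\<close>

lemma arrays_iff: "T \<in> arrays n q l \<longleftrightarrow> (\<forall>b a. b \<notin> words n q \<or> a \<notin> words n l \<longrightarrow> T b a = 0)"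
  by (auto simp: arrays_def truncate_def fun_eq_iff)

lemma arrays_off: "T \<in> arrays n q l \<Longrightarrow> b \<notin> words n q \<or> a \<notin> words n l \<Longrightarrow> T b a = 0"
  by (simp add: arrays_iff)

lemma truncate_arrays: "truncate n q l T \<in> arrays n q l"
  by (auto simp: arrays_iff truncate_def)

lemma truncate_apply: "b \<in> words n q \<Longrightarrow> a \<in> words n l \<Longrightarrow> truncate n q l T b a = T b a"
  by (simp add: truncate_def)

lemma truncate_array: "T \<in> arrays n q l \<Longrightarrow> truncate n q l T = T"
  by (simp add: arrays_def)

lemma comp_arr_add_left: "comp_arr n r (S + S') T = comp_arr n r S T + comp_arr n r S' T"
  and comp_arr_add_right: "comp_arr n r S (T + T') = comp_arr n r S T + comp_arr n r S T'"
  by (simp_all add: comp_arr_def fun_eq_iff distrib_left distrib_right sum.distrib)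

lemma tensor_arr_add_left: "tensor_arr q l (S + S') T = tensor_arr q l S T + tensor_arr q l S' T"
  and tensor_arr_add_right: "tensor_arr q l S (T + T') = tensor_arr q l S T + tensor_arr q l S T'"
  by (simp_all add: tensor_arr_def fun_eq_iff distrib_left distrib_right)

lemma comp_arr_assoc: "comp_arr n r S (comp_arr n s T U) = comp_arr n s (comp_arr n r S T) U"
proof (intro ext)
  fix b a :: "nat list"
  have "comp_arr n r S (comp_arr n s T U) b a
      = (\<Sum>c\<in>words n r. \<Sum>d\<in>words n s. S b c * T c d * U d a)"
    by (simp add: comp_arr_def sum_distrib_left mult.assoc)
  also have "\<dots> = (\<Sum>d\<in>words n s. \<Sum>c\<in>words n r. S b c * T c d * U d a)"
    by (rule sum.swap)
  also have "\<dots> = comp_arr n s (comp_arr n r S T) U b a"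
    by (simp add: comp_arr_def sum_distrib_right)
  finally show "comp_arr n r S (comp_arr n s T U) b a = comp_arr n s (comp_arr n r S T) U b a" .
qed

lemma comp_arrays: "S \<in> arrays n q r \<Longrightarrow> T \<in> arrays n s l \<Longrightarrow> comp_arr n r' S T \<in> arrays n q l"
  by (auto simp: arrays_iff comp_arr_def)

lemma tensor_arrays:
  "S \<in> arrays n q l \<Longrightarrow> T \<in> arrays n q' l' \<Longrightarrow> tensor_arr q l S T \<in> arrays n (q + q') (l + l')"
  by (auto simp: arrays_iff tensor_arr_def words_append_iff)

lemma id_arrays: "id_arr n q \<in> arrays n q q"
  by (simp add: id_arr_def truncate_arrays)

lemma id_arr_apply: "c \<in> words n q \<Longrightarrow> id_arr n q b c = (if b = c then 1 else 0)"
  "b \<in> words n q \<Longrightarrow> id_arr n q b c = (if b = c then 1 else 0)"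
  by (auto simp: id_arr_def truncate_def)

lemma comp_id_left:
  assumes "T \<in> arrays n q l"
  shows "comp_arr n q (id_arr n q) T = T"
proof (intro ext)
  fix b a :: "nat list"
  have "comp_arr n q (id_arr n q) T b a = (\<Sum>c\<in>words n q. if b = c then T c a else 0)"
    unfolding comp_arr_def by (rule sum.cong) (auto simp: id_arr_apply)
  then show "comp_arr n q (id_arr n q) T b a = T b a"
    using assms by (auto simp: arrays_iff)
qed

lemma comp_id_right:
  assumes "T \<in> arrays n q l"
  shows "comp_arr n l T (id_arr n l) = T"
proof (intro ext)
  fix b a :: "nat list"
  have "comp_arr n l T (id_arr n l) b a = (\<Sum>c\<in>words n l. if c = a then T b c else 0)"
    unfolding comp_arr_def by (rule sum.cong) (auto simp: id_arr_apply)
  then show "comp_arr n l T (id_arr n l) b a = T b a"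
    using assms by (auto simp: arrays_iff)
qed

lemma tensor_id: "tensor_arr q q (id_arr n q) (id_arr n r) = id_arr n (q + r)"
proof (intro ext)
  fix b a :: "nat list"
  have "b = a \<longleftrightarrow> take q b = take q a \<and> drop q b = drop q a"
    by (metis append_take_drop_id)
  then show "tensor_arr q q (id_arr n q) (id_arr n r) b a = id_arr n (q + r) b a"
    by (auto simp: tensor_arr_def id_arr_def truncate_def words_append_iff)
qed

text \<open>The interchange law. Arrays are plain linear maps without a degree, so it carries no
  sign.\<close>

lemma tensor_comp:
  "comp_arr n (r + r') (tensor_arr q r S S') (tensor_arr r l T T')
    = tensor_arr q l (comp_arr n r S T) (comp_arr n r' S' T')"
proof (intro ext)
  fix b a :: "nat list"
  have "comp_arr n (r + r') (tensor_arr q r S S') (tensor_arr r l T T') b a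
    = (\<Sum>u\<in>words n r. \<Sum>v\<in>words n r'.
        (S (take q b) u * T u (take l a)) * (S' (drop q b) v * T' v (drop l a)))"
    unfolding comp_arr_def sum_words_append
    by (intro sum.cong refl) (simp add: tensor_arr_def words_def mult_ac)
  then show "comp_arr n (r + r') (tensor_arr q r S S') (tensor_arr r l T T') b a
      = tensor_arr q l (comp_arr n r S T) (comp_arr n r' S' T') b a"
    by (simp add: tensor_arr_def comp_arr_def sum_product)
qed

section \<open>Induced maps on tensor powers\<close>

lemma ind_pow_arrays: "ind_pow n q \<psi> \<in> arrays n q q"
  by (simp add: ind_pow_def truncate_arrays)

lemma ind_pow_0: "ind_pow n 0 \<psi> b a = (if b = [] \<and> a = [] then 1 else 0)"
  by (simp add: ind_pow_def truncate_def words_0)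

lemma ind_pow_Cons:
  "ind_pow n (Suc q) \<psi> (x # b) (y # a)
    = (if x < n \<and> y < n then ab_coord (\<psi> (gen y)) x * ind_pow n q \<psi> b a else 0)"
  by (simp add: ind_pow_def truncate_def words_Cons prod.lessThan_Suc_shift del: prod.lessThan_Suc)

lemma ind_pow_tensor: "tensor_arr 1 1 (ind_pow n 1 \<psi>) (ind_pow n q \<psi>) = ind_pow n (Suc q) \<psi>"
proof (intro ext)
  fix b a :: "nat list"
  show "tensor_arr 1 1 (ind_pow n 1 \<psi>) (ind_pow n q \<psi>) b a = ind_pow n (Suc q) \<psi> b a"
  proof (cases "b = [] \<or> a = []")
    case True
    then show ?thesis
      by (auto simp: tensor_arr_def Nil_words arrays_off [OF ind_pow_arrays])
  next
    case False
    then obtain x b' y a' where "b = x # b'" "a = y # a'" by (auto simp: neq_Nil_conv)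
    then show ?thesis by (simp add: tensor_arr_def ind_pow_Cons ind_pow_0)
  qed
qed

lemma tensor_arr_assoc:
  "tensor_arr q l S (tensor_arr q' l' T U) = tensor_arr (q + q') (l + l') (tensor_arr q l S T) U"
  by (intro ext) (simp add: tensor_arr_def drop_take mult.assoc add.commute)

lemma ind_pow_0_id: "ind_pow n 0 \<psi> = id_arr n 0"
  by (auto simp: fun_eq_iff ind_pow_0 id_arr_def truncate_def words_0)

lemma tensor_id_0: "T \<in> arrays n q l \<Longrightarrow> tensor_arr 0 0 (id_arr n 0) T = T"
  by (simp add: tensor_arr_def id_arr_def truncate_def words_0 fun_eq_iff)

lemma ind_pow_add:
  "tensor_arr q q (ind_pow n q \<psi>) (ind_pow n r \<psi>)
    = (ind_pow n (q + r) \<psi> :: 'k::{comm_ring, comm_monoid_mult} arr)"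
proof (induction q)
  case 0
  then show ?case by (simp add: ind_pow_0_id tensor_id_0 [OF ind_pow_arrays])
next
  case (Suc q)
  have "tensor_arr (Suc q) (Suc q) (ind_pow n (Suc q) \<psi>) (ind_pow n r \<psi> :: 'k arr)
      = tensor_arr 1 1 (ind_pow n 1 \<psi>) (tensor_arr q q (ind_pow n q \<psi>) (ind_pow n r \<psi>))"
    unfolding tensor_arr_assoc by (simp add: ind_pow_tensor [simplified])
  then show ?case by (simp add: Suc ind_pow_tensor [simplified])
qed

lemma comp_0_0: "comp_arr n 0 (id_arr n 0) (id_arr n 0) = id_arr n 0"
  by (rule comp_id_left [OF id_arrays])

lemma ind_pow_1: "ind_pow n (Suc 0) \<psi> b a = (if b \<in> words n 1 \<and> a \<in> words n 1
    then ab_coord (\<psi> (gen (hd a))) (hd b) else 0)"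
  by (auto simp: ind_pow_def truncate_def words_1)

text \<open>By the interchange law everything reduces to one tensor factor, where the entries of the
  matrix product are the exponent sums given by \<open>ab_coord_Aut\<close>.\<close>

lemma ind_pow_mult:
  assumes \<psi>: "\<psi> \<in> carrier (Aut n)" and \<phi>: "\<phi> \<in> carrier (Aut n)"
  shows "(ind_pow n q (\<psi> \<otimes>\<^bsub>Aut n\<^esub> \<phi>) :: 'k::{comm_ring, comm_monoid_mult} arr)
    = comp_arr n q (ind_pow n q \<psi>) (ind_pow n q \<phi>)"
proof (induction q)
  case 0
  then show ?case by (simp add: ind_pow_0_id comp_0_0)
next
  case (Suc q)
  have one: "(ind_pow n 1 (\<psi> \<otimes>\<^bsub>Aut n\<^esub> \<phi>) :: 'k arr) = comp_arr n 1 (ind_pow n 1 \<psi>) (ind_pow n 1 \<phi>)"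
  proof (intro ext)
    fix b a
    have "ab_coord (\<psi> (\<phi> (gen y))) x
        = (\<Sum>k<n. ab_coord (\<psi> (gen k)) x * ab_coord (\<phi> (gen y)) k :: 'k)" if "y < n" for x y
      using ab_coord_Aut [OF \<psi> Aut_closed [OF \<phi> letter_carrier [of "(y, True)"]], of x] that
      by (simp add: mult.commute)
    then show "(ind_pow n 1 (\<psi> \<otimes>\<^bsub>Aut n\<^esub> \<phi>) b a :: 'k) = comp_arr n 1 (ind_pow n 1 \<psi>) (ind_pow n 1 \<phi>) b a"
      using \<psi> \<phi> by (auto simp: ind_pow_1 comp_arr_def words_1 sum.reindex inj_on_def mult_Aut_apply
          letter_carrier)
  qed
  have "(ind_pow n (Suc q) (\<psi> \<otimes>\<^bsub>Aut n\<^esub> \<phi>) :: 'k arr)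
      = tensor_arr 1 1 (comp_arr n 1 (ind_pow n 1 \<psi>) (ind_pow n 1 \<phi>))
          (comp_arr n q (ind_pow n q \<psi>) (ind_pow n q \<phi>))"
    unfolding ind_pow_tensor [symmetric] one Suc ..
  also have "\<dots> = comp_arr n (1 + q) (ind_pow n (Suc q) \<psi>) (ind_pow n (Suc q) \<phi>)"
    unfolding ind_pow_tensor [symmetric] tensor_comp ..
  finally show ?case by simp
qed

lemma ind_pow_one:
  "ind_pow n q \<one>\<^bsub>Aut n\<^esub> = (id_arr n q :: 'k::{comm_ring, comm_monoid_mult} arr)"
proof (induction q)
  case 0
  then show ?case by (simp add: ind_pow_0_id)
next
  case (Suc q)
  have "(ind_pow n 1 \<one>\<^bsub>Aut n\<^esub> :: 'k arr) = id_arr n 1"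
    by (auto simp: fun_eq_iff ind_pow_1 id_arr_def truncate_def words_1 one_Aut_apply letter_carrier
        ab_coord_gen split: if_splits)
  then have "(ind_pow n (Suc q) \<one>\<^bsub>Aut n\<^esub> :: 'k arr) = tensor_arr 1 1 (id_arr n 1) (id_arr n q)"
    unfolding ind_pow_tensor [symmetric] Suc by simp
  then show ?case by (simp add: tensor_id)
qed

lemma ind_pow_inv_left:
  "\<psi> \<in> carrier (Aut n) \<Longrightarrow> comp_arr n q (ind_pow n q (inv\<^bsub>Aut n\<^esub> \<psi>)) (ind_pow n q \<psi>) = id_arr n q"
  by (simp add: ind_pow_mult [symmetric] inv_Aut_closed group.l_inv [OF group_Aut] ind_pow_one)

lemma ind_pow_inv_right:
  "\<psi> \<in> carrier (Aut n) \<Longrightarrow> comp_arr n q (ind_pow n q \<psi>) (ind_pow n q (inv\<^bsub>Aut n\<^esub> \<psi>)) = id_arr n q"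
  by (simp add: ind_pow_mult [symmetric] inv_Aut_closed group.r_inv [OF group_Aut] ind_pow_one)

section \<open>The coefficient modules and their pairings\<close>

lemma coef_simps [simp]:
  "grp (coef n q l) = Aut n" "coeffs (coef n q l) = arrays n q l" "act (coef n q l) = act_arr n q l"
  by (simp_all add: coef_def)

lemma act_arrays: "act_arr n q l \<psi> T \<in> arrays n q l"
  by (auto simp: arrays_iff act_arr_def comp_arr_def arrays_off [OF ind_pow_arrays])

lemma gmod_coef: "gmod (coef n q l :: (letter list \<Rightarrow> letter list, 'k::{comm_ring, comm_monoid_mult} arr) gmodule)"
proof (rule gmod.intro)
  fix \<psi> \<phi> and S T :: "'k arr"
  assume \<psi>: "\<psi> \<in> carrier (grp (coef n q l))" and \<phi>: "\<phi> \<in> carrier (grp (coef n q l))"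
  then show "act (coef n q l) (\<psi> \<otimes>\<^bsub>grp (coef n q l)\<^esub> \<phi>) T
      = act (coef n q l) \<psi> (act (coef n q l) \<phi> T)"
    by (simp add: act_arr_def ind_pow_mult group.inv_mult_group [OF group_Aut] inv_Aut_closed comp_arr_assoc)
qed (auto simp: group_Aut act_arrays, auto simp: arrays_iff act_arr_def comp_arr_add_left comp_arr_add_right)

text \<open>The inverse of |\<psi>| at the right end of the first factor meets |\<psi>| at the left
  end of the second. They cancel to an identity array, which is absorbed because \<open>T\<close> is
  supported on words of the right kind.\<close>

lemma act_arr_comp:
  assumes \<psi>: "\<psi> \<in> carrier (Aut n)" and T: "T \<in> arrays n r l"
  shows "comp_arr n r (act_arr n q r \<psi> S) (act_arr n r l \<psi> T) = act_arr n q l \<psi> (comp_arr n r S T)"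
proof -
  let ?P = "\<lambda>q. ind_pow n q \<psi>" and ?I = "\<lambda>q. ind_pow n q (inv\<^bsub>Aut n\<^esub> \<psi>)"
  have "comp_arr n r (?I r) (comp_arr n r (?P r) (comp_arr n l T (?I l))) = comp_arr n l T (?I l)"
    using comp_id_left [OF comp_arrays [OF T ind_pow_arrays]]
    by (subst comp_arr_assoc) (simp add: ind_pow_inv_left [OF \<psi>])
  then show ?thesis
    unfolding act_arr_def by (metis comp_arr_assoc)
qed

lemma act_arr_tensor:
  "tensor_arr q l (act_arr n q l \<psi> S) (act_arr n q' l' \<psi> T)
    = act_arr n (q + q') (l + l') \<psi> (tensor_arr q l S T)"
  unfolding act_arr_def ind_pow_add [symmetric] tensor_comp ..

lemma act_arr_id:
  assumes \<psi>: "\<psi> \<in> carrier (Aut n)"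
  shows "act_arr n q q \<psi> (id_arr n q) = id_arr n q"
  by (simp add: act_arr_def comp_id_left [OF ind_pow_arrays] ind_pow_inv_right \<psi>)

lemma comp_pairing: "gpairing (coef n q r) (coef n r l) (coef n q l) (comp_arr n r)"
  by (intro gpairing.intro gpairing_axioms.intro gmod_coef)
    (auto simp: comp_arr_add_left comp_arr_add_right act_arr_comp intro: comp_arrays)

lemma tensor_pairing:
  "gpairing (coef n q l) (coef n q' l') (coef n (q + q') (l + l')) (tensor_arr q l)"
  by (intro gpairing.intro gpairing_axioms.intro gmod_coef)
    (auto simp: tensor_arr_add_left tensor_arr_add_right act_arr_tensor intro: tensor_arrays)

text \<open>Tensoring with the identity and composing are fused into one bilinear pairing, so that
  each step of the recursion for the classes \<open>h_st p\<close> becomes a single cup product of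
  cochains.\<close>

definition widen_comp :: "nat \<Rightarrow> nat \<Rightarrow> 'k::{comm_ring, comm_monoid_mult} arr \<Rightarrow> 'k arr \<Rightarrow> 'k arr" where
  "widen_comp n q S T = comp_arr n 2 (tensor_arr q 1 S (id_arr n 1)) T"

lemma widen_comp_arrays:
  "S \<in> arrays n q 1 \<Longrightarrow> T \<in> arrays n 2 l \<Longrightarrow> widen_comp n q S T \<in> arrays n (Suc q) l"
  unfolding widen_comp_def
  using comp_arrays [OF tensor_arrays [OF _ id_arrays, of S n q 1 1]] by simp

lemma widen_comp_pairing:
  "gpairing (coef n q 1) (coef n 2 l) (coef n (Suc q) l) (widen_comp n q)"
proof (intro gpairing.intro gpairing_axioms.intro gmod_coef)
  fix \<psi> and S T :: "'a arr"
  assume "\<psi> \<in> carrier (grp (coef n q 1))" and "T \<in> coeffs (coef n 2 l)"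
  then have \<psi>: "\<psi> \<in> carrier (Aut n)" and T: "T \<in> arrays n 2 l" by simp_all
  have "widen_comp n q (act_arr n q 1 \<psi> S) (act_arr n 2 l \<psi> T)
      = comp_arr n 2 (tensor_arr q 1 (act_arr n q 1 \<psi> S) (act_arr n 1 1 \<psi> (id_arr n 1))) (act_arr n 2 l \<psi> T)"
    by (simp add: widen_comp_def act_arr_id \<psi>)
  also have "\<dots> = comp_arr n 2 (act_arr n (q + 1) 2 \<psi> (tensor_arr q 1 S (id_arr n 1))) (act_arr n 2 l \<psi> T)"
    unfolding act_arr_tensor one_add_one ..
  also have "\<dots> = act_arr n (Suc q) l \<psi> (widen_comp n q S T)"
    by (simp add: act_arr_comp [OF \<psi> T] widen_comp_def)
  finally show "widen_comp n q (act (coef n q 1) \<psi> S) (act (coef n 2 l) \<psi> T)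
      = act (coef n (Suc q) l) \<psi> (widen_comp n q S T)" by simp
qed (auto simp: widen_comp_def tensor_arr_add_left comp_arr_add_left comp_arr_add_right
    intro: widen_comp_arrays [unfolded widen_comp_def One_nat_def])

section \<open>Contraction of the first factors\<close>

lemma eval_first_arrays: "T \<in> arrays n (Suc q) (Suc l) \<Longrightarrow> eval_first n T \<in> arrays n q l"
  by (auto simp: arrays_iff eval_first_def words_Cons)

text \<open>The index summed over in the contraction occurs only in an entry of the inverse of
  |\<psi>| times an entry of |\<psi>|. Carrying out that sum first produces an identity matrix,
  which contracts the first indices of \<open>T\<close> instead. In other words, evaluation of the
  dual of \<open>H\<close> on \<open>H\<close> is invariant.\<close>

lemma eval_first_act:
  assumes \<psi>: "\<psi> \<in> carrier (Aut n)"
  shows "eval_first n (act_arr n (Suc q) (Suc l) \<psi> T)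
    = act_arr n q l \<psi> (eval_first n (T :: 'k::{comm_ring, comm_monoid_mult} arr))"
proof (intro ext)
  fix b a :: "nat list"
  let ?P = "ind_pow n q \<psi> :: 'k arr" and ?I = "ind_pow n l (inv\<^bsub>Aut n\<^esub> \<psi>) :: 'k arr"
  define A where "A x y = (ind_pow n 1 \<psi> [x] [y] :: 'k)" for x y
  define B where "B x y = (ind_pow n 1 (inv\<^bsub>Aut n\<^esub> \<psi>) [x] [y] :: 'k)" for x y
  have BA: "(\<Sum>c<n. B y c * A c x) = (if x = y then 1 else 0)" if "x < n" "y < n" for x y
    using fun_cong [OF fun_cong [OF ind_pow_inv_left [OF \<psi>, of 1, where ?'a = 'k]], of "[y]" "[x]"] that
    by (simp add: comp_arr_def sum_words_1 A_def B_def id_arr_apply words_Cons words_0)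
  have P: "ind_pow n (Suc q) \<psi> (c # b) (x # u) = A c x * ?P b u" for c x u
    by (simp add: ind_pow_Cons A_def ind_pow_0)
  have I: "ind_pow n (Suc l) (inv\<^bsub>Aut n\<^esub> \<psi>) (y # v) (c # a) = B y c * ?I v a" for c y v
    by (simp add: ind_pow_Cons B_def ind_pow_0)
  have "eval_first n (act_arr n (Suc q) (Suc l) \<psi> T) b a
    = (\<Sum>c<n. \<Sum>x<n. \<Sum>u\<in>words n q. \<Sum>y<n. \<Sum>v\<in>words n l.
        ?P b u * T (x # u) (y # v) * ?I v a * (B y c * A c x))"
    unfolding eval_first_def act_arr_def comp_arr_def sum_words_Suc P I sum_distrib_left
    by (intro sum.cong refl) (simp add: mult_ac)
  also have "\<dots> = (\<Sum>x<n. \<Sum>u\<in>words n q. \<Sum>y<n. \<Sum>v\<in>words n l. \<Sum>c<n.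
        ?P b u * T (x # u) (y # v) * ?I v a * (B y c * A c x))"
    by (subst sum.swap, rule sum.cong [OF refl], subst sum.swap, rule sum.cong [OF refl],
        subst sum.swap, rule sum.cong [OF refl], rule sum.swap)
  also have "\<dots> = (\<Sum>x<n. \<Sum>u\<in>words n q. \<Sum>y<n. \<Sum>v\<in>words n l.
        if x = y then ?P b u * T (x # u) (y # v) * ?I v a else 0)"
    by (intro sum.cong refl) (simp add: sum_distrib_left [symmetric] BA)
  also have "\<dots> = (\<Sum>x<n. \<Sum>u\<in>words n q. \<Sum>v\<in>words n l. \<Sum>y<n.
        if x = y then ?P b u * T (x # u) (y # v) * ?I v a else 0)"
    by (intro sum.cong [OF refl]) (rule sum.swap)
  also have "\<dots> = (\<Sum>x<n. \<Sum>u\<in>words n q. \<Sum>v\<in>words n l. ?P b u * T (x # u) (x # v) * ?I v a)"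
    by (intro sum.cong refl) simp
  also have "\<dots> = (\<Sum>u\<in>words n q. \<Sum>v\<in>words n l. \<Sum>x<n. ?P b u * T (x # u) (x # v) * ?I v a)"
    by (subst sum.swap, rule sum.cong [OF refl], rule sum.swap)
  also have "\<dots> = act_arr n q l \<psi> (eval_first n T) b a"
    by (simp add: act_arr_def comp_arr_def eval_first_def sum_distrib_left sum_distrib_right mult.assoc)
  finally show "eval_first n (act_arr n (Suc q) (Suc l) \<psi> T) b a
    = act_arr n q l \<psi> (eval_first n T) b a" .
qed

lemma eval_first_map: "gmod_map (coef n (Suc q) (Suc l)) (coef n q l) (eval_first n)"
  by (intro gmod_map.intro gmod_map_axioms.intro gmod_coef)
    (auto simp: eval_first_act eval_first_arrays, simp add: eval_first_def fun_eq_iff sum.distrib)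

lemma contract_arr_1_1: "contract_arr n 1 1 = eval_first n"
  by (simp add: contract_arr_def eval_first_def fun_eq_iff)

section \<open>Stabilisation of the matrices and of the action\<close>

lemma ind_pow_ext_right:
  assumes \<psi>: "\<psi> \<in> carrier (Aut n)"
  shows "a \<in> words n q \<Longrightarrow> ind_pow (Suc n) q (aut_ext n \<psi>) b a = ind_pow n q \<psi> b a"
proof (induction q arbitrary: a b)
  case 0
  then show ?case by (simp add: ind_pow_0)
next
  case (Suc q)
  then obtain y a' where a: "a = y # a'" "y < n" "a' \<in> words n q"
    by (cases a) (auto simp: words_def)
  show ?case
  proof (cases b)
    case Nil
    then show ?thesis by (simp add: ind_pow_def truncate_def words_def)
  next
    case (Cons x b')
    have "\<psi> (gen y) \<in> carrier (free_group n)"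
      using a by (simp add: Aut_closed [OF \<psi>] letter_carrier)
    then show ?thesis
      using a Cons Suc.IH [of a' b'] by (auto simp: ind_pow_Cons aut_ext_letter [OF \<psi>] ab_coord_off)
  qed
qed

text \<open>The matrix of an extended automorphism is block diagonal with a last entry 1. The
  preceding lemma treats the columns of the block: the images of the first \<open>n\<close>
  generators do not involve the last one. This one treats the rows, where the reason is that the
  last generator is fixed.\<close>

lemma ind_pow_ext_left:
  assumes \<psi>: "\<psi> \<in> carrier (Aut n)"
  shows "b \<in> words n q \<Longrightarrow> ind_pow (Suc n) q (aut_ext n \<psi>) b a = ind_pow n q \<psi> b a"
proof (induction q arbitrary: a b)
  case 0
  then show ?case by (simp add: ind_pow_0)
next
  case (Suc q)
  then obtain x b' where b: "b = x # b'" "x < n" "b' \<in> words n q"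
    by (cases b) (auto simp: words_def)
  show ?case
  proof (cases a)
    case Nil
    then show ?thesis by (simp add: ind_pow_def truncate_def words_def)
  next
    case (Cons y a')
    then show ?thesis
      using b Suc.IH [of b' a']
      by (cases "y = n") (auto simp: ind_pow_Cons aut_ext_letter [OF \<psi>] aut_ext_last ab_coord_gen)
  qed
qed

lemma comp_arr_Suc:
  assumes "\<And>c. c \<notin> words n r \<Longrightarrow> T c a = 0"
  shows "comp_arr (Suc n) r S T b a = comp_arr n r S T b a"
  unfolding comp_arr_def using words_mono assms by (intro sum.mono_neutral_right) auto

lemma comp_arr_Suc':
  assumes "\<And>c. c \<notin> words n r \<Longrightarrow> S b c = 0"
  shows "comp_arr (Suc n) r S T b a = comp_arr n r S T b a"
  unfolding comp_arr_def using words_mono assms by (intro sum.mono_neutral_right) auto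

text \<open>The block shape keeps an array supported on the first \<open>n\<close> indices within
  that support, so nothing has to be truncated. This drives the exact stability of the
  cocycles.\<close>

lemma act_arr_ext:
  assumes \<psi>: "\<psi> \<in> carrier (Aut n)" and T: "T \<in> arrays n q l"
  shows "act_arr (Suc n) q l (aut_ext n \<psi>) T = act_arr n q l \<psi> T"
proof -
  let ?\<phi> = "inv\<^bsub>Aut n\<^esub> \<psi>"
  have \<phi>: "?\<phi> \<in> carrier (Aut n)" by (rule inv_Aut_closed [OF \<psi>])
  have 1: "comp_arr (Suc n) l T (ind_pow (Suc n) l (aut_ext n ?\<phi>)) = comp_arr n l T (ind_pow n l ?\<phi>)"
  proof (intro ext)
    fix b a
    have "comp_arr (Suc n) l T (ind_pow (Suc n) l (aut_ext n ?\<phi>)) b a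
        = comp_arr n l T (ind_pow (Suc n) l (aut_ext n ?\<phi>)) b a"
      by (rule comp_arr_Suc') (use T in \<open>auto simp: arrays_iff\<close>)
    also have "\<dots> = comp_arr n l T (ind_pow n l ?\<phi>) b a"
      unfolding comp_arr_def by (intro sum.cong refl) (simp add: ind_pow_ext_left [OF \<phi>])
    finally show "comp_arr (Suc n) l T (ind_pow (Suc n) l (aut_ext n ?\<phi>)) b a
        = comp_arr n l T (ind_pow n l ?\<phi>) b a" .
  qed
  define U where "U = comp_arr n l T (ind_pow n l ?\<phi>)"
  have U: "U \<in> arrays n q l" unfolding U_def by (rule comp_arrays [OF T ind_pow_arrays])
  have "comp_arr (Suc n) q (ind_pow (Suc n) q (aut_ext n \<psi>)) U = comp_arr n q (ind_pow n q \<psi>) U"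
  proof (intro ext)
    fix b a
    have "comp_arr (Suc n) q (ind_pow (Suc n) q (aut_ext n \<psi>)) U b a
        = comp_arr n q (ind_pow (Suc n) q (aut_ext n \<psi>)) U b a"
      by (rule comp_arr_Suc) (use U in \<open>auto simp: arrays_iff\<close>)
    also have "\<dots> = comp_arr n q (ind_pow n q \<psi>) U b a"
      unfolding comp_arr_def by (intro sum.cong refl) (simp add: ind_pow_ext_right [OF \<psi>])
    finally show "comp_arr (Suc n) q (ind_pow (Suc n) q (aut_ext n \<psi>)) U b a
        = comp_arr n q (ind_pow n q \<psi>) U b a" .
  qed
  then show ?thesis
    by (simp add: act_arr_def aut_ext_inv [OF \<psi>] 1 U_def)
qed

text \<open>Here \<open>T\<close> is arbitrary, and truncation removes what lies outside the block:
  by the block shape, indices within it and the last one never mix. This is what makes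
  \<open>stab\<close> well defined.\<close>

lemma act_arr_truncate:
  assumes \<psi>: "\<psi> \<in> carrier (Aut n)"
  shows "truncate n q l (act_arr (Suc n) q l (aut_ext n \<psi>) T) = act_arr n q l \<psi> (truncate n q l T)"
proof (intro ext)
  fix b a :: "nat list"
  let ?\<phi> = "inv\<^bsub>Aut n\<^esub> \<psi>"
  have \<phi>: "?\<phi> \<in> carrier (Aut n)" by (rule inv_Aut_closed [OF \<psi>])
  show "truncate n q l (act_arr (Suc n) q l (aut_ext n \<psi>) T) b a = act_arr n q l \<psi> (truncate n q l T) b a"
  proof (cases "b \<in> words n q \<and> a \<in> words n l")
    case False
    then show ?thesis
      using arrays_off [OF act_arrays, of b n q a l] arrays_off [OF truncate_arrays, of b n q a l]
      by (metis (no_types))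
  next
    case True
    have 1: "comp_arr (Suc n) l T (ind_pow (Suc n) l (aut_ext n ?\<phi>)) c a
        = comp_arr n l (truncate n q l T) (ind_pow n l ?\<phi>) c a" if "c \<in> words n q" for c
    proof -
      have "comp_arr (Suc n) l T (ind_pow (Suc n) l (aut_ext n ?\<phi>)) c a
          = comp_arr n l T (ind_pow (Suc n) l (aut_ext n ?\<phi>)) c a"
        by (rule comp_arr_Suc) (use True in
            \<open>auto simp: ind_pow_ext_right [OF \<phi>] intro: arrays_off [OF ind_pow_arrays]\<close>)
      also have "\<dots> = comp_arr n l (truncate n q l T) (ind_pow n l ?\<phi>) c a"
        unfolding comp_arr_def using True that
        by (intro sum.cong refl) (simp add: ind_pow_ext_right [OF \<phi>] truncate_def)
      finally show ?thesis .
    qed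
    have "comp_arr (Suc n) q (ind_pow (Suc n) q (aut_ext n \<psi>)) U b a
        = comp_arr n q (ind_pow (Suc n) q (aut_ext n \<psi>)) U b a" for U :: "'a arr"
      by (rule comp_arr_Suc') (use True in
          \<open>auto simp: ind_pow_ext_left [OF \<psi>] intro: arrays_off [OF ind_pow_arrays]\<close>)
    also have "comp_arr n q (ind_pow (Suc n) q (aut_ext n \<psi>))
          (comp_arr (Suc n) l T (ind_pow (Suc n) l (aut_ext n ?\<phi>))) b a
        = comp_arr n q (ind_pow n q \<psi>) (comp_arr n l (truncate n q l T) (ind_pow n l ?\<phi>)) b a"
      unfolding comp_arr_def [of n q] using True
      by (intro sum.cong refl) (simp add: ind_pow_ext_left [OF \<psi>] 1)
    finally show ?thesis
      using True by (simp add: truncate_apply act_arr_def aut_ext_inv [OF \<psi>])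
  qed
qed

section \<open>Magnus expansions\<close>

abbreviation one_series :: "nat list \<Rightarrow> 'k::{comm_ring, comm_monoid_mult}" where
  "one_series \<equiv> \<lambda>w. if w = [] then 1 else 0"

lemma series_mult_Nil: "series_mult f g [] = f [] * g []"
  by (simp add: series_mult_def)

text \<open>The cut before \<open>x\<close> is split off, and the remaining cuts form a product with
  the shifted series \<open>\<lambda>v. f (x # v)\<close>. Sums over cuts thus become recursions on
  the word, with the left factor changing; hence associativity is proved for all \<open>f\<close> at
  once.\<close>

lemma series_mult_Cons:
  "series_mult f g (x # w) = f [] * g (x # w) + series_mult (\<lambda>v. f (x # v)) g w"
  by (simp add: series_mult_def sum.atMost_Suc_shift del: sum.atMost_Suc)

lemma series_mult_add_left: "series_mult (\<lambda>w. f w + f' w) g w = series_mult f g w + series_mult f' g w"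
  by (simp add: series_mult_def distrib_right sum.distrib)

lemma series_mult_scale_left: "series_mult (\<lambda>w. c * f w) g w = c * series_mult f g w"
  by (simp add: series_mult_def sum_distrib_left mult.assoc)

lemma series_mult_uminus_left: "series_mult (\<lambda>w. - f w) g w = - series_mult f g w"
  by (simp add: series_mult_def sum_negf)

lemma series_mult_zero_left: "series_mult (\<lambda>w. 0) g w = 0"
  by (simp add: series_mult_def)

lemma series_mult_one_left: "series_mult one_series g = g"
proof
  fix w show "series_mult one_series g w = g w"
    by (cases w) (simp_all add: series_mult_Nil series_mult_Cons series_mult_zero_left)
qed

lemma series_mult_assoc: "series_mult (series_mult f g) h = series_mult f (series_mult g h)"
proof
  fix w show "series_mult (series_mult f g) h w = series_mult f (series_mult g h) w"
    by (induction w arbitrary: f) (simp_all add: series_mult_Nil series_mult_Cons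
        series_mult_add_left series_mult_scale_left algebra_simps)
qed

section \<open>The standard expansion\<close>

definition gen_series :: "nat \<Rightarrow> nat list \<Rightarrow> 'k::{comm_ring, comm_monoid_mult}" where
  "gen_series i w = (if w = [] \<or> w = [i] then 1 else 0)"

text \<open>The geometric series for the inverse of a generator: the word consisting of k letters
  \<open>i\<close> has the coefficient (-1)^k, and all other words have 0.\<close>

primrec inv_gen_series :: "nat \<Rightarrow> nat list \<Rightarrow> 'k::{comm_ring, comm_monoid_mult}" where
  "inv_gen_series i [] = 1"
| "inv_gen_series i (j # w) = (if j = i then - inv_gen_series i w else 0)"

lemma gen_series_Nil: "gen_series i [] = 1"
  and gen_series_Cons: "gen_series i (j # w) = (if j = i then one_series w else 0)"
  by (auto simp: gen_series_def)

lemma gen_series_right_inverse: "series_mult (gen_series i) (inv_gen_series i) = one_series"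
proof
  fix w
  show "series_mult (gen_series i) (inv_gen_series i) w = one_series w"
  proof (cases w)
    case (Cons j v)
    then show ?thesis
      by (cases "j = i") (simp_all add: series_mult_Cons gen_series_Nil gen_series_Cons
          series_mult_one_left series_mult_zero_left)
  qed (simp add: series_mult_Nil gen_series_Nil)
qed

lemma gen_series_left_inverse: "series_mult (inv_gen_series i) (gen_series i) = one_series"
proof
  fix w
  show "series_mult (inv_gen_series i) (gen_series i) w = one_series w"
  proof (induction w)
    case (Cons j v)
    then show ?case
      by (cases "j = i") (simp_all add: series_mult_Cons gen_series_Cons
          series_mult_uminus_left series_mult_zero_left)
  qed (simp add: series_mult_Nil gen_series_Nil)
qed

definition letter_series :: "letter \<Rightarrow> nat list \<Rightarrow> 'k::{comm_ring, comm_monoid_mult}" where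
  "letter_series x = (if snd x then gen_series (fst x) else inv_gen_series (fst x))"

definition magnus :: "letter list \<Rightarrow> nat list \<Rightarrow> 'k::{comm_ring, comm_monoid_mult}" where
  "magnus \<gamma> = foldr (\<lambda>x. series_mult (letter_series x)) \<gamma> one_series"

lemma magnus_Nil: "magnus [] = one_series"
  and magnus_Cons: "magnus (x # \<gamma>) = series_mult (letter_series x) (magnus \<gamma>)"
  by (simp_all add: magnus_def)

lemma magnus_append: "magnus (\<gamma> @ \<delta>) = series_mult (magnus \<gamma>) (magnus \<delta>)"
  by (induction \<gamma>) (simp_all add: magnus_Nil magnus_Cons series_mult_one_left series_mult_assoc)

lemma letter_series_flip: "series_mult (letter_series x) (letter_series (flip x)) = one_series"
  by (simp add: letter_series_def gen_series_right_inverse gen_series_left_inverse)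

lemma magnus_reduce: "magnus (reduce \<gamma>) = magnus \<gamma>"
proof (rule reduce_invariant)
  show "magnus (x # flip x # w) = magnus w" for x w
    by (simp add: magnus_Cons series_mult_assoc [symmetric] letter_series_flip series_mult_one_left)
qed (simp add: magnus_Cons)

lemma letter_series_off: "fst x < n \<Longrightarrow> \<not> set w \<subseteq> {..<n} \<Longrightarrow> letter_series x w = 0"
proof (cases "snd x")
  case False
  moreover have "i < n \<Longrightarrow> \<not> set w \<subseteq> {..<n} \<Longrightarrow> inv_gen_series i w = 0" for i
    by (induction w) auto
  ultimately show "fst x < n \<Longrightarrow> \<not> set w \<subseteq> {..<n} \<Longrightarrow> ?thesis"
    by (simp add: letter_series_def)
qed (auto simp: letter_series_def gen_series_def)

lemma magnus_expansion_magnus: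
  "magnus_expansion n (magnus :: letter list \<Rightarrow> nat list \<Rightarrow> 'k::{comm_ring, comm_monoid_mult})"
  unfolding magnus_expansion_def
proof (intro conjI ballI allI impI)
  fix \<gamma> assume "\<gamma> \<in> carrier (free_group n)"
  then have letters: "fst ` set \<gamma> \<subseteq> {..<n}" by (simp add: carrier_free_group)
  show "magnus \<gamma> [] = (1 :: 'k)"
    by (induction \<gamma>) (simp_all add: magnus_Nil magnus_Cons series_mult_Nil letter_series_def gen_series_def)
  \<comment> \<open>Stated for every word, as the induction on letters that follows needs it for
    tails.\<close>
  then have 1: "magnus \<gamma> [] = (1 :: 'k)" for \<gamma>
    by (induction \<gamma>) (simp_all add: magnus_Nil magnus_Cons series_mult_Nil letter_series_def gen_series_def)
  show "magnus \<gamma> [i] = (ab_coord \<gamma> i :: 'k)" for i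
    by (induction \<gamma>) (auto simp: magnus_Nil magnus_Cons series_mult_Nil series_mult_Cons 1
        letter_series_def gen_series_def ab_coord_Cons)
  show "magnus \<gamma> w = (0 :: 'k)" if "\<not> set w \<subseteq> {..<n}" for w
    using letters that
  proof (induction \<gamma> arbitrary: w)
    case (Cons x \<gamma>)
    \<comment> \<open>A letter out of range lies on one side of each cut, and the factor on that
      side vanishes.\<close>
    have "letter_series x (take i w) * magnus \<gamma> (drop i w) = (0 :: 'k)" for i
    proof (cases "set (take i w) \<subseteq> {..<n}")
      case True
      then have "\<not> set (drop i w) \<subseteq> {..<n}"
        using Cons.prems(2) set_append [of "take i w" "drop i w"] by auto
      then show ?thesis using Cons by simp
    next
      case False
      then show ?thesis using Cons.prems(1) by (simp add: letter_series_off [of x n])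
    qed
    then show ?case by (simp add: magnus_Cons series_mult_def)
  qed (auto simp: magnus_Nil)
  show "magnus (\<gamma> \<otimes>\<^bsub>free_group n\<^esub> \<delta>) = series_mult (magnus \<gamma>) (magnus \<delta> :: _ \<Rightarrow> 'k)" for \<delta>
    by (simp add: mult_free_group magnus_reduce magnus_append)
qed

text \<open>The quadratic part fails to be additive by the cross term [\<gamma>] \<otimes>
  [\<delta>]. As this term depends on neither the expansion nor the representatives of the classes,
  it drops out of the difference of two expansions and of the formula for
  \<open>tau1\<close>.\<close>

lemma magnus_expansion_mult_2:
  assumes \<theta>: "magnus_expansion n \<theta>" and b: "b \<in> words n 2"
    and \<gamma>: "\<gamma> \<in> carrier (free_group n)" and \<delta>: "\<delta> \<in> carrier (free_group n)"
  shows "\<theta> (\<gamma> \<otimes>\<^bsub>free_group n\<^esub> \<delta>) b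
    = \<theta> \<gamma> b + \<theta> \<delta> b + ab_coord \<gamma> (b ! 0) * ab_coord \<delta> (b ! 1)"
proof -
  obtain i j where ij: "b = [i, j]" "i < n" "j < n"
    using b by (auto simp: words_def length_Suc_conv numeral_2_eq_2)
  have "\<theta> \<eta> [] = 1" "\<theta> \<eta> [i] = ab_coord \<eta> i" "\<theta> \<eta> [j] = ab_coord \<eta> j"
    if "\<eta> \<in> carrier (free_group n)" for \<eta>
    using \<theta> that ij unfolding magnus_expansion_def by blast+
  moreover have "\<theta> (\<gamma> \<otimes>\<^bsub>free_group n\<^esub> \<delta>) b = series_mult (\<theta> \<gamma>) (\<theta> \<delta>) b"
    using \<theta> \<gamma> \<delta> unfolding magnus_expansion_def by metis
  ultimately show ?thesis
    using \<gamma> \<delta> by (simp add: ij series_mult_Cons series_mult_Nil algebra_simps)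
qed

text \<open>The array records \<open>F\<close> on generators only, whereas the inverse of \<psi>
  sends generators to arbitrary elements. Additivity bridges this: composing with the inverse of
  |\<psi>| amounts to evaluating \<open>F\<close> at the inverse image of the generator.\<close>

lemma act_arr_additive:
  fixes F :: "nat list \<Rightarrow> letter list \<Rightarrow> 'k::{comm_ring, comm_monoid_mult}"
  assumes \<psi>: "\<psi> \<in> carrier (Aut n)"
    and F: "\<And>b \<gamma> \<delta>. b \<in> words n q \<Longrightarrow> \<gamma> \<in> carrier (free_group n) \<Longrightarrow> \<delta> \<in> carrier (free_group n) \<Longrightarrow>
      F b (\<gamma> \<otimes>\<^bsub>free_group n\<^esub> \<delta>) = F b \<gamma> + F b \<delta>"
  shows "act_arr n q 1 \<psi> (truncate n q 1 (\<lambda>b a. F b (gen (hd a))))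
    = truncate n q 1 (\<lambda>b a. \<Sum>c\<in>words n q. ind_pow n q \<psi> b c * F c ((inv\<^bsub>Aut n\<^esub> \<psi>) (gen (hd a))))"
proof (intro ext)
  fix b a :: "nat list"
  let ?\<phi> = "inv\<^bsub>Aut n\<^esub> \<psi>" and ?u = "truncate n q 1 (\<lambda>b a. F b (gen (hd a)))"
  let ?v = "truncate n q 1 (\<lambda>b a. \<Sum>c\<in>words n q. ind_pow n q \<psi> b c * F c ((inv\<^bsub>Aut n\<^esub> \<psi>) (gen (hd a))))"
  show "act_arr n q 1 \<psi> ?u b a = ?v b a"
  proof (cases "b \<in> words n q \<and> a \<in> words n 1")
    case False
    then show ?thesis
      using arrays_off [OF act_arrays, of b n q a 1] by (auto simp: truncate_def)
  next
    case True
    then obtain k where k: "a = [k]" "k < n" by (auto simp: words_1)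
    then have \<gamma>: "?\<phi> (gen k) \<in> carrier (free_group n)"
      by (simp add: Aut_closed inv_Aut_closed \<psi> letter_carrier)
    have "comp_arr n 1 ?u (ind_pow n 1 ?\<phi>) c a = F c (?\<phi> (gen k))" if c: "c \<in> words n q" for c
    proof -
      have "F c (?\<phi> (gen k)) = (\<Sum>j<n. ab_coord (?\<phi> (gen k)) j * F c (gen j))"
        by (rule additive_free_group [OF F [OF c] \<gamma>])
      then show ?thesis
        using c k by (simp add: comp_arr_def ind_pow_1 words_1 sum.reindex inj_on_def truncate_def
            mult.commute)
    qed
    then have "act_arr n q 1 \<psi> ?u b a = (\<Sum>c\<in>words n q. ind_pow n q \<psi> b c * F c (?\<phi> (gen k)))"
      unfolding act_arr_def comp_arr_def [of n q] by (intro sum.cong refl) simp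
    then show ?thesis
      using True by (simp add: truncate_def k)
  qed
qed

text \<open>The formula of \<open>tau1\<close> at an arbitrary element of the free group. The
  cocycle identity evaluates it at the inverse image of a generator.\<close>

definition tau_fun ::
  "nat \<Rightarrow> (letter list \<Rightarrow> nat list \<Rightarrow> 'k::{comm_ring, comm_monoid_mult})
     \<Rightarrow> (letter list \<Rightarrow> letter list) \<Rightarrow> nat list \<Rightarrow> letter list \<Rightarrow> 'k" where
  "tau_fun n \<theta> \<psi> b \<gamma> = \<theta> \<gamma> b - (\<Sum>c \<in> words n 2. ind_pow n 2 \<psi> b c * \<theta> ((inv\<^bsub>Aut n\<^esub> \<psi>) \<gamma>) c)"

lemma tau1_eq: "tau1 n \<theta> \<psi> = truncate n 2 1 (\<lambda>b a. tau_fun n \<theta> \<psi> b (gen (hd a)))"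
  by (simp add: tau1_def tau_fun_def)

lemma tau1_arrays: "tau1 n \<theta> \<psi> \<in> arrays n 2 1"
  by (simp add: tau1_eq truncate_arrays)

text \<open>The cross term [\<gamma>] \<otimes> [\<delta>] of the first summand equals the image
  under the square of |\<psi>| of the cross term at the inverse images, so the two cancel. This
  justifies describing \<open>tau1\<close> by its values on the basis.\<close>

lemma tau_fun_mult:
  fixes \<theta> :: "letter list \<Rightarrow> nat list \<Rightarrow> 'k::{comm_ring, comm_monoid_mult}"
  assumes \<theta>: "magnus_expansion n \<theta>" and \<psi>: "\<psi> \<in> carrier (Aut n)" and b: "b \<in> words n 2"
    and \<gamma>: "\<gamma> \<in> carrier (free_group n)" and \<delta>: "\<delta> \<in> carrier (free_group n)"
  shows "tau_fun n \<theta> \<psi> b (\<gamma> \<otimes>\<^bsub>free_group n\<^esub> \<delta>) = tau_fun n \<theta> \<psi> b \<gamma> + tau_fun n \<theta> \<psi> b \<delta>"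
proof -
  let ?\<phi> = "inv\<^bsub>Aut n\<^esub> \<psi>"
  have \<phi>: "?\<phi> \<in> carrier (Aut n)" by (rule inv_Aut_closed [OF \<psi>])
  have \<phi>': "?\<phi> \<gamma> \<in> carrier (free_group n)" "?\<phi> \<delta> \<in> carrier (free_group n)"
    by (simp_all add: Aut_closed \<phi> \<gamma> \<delta>)
  obtain i j where ij: "b = [i, j]" "i < n" "j < n"
    using b by (auto simp: words_def length_Suc_conv numeral_2_eq_2)
  have ab: "ab_coord \<eta> m = (\<Sum>k<n. ab_coord (\<psi> (gen k)) m * ab_coord (?\<phi> \<eta>) k :: 'k)"
    if "\<eta> \<in> carrier (free_group n)" for \<eta> m
    using ab_coord_Aut [OF \<psi> Aut_closed [OF \<phi> that], of m] Aut_apply_inv [OF \<psi> that]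
    by (simp add: mult.commute)
  have "(\<Sum>c\<in>words n 2. ind_pow n 2 \<psi> b c * (ab_coord (?\<phi> \<gamma>) (c ! 0) * ab_coord (?\<phi> \<delta>) (c ! 1)))
      = (\<Sum>k<n. \<Sum>l<n. (ab_coord (\<psi> (gen k)) i * ab_coord (?\<phi> \<gamma>) k)
          * (ab_coord (\<psi> (gen l)) j * ab_coord (?\<phi> \<delta>) l) :: 'k)"
    unfolding numeral_2_eq_2 sum_words_Suc
    by (intro sum.cong refl) (simp add: ij words_0 ind_pow_Cons ind_pow_0 mult_ac)
  also have "\<dots> = ab_coord \<gamma> i * ab_coord \<delta> j"
    unfolding ab [OF \<gamma>, of i] ab [OF \<delta>, of j] by (rule sum_product [symmetric])
  finally have cross: "(\<Sum>c\<in>words n 2. ind_pow n 2 \<psi> b c * (ab_coord (?\<phi> \<gamma>) (c ! 0) * ab_coord (?\<phi> \<delta>) (c ! 1)))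
      = (ab_coord \<gamma> (b ! 0) * ab_coord \<delta> (b ! 1) :: 'k)"
    by (simp add: ij)
  have "(\<Sum>c\<in>words n 2. ind_pow n 2 \<psi> b c * \<theta> (?\<phi> (\<gamma> \<otimes>\<^bsub>free_group n\<^esub> \<delta>)) c)
      = (\<Sum>c\<in>words n 2. ind_pow n 2 \<psi> b c * \<theta> (?\<phi> \<gamma>) c)
        + (\<Sum>c\<in>words n 2. ind_pow n 2 \<psi> b c * \<theta> (?\<phi> \<delta>) c)
        + (\<Sum>c\<in>words n 2. ind_pow n 2 \<psi> b c * (ab_coord (?\<phi> \<gamma>) (c ! 0) * ab_coord (?\<phi> \<delta>) (c ! 1)))"
    unfolding sum.distrib [symmetric]
    by (intro sum.cong refl) (simp add: Aut_apply_mult [OF \<phi> \<gamma> \<delta>]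
        magnus_expansion_mult_2 [OF \<theta> _ \<phi>'] distrib_left)
  then show ?thesis
    unfolding tau_fun_def cross magnus_expansion_mult_2 [OF \<theta> b \<gamma> \<delta>]
    by (simp add: algebra_simps)
qed

text \<open>A telescoping sum: the square of |\<psi>| applied to the quadratic part at the inverse
  image under \<psi> is subtracted in \<open>tau1 n \<theta> \<psi>\<close> and added back in the
  translate of \<open>tau1 n \<theta> \<phi>\<close>.\<close>

lemma tau1_mult:
  assumes \<theta>: "magnus_expansion n \<theta>" and \<psi>: "\<psi> \<in> carrier (Aut n)" and \<phi>: "\<phi> \<in> carrier (Aut n)"
  shows "tau1 n \<theta> (\<psi> \<otimes>\<^bsub>Aut n\<^esub> \<phi>) = tau1 n \<theta> \<psi> + act_arr n 2 1 \<psi> (tau1 n \<theta> \<phi>)"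
proof (intro ext)
  fix b a :: "nat list"
  let ?I = "inv\<^bsub>Aut n\<^esub> \<psi>" and ?J = "inv\<^bsub>Aut n\<^esub> \<phi>"
  have act: "act_arr n 2 1 \<psi> (tau1 n \<theta> \<phi>)
    = truncate n 2 1 (\<lambda>b a. \<Sum>c\<in>words n 2. ind_pow n 2 \<psi> b c * tau_fun n \<theta> \<phi> c (?I (gen (hd a))))"
    unfolding tau1_eq by (rule act_arr_additive [OF \<psi> tau_fun_mult [OF \<theta> \<phi>]])
  show "tau1 n \<theta> (\<psi> \<otimes>\<^bsub>Aut n\<^esub> \<phi>) b a = (tau1 n \<theta> \<psi> + act_arr n 2 1 \<psi> (tau1 n \<theta> \<phi>)) b a"
  proof (cases "b \<in> words n 2 \<and> a \<in> words n 1")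
    case False
    then show ?thesis by (auto simp: arrays_off [OF tau1_arrays] arrays_off [OF act_arrays])
  next
    case True
    then obtain k where k: "a = [k]" "k < n" by (auto simp: words_1)
    have inv: "(inv\<^bsub>Aut n\<^esub> (\<psi> \<otimes>\<^bsub>Aut n\<^esub> \<phi>)) (gen k) = ?J (?I (gen k))"
      using \<psi> \<phi> k by (simp add: group.inv_mult_group [OF group_Aut] mult_Aut_apply inv_Aut_closed letter_carrier)
    have "(\<Sum>c\<in>words n 2. ind_pow n 2 (\<psi> \<otimes>\<^bsub>Aut n\<^esub> \<phi>) b c * \<theta> (?J (?I (gen k))) c)
      = (\<Sum>c\<in>words n 2. ind_pow n 2 \<psi> b c
          * (\<Sum>d\<in>words n 2. ind_pow n 2 \<phi> c d * \<theta> (?J (?I (gen k))) d))"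
      unfolding ind_pow_mult [OF \<psi> \<phi>] comp_arr_def sum_distrib_left sum_distrib_right
      by (subst sum.swap) (simp add: mult.assoc)
    then have "tau_fun n \<theta> (\<psi> \<otimes>\<^bsub>Aut n\<^esub> \<phi>) b (gen k) = tau_fun n \<theta> \<psi> b (gen k)
      + (\<Sum>c\<in>words n 2. ind_pow n 2 \<psi> b c * tau_fun n \<theta> \<phi> c (?I (gen k)))"
      by (simp add: tau_fun_def inv right_diff_distrib sum_subtractf)
    moreover have "act_arr n 2 1 \<psi> (tau1 n \<theta> \<phi>) b a
        = (\<Sum>c\<in>words n 2. ind_pow n 2 \<psi> b c * tau_fun n \<theta> \<phi> c (?I (gen k)))"
      unfolding act using True k by (simp add: truncate_apply)
    moreover have "tau1 n \<theta> \<rho> b a = tau_fun n \<theta> \<rho> b (gen k)" for \<rho>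
      unfolding tau1_eq using True k by (simp add: truncate_apply)
    ultimately show ?thesis by simp
  qed
qed

section \<open>The cohomology class of the cocycle\<close>

definition tau_cochain ::
  "nat \<Rightarrow> (letter list \<Rightarrow> nat list \<Rightarrow> 'k::{comm_ring, comm_monoid_mult})
     \<Rightarrow> (letter list \<Rightarrow> letter list) list \<Rightarrow> 'k arr" where
  "tau_cochain n \<theta> = on_tuples (Aut n) 1 (\<lambda>gs. tau1 n \<theta> (hd gs))"

lemma tuples_Suc_0: "gs \<in> tuples G (Suc 0) \<longleftrightarrow> (\<exists>g\<in>carrier G. gs = [g])"
  by (auto simp: tuples_def length_Suc_conv)

lemma tau_cochain_cocycle:
  assumes \<theta>: "magnus_expansion n \<theta>"
  shows "tau_cochain n \<theta> \<in> cocycles (coef n 2 1) 1"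
proof -
  interpret gmod "coef n 2 1 :: (letter list \<Rightarrow> letter list, 'a arr) gmodule" by (rule gmod_coef)
  have "tau_cochain n \<theta> \<in> cochains (coef n 2 1) 1"
    using on_tuples_cochain [of 1 "\<lambda>gs. tau1 n \<theta> (hd gs)"] by (simp add: tau_cochain_def tau1_arrays [simplified])
  moreover have "coboundary (coef n 2 1) (Suc 0) (tau_cochain n \<theta>) = 0"
  proof
    fix gs
    show "coboundary (coef n 2 1) (Suc 0) (tau_cochain n \<theta>) gs = 0 gs"
    proof (cases "gs \<in> tuples (Aut n) (Suc (Suc 0))")
      case False
      then show ?thesis by (simp add: coboundary_def on_tuples_def)
    next
      case True
      then obtain g h where gs: "gs = [g, h]" and gh: "g \<in> carrier (Aut n)" "h \<in> carrier (Aut n)"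
        by (auto simp: tuples_def length_Suc_conv)
      then have "g \<otimes>\<^bsub>Aut n\<^esub> h \<in> carrier (Aut n)"
        using m_closed by simp
      with True gh show ?thesis
        by (subst coboundary_tuple) (simp_all add: gs tau_cochain_def on_tuples_def tuples_Suc_0 merge_def
            alt_def tau1_mult [OF \<theta>])
    qed
  qed
  ultimately show ?thesis by (simp add: cocycles_def)
qed

text \<open>The quadratic parts of two expansions have the same cross terms, so their difference is
  additive and defines a linear map from \<open>H\<close> to its tensor square. The coboundary of
  this map is the difference of the cocycles.\<close>

lemma tau_cochain_class_independent:
  fixes \<theta> \<theta>' :: "letter list \<Rightarrow> nat list \<Rightarrow> 'k::{comm_ring, comm_monoid_mult}"
  assumes \<theta>: "magnus_expansion n \<theta>" and \<theta>': "magnus_expansion n \<theta>'"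
  shows "coho_class (coef n 2 1) 1 (tau_cochain n \<theta>) = coho_class (coef n 2 1) 1 (tau_cochain n \<theta>')"
proof -
  interpret gmod "coef n 2 1 :: (letter list \<Rightarrow> letter list, 'k arr) gmodule" by (rule gmod_coef)
  \<comment> \<open>The order of the difference is chosen so that the coboundary comes out without a
    sign.\<close>
  define D where "D b \<gamma> = \<theta>' \<gamma> b - \<theta> \<gamma> b" for b \<gamma>
  define u where "u = truncate n 2 1 (\<lambda>b a. D b (gen (hd a)))"
  define f where "f = on_tuples (Aut n) 0 (\<lambda>_. u)"
  have f: "f \<in> cochains (coef n 2 1) 0"
    using on_tuples_cochain [of 0 "\<lambda>_. u"] by (simp add: f_def u_def truncate_arrays)
  have act: "act_arr n 2 1 \<psi> u
      = truncate n 2 1 (\<lambda>b a. \<Sum>c\<in>words n 2. ind_pow n 2 \<psi> b c * D c ((inv\<^bsub>Aut n\<^esub> \<psi>) (gen (hd a))))"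
    if "\<psi> \<in> carrier (Aut n)" for \<psi>
    unfolding u_def by (rule act_arr_additive [OF that])
      (simp add: D_def magnus_expansion_mult_2 [OF \<theta>] magnus_expansion_mult_2 [OF \<theta>'])
  have diff: "tau1 n \<theta> \<psi> - tau1 n \<theta>' \<psi> = act_arr n 2 1 \<psi> u - u" if "\<psi> \<in> carrier (Aut n)" for \<psi>
    unfolding act [OF that]
    by (intro ext) (simp add: tau1_eq u_def truncate_def tau_fun_def D_def right_diff_distrib sum_subtractf)
  have "tau_cochain n \<theta> - tau_cochain n \<theta>' = coboundary (coef n 2 1) 0 f"
  proof
    fix gs
    show "(tau_cochain n \<theta> - tau_cochain n \<theta>') gs = coboundary (coef n 2 1) 0 f gs"
    proof (cases "gs \<in> tuples (Aut n) (Suc 0)")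
      case False
      then show ?thesis by (simp add: tau_cochain_def coboundary_def on_tuples_def)
    next
      case True
      then obtain g where "gs = [g]" "g \<in> carrier (Aut n)" by (auto simp: tuples_Suc_0)
      with True show ?thesis
        by (simp add: tau_cochain_def coboundary_def on_tuples_def f_def alt_def diff
            tuples_def [of _ 0])
    qed
  qed
  then have "tau_cochain n \<theta> - tau_cochain n \<theta>' \<in> coboundaries (coef n 2 1) 1"
    using f by (simp add: coboundaries_def)
  then show ?thesis by (rule coho_class_eqI)
qed

text \<open>The existence of one expansion makes the definite description in \<open>h1\<close>
  unique; the independence of the expansion makes it satisfiable.\<close>

lemma h1_eq:
  "(h1 n :: 'k::{comm_ring, comm_monoid_mult} coho) = coho_class (coef n 2 1) 1 (tau_cochain n magnus)"
  unfolding h1_def tau_cochain_def [symmetric]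
proof (rule the_equality)
  show "\<forall>\<theta>. magnus_expansion n \<theta> \<longrightarrow>
      coho_class (coef n 2 1) 1 (tau_cochain n magnus) = coho_class (coef n 2 1) 1 (tau_cochain n \<theta>)"
    using tau_cochain_class_independent magnus_expansion_magnus by blast
qed (use magnus_expansion_magnus in blast)

text \<open>This property singles out the expansion: the series of a generator has no quadratic
  term.\<close>

lemma magnus_gen_2: "b \<in> words n 2 \<Longrightarrow> magnus (gen k) b = 0"
  by (auto simp: words_def length_Suc_conv numeral_2_eq_2 magnus_Cons magnus_Nil series_mult_Cons
      series_mult_Nil letter_series_def gen_series_def)

text \<open>On the last generator, which the extension and its inverse fix, both quadratic terms
  vanish by \<open>magnus_gen_2\<close>. On another generator, its inverse image is a word in the
  first \<open>n\<close> generators, so words \<open>c\<close> containing \<open>n\<close>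
  contribute nothing, and by the block shape of the matrix the rows containing \<open>n\<close> are
  zero.\<close>

lemma tau1_ext:
  assumes \<psi>: "\<psi> \<in> carrier (Aut n)"
  shows "tau1 (Suc n) magnus (aut_ext n \<psi>) = (tau1 n magnus \<psi> :: 'k::{comm_ring, comm_monoid_mult} arr)"
proof (intro ext)
  fix b a :: "nat list"
  let ?\<phi> = "inv\<^bsub>Aut n\<^esub> \<psi>"
  have \<phi>: "?\<phi> \<in> carrier (Aut n)" by (rule inv_Aut_closed [OF \<psi>])
  show "tau1 (Suc n) magnus (aut_ext n \<psi>) b a = (tau1 n magnus \<psi> b a :: 'k)"
  proof (cases "b \<in> words (Suc n) 2 \<and> a \<in> words (Suc n) 1")
    case False
    then have "\<not> (b \<in> words n 2 \<and> a \<in> words n 1)" using words_mono by blast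
    with False show ?thesis by (auto simp: tau1_def truncate_def)
  next
    case True
    then obtain k where k: "a = [k]" "k < Suc n" by (auto simp: words_1)
    show ?thesis
    proof (cases "k = n")
      case True
      then have "a \<notin> words n 1" by (simp add: k words_def)
      moreover have "magnus (gen n) c = (0 :: 'k)" if "c \<in> words (Suc n) 2" for c
        by (rule magnus_gen_2 [OF that])
      ultimately show ?thesis
        by (simp add: tau1_def truncate_def aut_ext_inv \<psi> k True aut_ext_last)
    next
      case False
      with k have kn: "k < n" by simp
      then have \<gamma>: "?\<phi> (gen k) \<in> carrier (free_group n)"
        by (simp add: Aut_closed \<phi> letter_carrier)
      have off: "magnus (?\<phi> (gen k)) c = (0 :: 'k)" if "c \<in> words (Suc n) 2" "c \<notin> words n 2" for c
        using magnus_expansion_magnus [of n] \<gamma> that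
        unfolding magnus_expansion_def words_def by blast
      have "(\<Sum>c\<in>words (Suc n) 2. ind_pow (Suc n) 2 (aut_ext n \<psi>) b c * magnus (?\<phi> (gen k)) c)
          = (\<Sum>c\<in>words n 2. ind_pow (Suc n) 2 (aut_ext n \<psi>) b c * magnus (?\<phi> (gen k)) c :: 'k)"
        using words_mono off by (intro sum.mono_neutral_right) auto
      also have "\<dots> = (\<Sum>c\<in>words n 2. ind_pow n 2 \<psi> b c * magnus (?\<phi> (gen k)) c)"
        by (intro sum.cong refl) (simp add: ind_pow_ext_right [OF \<psi>])
      finally have sum: "(\<Sum>c\<in>words (Suc n) 2. ind_pow (Suc n) 2 (aut_ext n \<psi>) b c * magnus (?\<phi> (gen k)) c)
          = (\<Sum>c\<in>words n 2. ind_pow n 2 \<psi> b c * magnus (?\<phi> (gen k)) c :: 'k)" .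
      have "tau1 (Suc n) magnus (aut_ext n \<psi>) b a
          = - (\<Sum>c\<in>words n 2. ind_pow n 2 \<psi> b c * magnus (?\<phi> (gen k)) c :: 'k)"
        using \<open>b \<in> words (Suc n) 2 \<and> a \<in> words (Suc n) 1\<close> kn
        by (simp add: tau1_def truncate_def aut_ext_inv \<psi> k aut_ext_letter \<phi> sum magnus_gen_2 [of b "Suc n"])
      also have "\<dots> = tau1 n magnus \<psi> b a"
      proof (cases "b \<in> words n 2")
        case True
        then show ?thesis using kn by (simp add: tau1_def truncate_def k words_1 magnus_gen_2 [of b n])
      next
        case False
        then show ?thesis
          by (simp add: arrays_off [OF tau1_arrays] arrays_off [OF ind_pow_arrays])
      qed
      finally show ?thesis .
    qed
  qed
qed

section \<open>Kawazumi's classes\<close>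

lemma act_arr_one: "T \<in> arrays n q l \<Longrightarrow> act_arr n q l \<one>\<^bsub>Aut n\<^esub> T = T"
  using monoid.inv_one [OF group.is_monoid [OF group_Aut], of n]
  by (simp add: act_arr_def ind_pow_one comp_id_left comp_id_right)

section \<open>Kawazumi's map as a linear and equivariant map\<close>

lemma scale_arr_apply: "scale_arr c T b a = c * T b a"
  by (simp add: scale_arr_def)

lemma scale_arrays: "T \<in> arrays n q l \<Longrightarrow> scale_arr c T \<in> arrays n q l"
  by (simp add: arrays_iff scale_arr_apply)

lemma comp_arr_scale_left: "comp_arr n r (scale_arr c S) T = scale_arr c (comp_arr n r S T)"
  and comp_arr_scale_right: "comp_arr n r S (scale_arr c T) = scale_arr c (comp_arr n r S T)"
  by (simp_all add: fun_eq_iff comp_arr_def scale_arr_apply sum_distrib_left mult_ac)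

lemma tensor_arr_scale_left: "tensor_arr q l (scale_arr c S) T = scale_arr c (tensor_arr q l S T)"
  by (simp add: fun_eq_iff tensor_arr_def scale_arr_apply mult_ac)

lemma act_arr_scale: "act_arr n q l \<psi> (scale_arr c T) = scale_arr c (act_arr n q l \<psi> T)"
  by (simp add: act_arr_def comp_arr_scale_left comp_arr_scale_right)

lemma widen_comp_scale_left: "widen_comp n q (scale_arr c S) T = scale_arr c (widen_comp n q S T)"
  and widen_comp_scale_right: "widen_comp n q S (scale_arr c T) = scale_arr c (widen_comp n q S T)"
  by (simp_all add: widen_comp_def tensor_arr_scale_left comp_arr_scale_left comp_arr_scale_right)

lemma widen_comp_id:
  assumes "T \<in> arrays n 2 l"
  shows "widen_comp n 1 (id_arr n 1) T = T"
  unfolding widen_comp_def tensor_id one_add_one by (rule comp_id_left [OF assms])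

text \<open>The interchange law, with the identity in the new factor written as its own square; the
  two adjacent identities then merge into one.\<close>

lemma widen_comp_widen:
  assumes "L \<in> arrays n (Suc m) 1"
  shows "widen_comp n (m + 2) (comp_arr n (Suc m) (tensor_arr 2 1 u (id_arr n m)) L) T
    = comp_arr n (m + 2) (tensor_arr 2 1 u (id_arr n (Suc m))) (widen_comp n (Suc m) L T)"
proof -
  have "tensor_arr (2 + m) 1 (comp_arr n (1 + m) (tensor_arr 2 1 u (id_arr n m)) L) (comp_arr n 1 (id_arr n 1) (id_arr n 1))
      = comp_arr n ((1 + m) + 1) (tensor_arr (2 + m) (1 + m) (tensor_arr 2 1 u (id_arr n m)) (id_arr n 1))
          (tensor_arr (1 + m) 1 L (id_arr n 1))"
    by (rule tensor_comp [symmetric])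
  also have "tensor_arr (2 + m) (1 + m) (tensor_arr 2 1 u (id_arr n m)) (id_arr n 1)
      = tensor_arr 2 1 u (id_arr n (m + 1))"
    unfolding tensor_arr_assoc [symmetric] tensor_id ..
  finally show ?thesis
    by (simp add: widen_comp_def comp_id_left [OF id_arrays] comp_arr_assoc)
qed

lemma tensor_id_0_right:
  assumes "T \<in> arrays n q l"
  shows "tensor_arr q l T (id_arr n 0) = T"
proof (intro ext)
  fix b a :: "nat list"
  show "tensor_arr q l T (id_arr n 0) b a = T b a"
    using arrays_off [OF assms, of b a]
    by (cases "length b \<le> q \<and> length a \<le> l")
      (auto simp: tensor_arr_def id_arr_def truncate_def words_0 words_def)
qed

lemma varsigma_list_arrays:
  "(\<And>u. u \<in> set us \<Longrightarrow> u \<in> arrays n 2 1) \<Longrightarrow> varsigma_list n us \<in> arrays n (Suc (length us)) 1"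
proof (induction us)
  case Nil
  then show ?case using id_arrays [of n 1] by simp
next
  case (Cons u us)
  then have "tensor_arr 2 1 u (id_arr n (length us)) \<in> arrays n (2 + length us) (1 + length us)"
    by (intro tensor_arrays id_arrays) simp
  then show ?case
    using Cons comp_arrays by fastforce
qed

text \<open>The composite is defined by recursion on its outermost map, but the cup power grows at
  the other end. The widening passes through the outer maps one at a time by
  \<open>widen_comp_widen\<close>, which gives the recursion on the innermost map.\<close>

lemma varsigma_list_snoc:
  assumes v: "v \<in> arrays n 2 1"
  shows "(\<And>u. u \<in> set us \<Longrightarrow> u \<in> arrays n 2 1) \<Longrightarrow>
    varsigma_list n (us @ [v]) = widen_comp n (Suc (length us)) (varsigma_list n us) v"
proof (induction us)
  case Nil
  then show ?case
    using comp_id_right [OF v] widen_comp_id [OF v] tensor_id_0_right [OF v] by simp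
next
  case (Cons u us)
  have "varsigma_list n us \<in> arrays n (Suc (length us)) 1"
    using Cons.prems by (intro varsigma_list_arrays) simp
  from widen_comp_widen [OF this, of u v] Cons show ?case by simp
qed

lemma unit_arrays: "b \<in> words n q \<Longrightarrow> a \<in> words n l \<Longrightarrow> unit_arr b a \<in> arrays n q l"
  by (auto simp: arrays_iff unit_arr_def)

lemma unit_arr_apply: "unit_arr b a b' a' = (if b' = b \<and> a' = a then 1 else 0)"
  by (simp add: unit_arr_def)

lemma sum_fun_apply: "(\<Sum>x\<in>A. F x) y = (\<Sum>x\<in>A. F x y)"
  by (induction A rule: infinite_finite_induct) auto

lemma array_expand:
  assumes "T \<in> arrays n q l"
  shows "(\<Sum>b\<in>words n q. \<Sum>a\<in>words n l. scale_arr (T b a) (unit_arr b a)) = T"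
proof (intro ext)
  fix b' a' :: "nat list"
  have delta: "x * (if P then 1 else 0) = (if P then x else 0)" for x :: 'a and P
    by simp
  have "(\<Sum>b\<in>words n q. \<Sum>a\<in>words n l. scale_arr (T b a) (unit_arr b a)) b' a'
      = (\<Sum>b\<in>words n q. if b = b' then \<Sum>a\<in>words n l. if a = a' then T b a else 0 else 0)"
    unfolding sum_fun_apply
    by (intro sum.cong refl) (auto simp: scale_arr_apply unit_arr_apply delta)
  also have "\<dots> = T b' a'"
    using arrays_off [OF assms, of b' a'] by auto
  finally show "(\<Sum>b\<in>words n q. \<Sum>a\<in>words n l. scale_arr (T b a) (unit_arr b a)) b' a' = T b' a'" .
qed

lemma unit_tensor:
  assumes "b \<in> words n q" "a \<in> words n l"
  shows "tensor_arr q l (unit_arr b a) (unit_arr d e) = unit_arr (b @ d) (a @ e)"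
proof (intro ext)
  fix b' a' :: "nat list"
  have len: "length b = q" "length a = l" using assms by (auto simp: words_def)
  have "b' = b @ d \<longleftrightarrow> take q b' = b \<and> drop q b' = d"
    unfolding len(1) [symmetric] by (metis append_eq_conv_conj)
  moreover have "a' = a @ e \<longleftrightarrow> take l a' = a \<and> drop l a' = e"
    unfolding len(2) [symmetric] by (metis append_eq_conv_conj)
  ultimately show "tensor_arr q l (unit_arr b a) (unit_arr d e) b' a' = unit_arr (b @ d) (a @ e) b' a'"
    by (simp add: tensor_arr_def unit_arr_apply)
qed

definition varsigma_unit :: "nat \<Rightarrow> nat \<Rightarrow> nat list \<Rightarrow> nat list \<Rightarrow> 'k::{comm_ring, comm_monoid_mult} arr" where
  "varsigma_unit n p b a =
     varsigma_list n (map (\<lambda>i. unit_arr [b ! (2 * i), b ! (2 * i + 1)] [a ! i]) [0..<p])"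

lemma varsigma_eq:
  "varsigma n p T = (\<Sum>b \<in> words n (2 * p). \<Sum>a \<in> words n p. scale_arr (T b a) (varsigma_unit n p b a))"
  by (simp add: varsigma_def varsigma_unit_def)

lemma words_nth: "w \<in> words n q \<Longrightarrow> i < q \<Longrightarrow> w ! i < n"
  by (auto simp: words_def dest: nth_mem)

lemma unit_factor_arrays:
  assumes "b \<in> words n (2 * p)" "a \<in> words n p" "i < p"
  shows "unit_arr [b ! (2 * i), b ! (2 * i + 1)] [a ! i] \<in> arrays n 2 1"
  using words_nth [OF assms(1), of "2 * i"] words_nth [OF assms(1), of "2 * i + 1"]
    words_nth [OF assms(2,3)] assms(3)
  by (intro unit_arrays) (auto simp: words_def)

lemma varsigma_unit_arrays:
  assumes "b \<in> words n (2 * p)" "a \<in> words n p"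
  shows "(varsigma_unit n p b a :: 'k::{comm_ring, comm_monoid_mult} arr) \<in> arrays n (Suc p) 1"
proof -
  let ?us = "map (\<lambda>i. unit_arr [b ! (2 * i), b ! (2 * i + 1)] [a ! i] :: 'k arr) [0..<p]"
  have "varsigma_list n ?us \<in> arrays n (Suc (length ?us)) 1"
    by (rule varsigma_list_arrays) (use unit_factor_arrays [OF assms] in auto)
  then show ?thesis by (simp add: varsigma_unit_def)
qed

lemma varsigma_unit_append:
  fixes n :: nat
  assumes b: "b \<in> words n (2 * p)" and a: "a \<in> words n p"
    and d: "d \<in> words n 2" and e: "e \<in> words n 1"
  shows "(varsigma_unit n (Suc p) (b @ d) (a @ e) :: 'k::{comm_ring, comm_monoid_mult} arr)
    = widen_comp n (Suc p) (varsigma_unit n p b a) (unit_arr d e)"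
proof -
  let ?u = "\<lambda>b a i. unit_arr [b ! (2 * i), b ! (2 * i + 1)] [a ! i] :: 'k arr"
  have len: "length b = 2 * p" "length a = p" using a b by (auto simp: words_def)
  obtain x y z where de: "d = [x, y]" "e = [z]"
    using d e by (auto simp: words_def length_Suc_conv numeral_2_eq_2)
  have "?u (b @ d) (a @ e) i = ?u b a i" if "i < p" for i
    using that len by (simp add: nth_append)
  moreover have "?u (b @ d) (a @ e) p = unit_arr d e"
    using len by (simp add: nth_append de)
  ultimately have eq: "map (?u (b @ d) (a @ e)) [0..<Suc p] = map (?u b a) [0..<p] @ [unit_arr d e]"
    by simp
  have "varsigma_list n (map (?u b a) [0..<p] @ [unit_arr d e])
      = widen_comp n (Suc (length (map (?u b a) [0..<p]))) (varsigma_list n (map (?u b a) [0..<p])) (unit_arr d e)"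
    by (rule varsigma_list_snoc [OF unit_arrays [OF d e]]) (use unit_factor_arrays [OF b a] in auto)
  then show ?thesis
    unfolding varsigma_unit_def eq by simp
qed

lemma scale_arr_sum: "scale_arr c (\<Sum>x\<in>A. F x) = (\<Sum>x\<in>A. scale_arr c (F x))"
  by (simp add: fun_eq_iff scale_arr_apply sum_fun_apply sum_distrib_left)

lemma arrays_sum:
  fixes f :: "'a \<Rightarrow> 'k::{comm_ring, comm_monoid_mult} arr"
  assumes "\<And>x. x \<in> A \<Longrightarrow> f x \<in> arrays n q l"
  shows "sum f A \<in> arrays n q l"
  using gmod.sum_closed [OF gmod_coef [of n q l], of A f] assms by simp

lemma varsigma_arrays: "varsigma n p T \<in> arrays n (Suc p) 1"
  unfolding varsigma_eq by (intro arrays_sum scale_arrays varsigma_unit_arrays)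

lemma varsigma_add: "varsigma n p (S + T) = varsigma n p S + varsigma n p T"
  by (simp add: varsigma_eq fun_eq_iff sum_fun_apply scale_arr_apply distrib_right sum.distrib)

lemma varsigma_scale: "varsigma n p (scale_arr c T) = scale_arr c (varsigma n p T)"
  by (simp add: varsigma_eq fun_eq_iff sum_fun_apply scale_arr_apply sum_distrib_left mult.assoc)

text \<open>Both sides are bilinear, so matrix units suffice, and there tensoring with a further
  unit appends one map to the list in \<open>varsigma_list_snoc\<close>. \<open>T\<close> is
  expanded in units and so has to be an array, while \<open>varsigma\<close> reads the entries of
  \<open>S\<close> at words only.\<close>

lemma varsigma_tensor:
  assumes T: "T \<in> arrays n 2 1"
  shows "varsigma n (Suc p) (tensor_arr (2 * p) p S T) = widen_comp n (Suc p) (varsigma n p S) T"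
proof -
  interpret W: gpairing "coef n (Suc p) 1" "coef n 2 1" "coef n (Suc (Suc p)) 1" "widen_comp n (Suc p) :: 'a arr \<Rightarrow> _"
    by (rule widen_comp_pairing)
  let ?w = "widen_comp n (Suc p) :: 'a arr \<Rightarrow> _"
  have "?w (varsigma n p S) T
    = ?w (\<Sum>b\<in>words n (2 * p). \<Sum>a\<in>words n p. scale_arr (S b a) (varsigma_unit n p b a))
         (\<Sum>d\<in>words n 2. \<Sum>e\<in>words n 1. scale_arr (T d e) (unit_arr d e))"
    unfolding varsigma_eq array_expand [OF T] ..
  also have "\<dots> = (\<Sum>b\<in>words n (2 * p). \<Sum>a\<in>words n p. \<Sum>d\<in>words n 2. \<Sum>e\<in>words n 1.
      scale_arr (S b a) (scale_arr (T d e) (?w (varsigma_unit n p b a) (unit_arr d e))))"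
    unfolding W.pair_sum_left widen_comp_scale_left
    unfolding W.pair_sum_right widen_comp_scale_right scale_arr_sum ..
  also have "\<dots> = (\<Sum>b\<in>words n (2 * p). \<Sum>d\<in>words n 2. \<Sum>a\<in>words n p. \<Sum>e\<in>words n 1.
      scale_arr (S b a) (scale_arr (T d e) (?w (varsigma_unit n p b a) (unit_arr d e))))"
    by (intro sum.cong refl sum.swap)
  also have "\<dots> = (\<Sum>b\<in>words n (2 * p). \<Sum>d\<in>words n 2. \<Sum>a\<in>words n p. \<Sum>e\<in>words n 1.
      scale_arr (tensor_arr (2 * p) p S T (b @ d) (a @ e)) (varsigma_unit n (Suc p) (b @ d) (a @ e)))"
    by (intro sum.cong refl)
      (simp add: varsigma_unit_append [simplified] fun_eq_iff scale_arr_apply tensor_arr_def words_def mult.assoc)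
  also have "\<dots> = varsigma n (Suc p) (tensor_arr (2 * p) p S T)"
  proof -
    have "Suc p = p + 1" "2 * (p + 1) = 2 * p + 2" by simp_all
    then show ?thesis by (simp only: varsigma_eq sum_words_append)
  qed
  finally show ?thesis by simp
qed

text \<open>By linearity and \<open>varsigma_tensor\<close>, equivariance follows inductively from
  that of the pairing \<open>widen_comp\<close>, so the composite of \<open>p\<close> maps never has
  to be written out.\<close>

lemma varsigma_act:
  assumes \<psi>: "\<psi> \<in> carrier (Aut n)"
  shows "T \<in> arrays n (2 * p) p \<Longrightarrow>
    varsigma n p (act_arr n (2 * p) p \<psi> T) = act_arr n (Suc p) 1 \<psi> (varsigma n p (T :: 'k::{comm_ring, comm_monoid_mult} arr))"
proof (induction p arbitrary: T)
  case 0
  then have "act_arr n 0 0 \<psi> T = T"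
    by (simp add: act_arr_def ind_pow_0_id comp_id_left comp_id_right)
  moreover have "varsigma n 0 T = scale_arr (T [] []) (id_arr n 1)"
    by (simp add: varsigma_eq words_0 varsigma_unit_def)
  moreover have "act_arr n 1 1 \<psi> (id_arr n 1 :: 'k arr) = id_arr n 1"
    by (rule act_arr_id [OF \<psi>])
  ultimately show ?case by (simp add: act_arr_scale)
next
  case (Suc p)
  interpret W: gpairing "coef n (Suc p) 1" "coef n 2 1" "coef n (Suc (Suc p)) 1" "widen_comp n (Suc p) :: 'k arr \<Rightarrow> _"
    by (rule widen_comp_pairing)
  let ?a = "act_arr n (2 * Suc p) (Suc p) \<psi>" and ?a' = "act_arr n (Suc (Suc p)) 1 \<psi>"
  \<comment> \<open>A matrix unit is a tensor product of a unit for the first \<open>p\<close>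
    factors and one for the last factor; the action respects this splitting.\<close>
  have unit: "varsigma n (Suc p) (?a (unit_arr b a)) = ?a' (varsigma n (Suc p) (unit_arr b a :: 'k arr))"
    if b: "b \<in> words n (2 * Suc p)" and a: "a \<in> words n (Suc p)" for b a
  proof -
    have b': "take (2 * p) b \<in> words n (2 * p)" "drop (2 * p) b \<in> words n 2"
      using b words_append_iff [of b n "2 * p" 2] by (auto simp: add.commute)
    have a': "take p a \<in> words n p" "drop p a \<in> words n 1"
      using a words_append_iff [of a n p 1] by auto
    define X where "X = (unit_arr (take (2 * p) b) (take p a) :: 'k arr)"
    define Y where "Y = (unit_arr (drop (2 * p) b) (drop p a) :: 'k arr)"
    have X: "X \<in> arrays n (2 * p) p" and Y: "Y \<in> arrays n 2 1"
      using a' b' by (auto simp: X_def Y_def intro!: unit_arrays)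
    have U: "unit_arr b a = tensor_arr (2 * p) p X Y"
      unfolding X_def Y_def unit_tensor [OF b'(1) a'(1)] by simp
    have "?a (unit_arr b a) = tensor_arr (2 * p) p (act_arr n (2 * p) p \<psi> X) (act_arr n 2 1 \<psi> Y)"
      unfolding U act_arr_tensor by (simp add: add.commute)
    then have "varsigma n (Suc p) (?a (unit_arr b a))
        = widen_comp n (Suc p) (varsigma n p (act_arr n (2 * p) p \<psi> X)) (act_arr n 2 1 \<psi> Y)"
      by (simp only: varsigma_tensor [OF act_arrays])
    also have "\<dots> = ?a' (widen_comp n (Suc p) (varsigma n p X) Y)"
      unfolding Suc.IH [OF X] using W.pair_act [of \<psi> "varsigma n p X" Y] \<psi> varsigma_arrays [of n p X] Y by simp
    finally show ?thesis by (simp only: U varsigma_tensor [OF Y])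
  qed
  have vs: "additive (varsigma n (Suc p) :: 'k arr \<Rightarrow> _)"
    by (rule additive.intro) (rule varsigma_add)
  note a_sum = gmod.act_sum [OF gmod_coef [of n "2 * Suc p" "Suc p"], simplified coef_simps]
  note a'_sum = gmod.act_sum [OF gmod_coef [of n "Suc (Suc p)" 1], simplified coef_simps]
  have "varsigma n (Suc p) (?a (\<Sum>b\<in>words n (2 * Suc p). \<Sum>a\<in>words n (Suc p). scale_arr (T b a) (unit_arr b a)))
      = ?a' (varsigma n (Suc p) (\<Sum>b\<in>words n (2 * Suc p). \<Sum>a\<in>words n (Suc p). scale_arr (T b a) (unit_arr b a)))"
    unfolding a_sum a'_sum additive.sum [OF vs] act_arr_scale varsigma_scale
    by (intro sum.cong refl) (simp only: unit)
  then show ?case unfolding array_expand [OF Suc.prems] .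
qed

lemma varsigma_map: "gmod_map (coef n (2 * p) p) (coef n (Suc p) 1) (varsigma n p)"
  by (intro gmod_map.intro gmod_map_axioms.intro gmod_coef)
    (simp_all add: varsigma_arrays [simplified] varsigma_add varsigma_act [simplified])

section \<open>Cocycles representing the classes\<close>

lemma id_cocycle:
  "on_tuples (Aut n) 0 (\<lambda>_. id_arr n q :: 'k::{comm_ring, comm_monoid_mult} arr) \<in> cocycles (coef n q q) 0"
proof -
  interpret gmod "coef n q q :: (letter list \<Rightarrow> letter list, 'k arr) gmodule" by (rule gmod_coef)
  have "on_tuples (Aut n) 0 (\<lambda>_. id_arr n q :: 'k arr) \<in> cochains (coef n q q) 0"
    using on_tuples_cochain [of 0 "\<lambda>_. id_arr n q :: 'k arr"] by (simp add: id_arrays)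
  moreover have "coboundary (coef n q q) 0 (on_tuples (Aut n) 0 (\<lambda>_. id_arr n q :: 'k arr)) = 0"
    by (auto simp: fun_eq_iff coboundary_def on_tuples_def tuples_def length_Suc_conv alt_def act_arr_id)
  ultimately show ?thesis by (rule cocycleI)
qed

text \<open>Starting from the identity makes the recursion uniform: its first step returns the
  cocycle of \<open>h1\<close>, as \<open>h_cochain_1\<close> shows.\<close>

primrec h_cochain ::
  "nat \<Rightarrow> nat \<Rightarrow> (letter list \<Rightarrow> letter list) list \<Rightarrow> 'k::{comm_ring, comm_monoid_mult} arr" where
  "h_cochain n 0 = on_tuples (Aut n) 0 (\<lambda>_. id_arr n 1)"
| "h_cochain n (Suc p) =
     cup_cochain (coef n 2 1) p 1 (widen_comp n (Suc p)) (h_cochain n p) (tau_cochain n magnus)"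

lemma h_cochain_cocycle: "h_cochain n p \<in> cocycles (coef n (Suc p) 1) p"
proof (induction p)
  case 0
  show ?case using id_cocycle [of n 1] by simp
next
  case (Suc p)
  show ?case
    using gpairing.cup_cocycle [OF widen_comp_pairing Suc tau_cochain_cocycle [OF magnus_expansion_magnus]]
    by simp
qed

lemma cocycle_arrays: "f \<in> cocycles (coef n q l) d \<Longrightarrow> f gs \<in> arrays n q l"
  by (cases "gs \<in> tuples (Aut n) d") (auto simp: cocycles_def cochains_def arrays_iff)

lemma cocycle_off: "f \<in> cocycles (coef n q l) d \<Longrightarrow> gs \<notin> tuples (Aut n) d \<Longrightarrow> f gs = 0"
  by (auto simp: cocycles_def cochains_def)

lemmas h_cochain_arrays = cocycle_arrays [OF h_cochain_cocycle]
lemmas tau_cochain_arrays = cocycle_arrays [OF tau_cochain_cocycle [OF magnus_expansion_magnus]]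

lemma h_cochain_1: "h_cochain n (Suc 0) = tau_cochain n magnus"
proof
  fix gs
  show "h_cochain n (Suc 0) gs = tau_cochain n magnus gs"
  proof (cases "gs \<in> tuples (Aut n) (Suc 0)")
    case True
    then have "h_cochain n (Suc 0) gs
        = widen_comp n 1 (id_arr n 1) (act_arr n 2 1 \<one>\<^bsub>Aut n\<^esub> (tau_cochain n magnus gs))"
      by (simp add: cup_cochain_def on_tuples_def tuples_def)
    also have "\<dots> = tau_cochain n magnus gs"
      unfolding act_arr_one [OF tau_cochain_arrays] by (rule widen_comp_id [OF tau_cochain_arrays])
    finally show ?thesis .
  next
    case False
    then show ?thesis by (simp add: cup_cochain_def on_tuples_def tau_cochain_def)
  qed
qed

primrec pow_cochain ::
  "nat \<Rightarrow> nat \<Rightarrow> (letter list \<Rightarrow> letter list) list \<Rightarrow> 'k::{comm_ring, comm_monoid_mult} arr" where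
  "pow_cochain n 0 = on_tuples (Aut n) 0 (\<lambda>_. id_arr n 0)"
| "pow_cochain n (Suc p) =
     cup_cochain (coef n 2 1) p 1 (tensor_arr (2 * p) p) (pow_cochain n p) (tau_cochain n magnus)"

lemma pow_cochain_cocycle: "pow_cochain n p \<in> cocycles (coef n (2 * p) p) p"
proof (induction p)
  case 0
  show ?case using id_cocycle [of n 0] by simp
next
  case (Suc p)
  show ?case
    using gpairing.cup_cocycle [OF tensor_pairing Suc tau_cochain_cocycle [OF magnus_expansion_magnus]]
    by (simp add: add.commute)
qed

lemma coboundaries_coef_cocycles:
  "coboundaries (coef n q l) 0 \<subseteq> cocycles (coef n q l) 0"
  "coboundaries (coef n q l) 1 \<subseteq> cocycles (coef n q l) 1"
  unfolding One_nat_def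
  by (rule gmod.coboundaries_0_cocycles [OF gmod_coef] gmod.coboundaries_1_cocycles [OF gmod_coef])+

lemma h1_cup_pow_eq:
  "(h1_cup_pow n p :: 'k::{comm_ring, comm_monoid_mult} coho)
    = coho_class (coef n (2 * p) p) p (pow_cochain n p)"
proof (induction p)
  case 0
  show ?case by (simp add: id_st_def)
next
  case (Suc p)
  have "cup (coef n 2 1) (coef n (2 * p + 2) (p + 1)) p 1 (tensor_arr (2 * p) p)
      (coho_class (coef n (2 * p) p) p (pow_cochain n p)) (coho_class (coef n 2 1) 1 (tau_cochain n magnus))
    = coho_class (coef n (2 * p + 2) (p + 1)) (p + 1) (pow_cochain n (Suc p) :: _ \<Rightarrow> 'k arr)"
    unfolding pow_cochain.simps
    by (rule gpairing.cup_class [OF tensor_pairing pow_cochain_cocycle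
        tau_cochain_cocycle [OF magnus_expansion_magnus] coboundaries_coef_cocycles(2)])
  then show ?case by (simp add: Suc h1_eq [simplified] add.commute)
qed

text \<open>The equality holds at each tuple because both recursions translate the same last factor
  by the same group element, after which \<open>varsigma_tensor\<close> applies.\<close>

lemma varsigma_pow_cochain:
  "varsigma n p (pow_cochain n p gs) = (h_cochain n p gs :: 'k::{comm_ring, comm_monoid_mult} arr)"
proof (induction p arbitrary: gs)
  case 0
  have "varsigma n 0 (id_arr n 0) = (id_arr n 1 :: 'k arr)" "varsigma n 0 (\<lambda>_ _. 0) = (0 :: 'k arr)"
    by (simp_all add: varsigma_eq words_0 varsigma_unit_def id_arr_apply scale_arr_def zero_fun_def)
  then show ?case by (simp add: on_tuples_def zero_fun_def)
next
  case (Suc p)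
  have "varsigma n (Suc p) (\<lambda>_ _. 0) = (0 :: 'k arr)"
    by (simp add: varsigma_eq fun_eq_iff sum_fun_apply scale_arr_apply)
  then show ?case
    by (simp add: cup_cochain_def on_tuples_def varsigma_tensor [OF act_arrays, simplified] Suc
        zero_fun_def)
qed

lemma h_Kaw_eq: "h_Kaw n p = coho_class (coef n (Suc p) 1) p (h_cochain n p)"
  using gmod_map.coef_map_class [OF varsigma_map, of n p p "pow_cochain n p"]
  by (simp add: h_Kaw_def h1_cup_pow_eq varsigma_pow_cochain)

section \<open>The inverse system on cochains\<close>

definition pullback ::
  "nat \<Rightarrow> nat \<Rightarrow> nat \<Rightarrow> nat \<Rightarrow> ((letter list \<Rightarrow> letter list) list \<Rightarrow> 'k::{comm_ring, comm_monoid_mult} arr)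
     \<Rightarrow> (letter list \<Rightarrow> letter list) list \<Rightarrow> 'k arr" where
  "pullback n q l d f = on_tuples (Aut n) d (\<lambda>gs. truncate n q l (f (map (aut_ext n) gs)))"

lemma truncate_add: "truncate n q l (S + T) = truncate n q l S + truncate n q l (T :: 'k::{comm_ring, comm_monoid_mult} arr)"
  by (simp add: truncate_def fun_eq_iff)

lemma truncate_additive: "additive (truncate n q l :: 'k::{comm_ring, comm_monoid_mult} arr \<Rightarrow> _)"
  by (rule additive.intro) (rule truncate_add)

lemma pullback_add: "pullback n q l d (f + g) = pullback n q l d f + pullback n q l d g"
  by (auto simp: pullback_def on_tuples_def fun_eq_iff truncate_add)

lemma pullback_0: "pullback n q l d 0 = 0"
  by (auto simp: pullback_def on_tuples_def fun_eq_iff additive.zero [OF truncate_additive])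

lemma pullback_cochain: "pullback n q l d f \<in> cochains (coef n q l) d"
  by (simp add: pullback_def cochains_def on_tuples_def truncate_arrays)

lemma map_tuples: "gs \<in> tuples (Aut n) d \<Longrightarrow> map (aut_ext n) gs \<in> tuples (Aut (Suc n)) d"
  by (auto simp: tuples_def aut_ext_Aut)

lemma merge_map_aut_ext:
  assumes gs: "gs \<in> tuples (Aut n) (Suc d)" and k: "k < d"
  shows "merge (Aut (Suc n)) k (map (aut_ext n) gs) = map (aut_ext n) (merge (Aut n) k gs)"
proof -
  have len: "length gs = Suc d" using gs by (simp add: tuples_def)
  have "gs ! k \<in> carrier (Aut n)" "gs ! Suc k \<in> carrier (Aut n)"
    using gs k nth_mem [of k gs] nth_mem [of "Suc k" gs] by (auto simp: tuples_def)
  then show ?thesis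
    using k len by (simp add: merge_def take_map drop_map aut_ext_mult)
qed

text \<open>The merged entries match because \<open>aut_ext n\<close> is a homomorphism, and the
  leading terms match because truncation is equivariant by \<open>act_arr_truncate\<close>.\<close>

lemma coboundary_pullback:
  "coboundary (coef n q l) d (pullback n q l d f) = pullback n q l (Suc d) (coboundary (coef (Suc n) q l) d f)"
proof
  fix gs
  interpret gmod "coef n q l :: (letter list \<Rightarrow> letter list, 'a arr) gmodule" by (rule gmod_coef)
  show "coboundary (coef n q l) d (pullback n q l d f) gs
      = pullback n q l (Suc d) (coboundary (coef (Suc n) q l) d f) gs"
  proof (cases "gs \<in> tuples (Aut n) (Suc d)")
    case False
    then show ?thesis by (simp add: coboundary_def pullback_def on_tuples_def)
  next
    case True
    then obtain g hs where gs: "gs = g # hs" "g \<in> carrier (Aut n)" "hs \<in> tuples (Aut n) d"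
      by (cases gs) (auto simp: tuples_def)
    let ?F = "\<lambda>gs. truncate n q l (f (map (aut_ext n) gs))"
    have bl: "butlast gs \<in> tuples (Aut n) d"
      using True by (auto simp: tuples_def dest: in_set_butlastD)
    have mg: "merge (Aut n) k gs \<in> tuples (Aut n) d" if "k < d" for k
      using True that merge_tuples by simp
    have alt: "truncate n q l (alt k x) = alt k (truncate n q l x)" for k and x :: "'a arr"
      by (simp add: alt_def additive.minus [OF truncate_additive])
    have "coboundary (coef n q l) d (pullback n q l d f) gs
        = act_arr n q l g (?F hs) + (\<Sum>k<d. alt (Suc k) (?F (merge (Aut n) k gs))) + alt (Suc d) (?F (butlast gs))"
      using True gs bl mg by (simp add: coboundary_def on_tuples_def pullback_def)
    also have "\<dots> = truncate n q l (act_arr (Suc n) q l (aut_ext n g) (f (map (aut_ext n) hs))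
        + (\<Sum>k<d. alt (Suc k) (f (merge (Aut (Suc n)) k (map (aut_ext n) gs))))
        + alt (Suc d) (f (butlast (map (aut_ext n) gs))))"
      using gs merge_map_aut_ext [OF True]
      by (simp add: truncate_add additive.sum [OF truncate_additive] alt act_arr_truncate map_butlast)
    also have "\<dots> = pullback n q l (Suc d) (coboundary (coef (Suc n) q l) d f) gs"
      using True map_tuples [OF True] gs
      by (simp add: pullback_def coboundary_def on_tuples_def)
    finally show ?thesis .
  qed
qed

lemma stab_class:
  fixes f :: "(letter list \<Rightarrow> letter list) list \<Rightarrow> 'k::{comm_ring, comm_monoid_mult} arr"
  shows "stab n q l d (coho_class (coef (Suc n) q l) d f) = coho_class (coef n q l) d (pullback n q l d f)"
proof -
  interpret N: gmod "coef n q l :: (letter list \<Rightarrow> letter list, 'k arr) gmodule" by (rule gmod_coef)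
  interpret N': gmod "coef (Suc n) q l :: (letter list \<Rightarrow> letter list, 'k arr) gmodule" by (rule gmod_coef)
  have "coho_class (coef n q l) d (pullback n q l d f') = coho_class (coef n q l) d (pullback n q l d f)"
    if f': "f' \<in> coho_class (coef (Suc n) q l) d f" for f'
  proof (rule N.coho_class_eqI)
    obtain b where b: "b \<in> coboundaries (coef (Suc n) q l) d" "f' = f + b"
      using f' by (auto simp: coho_class_def)
    have "pullback n q l d b \<in> coboundaries (coef n q l) d"
      using b(1) by (auto simp: coboundaries_def pullback_0 coboundary_pullback [symmetric]
          intro!: imageI pullback_cochain split: nat.splits)
    then show "pullback n q l d f' - pullback n q l d f \<in> coboundaries (coef n q l) d"
      by (simp add: b(2) pullback_add)
  qed
  then show ?thesis
    unfolding stab_def coho_map_def pullback_def [symmetric]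
    by (intro SUP_eq_const N'.coho_class_nonempty)
qed

text \<open>The assumption \<open>ext\<close> asks for equality of cochain values without
  truncation. The truncation in \<open>pullback\<close> then changes nothing, since the values at
  stage \<open>n\<close> are already supported on the first \<open>n\<close> indices.\<close>

lemma stable_cohoI:
  assumes f: "\<And>n. f n \<in> cocycles (coef n q l) d"
    and ext: "\<And>n gs. gs \<in> tuples (Aut n) d \<Longrightarrow> f (Suc n) (map (aut_ext n) gs) = f n gs"
  shows "(\<lambda>n. coho_class (coef n q l) d (f n)) \<in> stable_coho q l d"
proof -
  have "pullback n q l d (f (Suc n)) = f n" for n
    using cocycle_off [OF f] by (auto simp: fun_eq_iff pullback_def on_tuples_def ext
        truncate_array [OF cocycle_arrays [OF f]])
  then show ?thesis
    using f by (simp add: stable_coho_def cohomology_def stab_class)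
qed

section \<open>Stable values, and stability of the cocycles\<close>

lemma stable_value_self: "z \<in> stable_coho q l d \<Longrightarrow> stable_value q l d z z"
  by (simp add: stable_value_def)

text \<open>A family that is compatible at all stages is its own stable value. Uniqueness follows by
  descending from a large stage along \<open>stab\<close>.\<close>

lemma stable_lim_eq:
  assumes "z \<in> stable_coho q l d"
  shows "stable_lim q l d z = z"
  unfolding stable_lim_def
proof (rule the_equality)
  fix y assume "stable_value q l d z y"
  then obtain N where y: "y \<in> stable_coho q l d" and N: "\<And>n. n \<ge> N \<Longrightarrow> y n = z n"
    by (auto simp: stable_value_def eventually_sequentially)
  have "y m = z m" if "m \<le> n" "n \<ge> N" for m n
    using that
  proof (induction rule: inc_induct)
    case base
    then show ?case using N by simp
  next
    case (step m)
    then have "y (Suc m) = z (Suc m)" by simp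
    with y assms show ?case unfolding stable_coho_def by (metis (mono_tags, lifting) mem_Collect_eq)
  qed
  then have "y m = z m" for m
    by (metis nle_le)
  then show "y = z" by auto
qed (rule stable_value_self [OF assms])

text \<open>The middle words come from the rows of \<open>T\<close> and do not contain the index
  \<open>n\<close>. On them the identities of sizes \<open>n\<close> and \<open>n + 1\<close> agree,
  although they differ as arrays.\<close>

lemma widen_comp_Suc:
  assumes T: "T \<in> arrays n 2 l"
  shows "widen_comp (Suc n) q S T = widen_comp n q S T"
proof (intro ext)
  fix b a :: "nat list"
  have "widen_comp (Suc n) q S T b a = comp_arr n 2 (tensor_arr q 1 S (id_arr (Suc n) 1)) T b a"
    unfolding widen_comp_def by (rule comp_arr_Suc) (use T in \<open>auto simp: arrays_iff\<close>)
  also have "\<dots> = widen_comp n q S T b a"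
    unfolding widen_comp_def comp_arr_def
  proof (intro sum.cong refl)
    fix c assume "c \<in> words n 2"
    then have "drop 1 c \<in> words n 1"
      using words_append_iff [of c n 1 1] by (simp add: numeral_2_eq_2)
    then have "id_arr (Suc n) 1 (drop q b) (drop 1 c) = (id_arr n 1 (drop q b) (drop 1 c) :: 'a)"
      using words_mono [of n 1] by (simp add: id_arr_apply subset_iff)
    then show "tensor_arr q 1 S (id_arr (Suc n) 1) b c * T c a = tensor_arr q 1 S (id_arr n 1) b c * T c a"
      by (simp add: tensor_arr_def)
  qed
  finally show "widen_comp (Suc n) q S T b a = widen_comp n q S T b a" .
qed

lemma list_mult_map_aut_ext:
  "set gs \<subseteq> carrier (Aut n) \<Longrightarrow> list_mult (Aut (Suc n)) (map (aut_ext n) gs) = aut_ext n (list_mult (Aut n) gs)"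
proof (induction gs)
  case Nil
  then show ?case by (simp add: aut_ext_hom_one)
next
  case (Cons g gs)
  then show ?case
    using monoid.list_mult_closed [OF group.is_monoid [OF group_Aut], of gs n] by (simp add: aut_ext_mult)
qed

lemma tau_cochain_ext:
  "gs \<in> tuples (Aut n) (Suc 0) \<Longrightarrow> tau_cochain (Suc n) magnus (map (aut_ext n) gs) = tau_cochain n magnus gs"
  using map_tuples [of gs n "Suc 0"] by (auto simp: tau_cochain_def on_tuples_def tuples_Suc_0 tau1_ext)

text \<open>Degree zero is left out because it would compare identities of two sizes. In the step,
  the element acting on the last factor is itself an extended automorphism, so
  \<open>act_arr_ext\<close> applies, and its result satisfies the support condition of
  \<open>widen_comp_Suc\<close>.\<close>

lemma h_cochain_ext:
  "gs \<in> tuples (Aut n) (Suc p) \<Longrightarrow>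
    h_cochain (Suc n) (Suc p) (map (aut_ext n) gs) = (h_cochain n (Suc p) gs :: 'k::{comm_ring, comm_monoid_mult} arr)"
proof (induction p arbitrary: gs)
  case 0
  then show ?case by (simp only: h_cochain_1 tau_cochain_ext)
next
  case (Suc p)
  let ?t = "take (Suc p) gs" and ?d = "drop (Suc p) gs"
  have t: "?t \<in> tuples (Aut n) (Suc p)" and d: "?d \<in> tuples (Aut n) (Suc 0)"
    using Suc.prems by (auto simp: tuples_def dest: in_set_takeD in_set_dropD)
  let ?g = "list_mult (Aut n) ?t"
  have g: "?g \<in> carrier (Aut n)"
    using t monoid.list_mult_closed [OF group.is_monoid [OF group_Aut], of ?t n] by (simp add: tuples_def)
  \<comment> \<open>Unfolds the outer cup product only, for general \<open>m\<close>, because it is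
    applied at both stages.\<close>
  have step: "h_cochain m (Suc (Suc p)) ks = widen_comp m (Suc (Suc p)) (h_cochain m (Suc p) (take (Suc p) ks))
      (act_arr m 2 1 (list_mult (Aut m) (take (Suc p) ks)) (tau_cochain m magnus (drop (Suc p) ks)) :: 'k arr)"
    if "ks \<in> tuples (Aut m) (Suc (Suc p))" for m ks
    using that by (simp add: cup_cochain_def on_tuples_def del: h_cochain.simps(2)
        add: h_cochain.simps(2) [of m "Suc p"])
  have "h_cochain (Suc n) (Suc (Suc p)) (map (aut_ext n) gs)
      = widen_comp (Suc n) (Suc (Suc p)) (h_cochain n (Suc p) ?t)
          (act_arr (Suc n) 2 1 (aut_ext n ?g) (tau_cochain n magnus ?d) :: 'k arr)"
    using t unfolding step [OF map_tuples [OF Suc.prems]] take_map drop_map Suc.IH [OF t] tau_cochain_ext [OF d]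
    by (simp only: list_mult_map_aut_ext tuples_def mem_Collect_eq)
  also have "\<dots> = widen_comp n (Suc (Suc p)) (h_cochain n (Suc p) ?t)
          (act_arr n 2 1 ?g (tau_cochain n magnus ?d))"
    unfolding act_arr_ext [OF g tau_cochain_arrays] by (rule widen_comp_Suc [OF act_arrays])
  also have "\<dots> = h_cochain n (Suc (Suc p)) gs"
    by (rule step [OF Suc.prems, symmetric])
  finally show ?case .
qed

section \<open>The classes in the wheeled PROP\<close>

definition h_stable :: "nat \<Rightarrow> 'k::{comm_ring, comm_monoid_mult} stable" where
  "h_stable p = (\<lambda>n. coho_class (coef n (Suc p) 1) p (h_cochain n p))"

lemma h_stable_stable: "h_stable (Suc p) \<in> stable_coho (Suc (Suc p)) 1 (Suc p)"
  unfolding h_stable_def by (intro stable_cohoI h_cochain_cocycle h_cochain_ext)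

lemma h_stable_1: "h_stable (Suc 0) = h1"
  by (intro ext) (simp only: h_stable_def h1_eq h_cochain_1 numeral_2_eq_2 One_nat_def)

definition widened_cochain ::
  "nat \<Rightarrow> nat \<Rightarrow> (letter list \<Rightarrow> letter list) list \<Rightarrow> 'k::{comm_ring, comm_monoid_mult} arr" where
  "widened_cochain n p = cup_cochain (coef n 1 1) p 0 (tensor_arr (Suc p) 1) (h_cochain n p)
     (on_tuples (Aut n) 0 (\<lambda>_. id_arr n 1))"

text \<open>The cup product translates its second factor by the product of the tuple, but identity
  arrays are invariant, so no trace of the translation remains.\<close>

lemma widened_cochain_apply:
  assumes "gs \<in> tuples (Aut n) p"
  shows "widened_cochain n p gs = tensor_arr (Suc p) 1 (h_cochain n p gs) (id_arr n 1)"
proof -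
  have "list_mult (Aut n) gs \<in> carrier (Aut n)"
    using assms monoid.list_mult_closed [OF group.is_monoid [OF group_Aut], of gs n] by (simp add: tuples_def)
  then show ?thesis
    using assms by (simp add: widened_cochain_def cup_cochain_def on_tuples_def tuples_def act_arr_id)
qed

lemma widened_cochain_cocycle: "widened_cochain n p \<in> cocycles (coef n (Suc p + 1) (1 + 1)) (p + 0)"
  unfolding widened_cochain_def
  by (rule gpairing.cup_cocycle [OF tensor_pairing h_cochain_cocycle id_cocycle])

lemma tensor_st_h_stable:
  "tensor_st (Suc p) 1 p 1 1 0 (h_stable p) (id_st 1) n
    = coho_class (coef n (Suc p + 1) (1 + 1)) (p + 0) (widened_cochain n p)"
  unfolding tensor_st_def h_stable_def id_st_def widened_cochain_def
  by (rule gpairing.cup_class [OF tensor_pairing h_cochain_cocycle id_cocycle coboundaries_coef_cocycles(1)])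

lemma comp_widened_cochain:
  "cup_cochain (coef n 2 1) p 1 (comp_arr n 2) (widened_cochain n p) (tau_cochain n magnus) = h_cochain n (Suc p)"
proof
  fix gs
  have "take p gs \<in> tuples (Aut n) p" if "gs \<in> tuples (Aut n) (Suc p)"
    using that by (auto simp: tuples_def dest: in_set_takeD)
  then show "cup_cochain (coef n 2 1) p 1 (comp_arr n 2) (widened_cochain n p) (tau_cochain n magnus) gs
      = h_cochain n (Suc p) gs"
    by (simp add: cup_cochain_def on_tuples_def widened_cochain_apply widen_comp_def)
qed

text \<open>An equality of families at every stage: composing with the widened cochain is the
  pairing \<open>widen_comp\<close>, and \<open>comp_at\<close> takes the cup product in the order
  of \<open>h_cochain\<close>. The limit defining \<open>comp_st\<close> is then that of a family
  already known to be compatible.\<close>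

lemma comp_at_h_stable:
  "comp_at (Suc (Suc p)) 2 1 1 p h1 (tensor_st (Suc p) 1 p 1 1 0 (h_stable p) (id_st 1)) = h_stable (Suc p)"
proof
  fix n
  have "cup (coef n 2 1) (coef n (Suc (Suc p)) 1) p 1 (comp_arr n 2)
      (coho_class (coef n (Suc (Suc p)) 2) p (widened_cochain n p)) (coho_class (coef n 2 1) 1 (tau_cochain n magnus))
    = coho_class (coef n (Suc (Suc p)) 1) (p + 1)
        (cup_cochain (coef n 2 1) p 1 (comp_arr n 2) (widened_cochain n p) (tau_cochain n magnus))"
    using widened_cochain_cocycle [of n p]
    by (intro gpairing.cup_class [OF comp_pairing _ tau_cochain_cocycle [OF magnus_expansion_magnus]
          coboundaries_coef_cocycles(2)]) (simp add: numeral_2_eq_2)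
  then show "comp_at (Suc (Suc p)) 2 1 1 p h1 (tensor_st (Suc p) 1 p 1 1 0 (h_stable p) (id_st 1)) n
      = h_stable (Suc p) n"
    unfolding comp_at_def tensor_st_h_stable h1_eq comp_widened_cochain
    by (simp add: h_stable_def numeral_2_eq_2)
qed

lemma h_st_eq: "h_st (Suc p) = (h_stable (Suc p) :: 'k::{comm_ring, comm_monoid_mult} stable)"
proof (induction p)
  case 0
  show ?case by (simp add: h_stable_1)
next
  case (Suc p)
  have "(h_st (Suc (Suc p)) :: 'k stable) = stable_lim (Suc (Suc (Suc p))) 1 (1 + Suc p)
      (comp_at (Suc (Suc (Suc p))) 2 1 1 (Suc p) h1
        (tensor_st (Suc (Suc p)) 1 (Suc p) 1 1 0 (h_stable (Suc p)) (id_st 1)))"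
    by (simp add: Suc comp_st_def numeral_2_eq_2 numeral_3_eq_3)
  also have "\<dots> = h_stable (Suc (Suc p))"
    unfolding comp_at_h_stable using stable_lim_eq [OF h_stable_stable, of "Suc p"] by simp
  finally show ?case .
qed

lemma h_stable_generated: "generated {(2, 1, 1, h1)} (Suc (Suc p)) 1 (Suc p) (h_stable (Suc p))"
proof (induction p)
  case 0
  show ?case using generated.base [of 2 1 1 h1 "{(2, 1, 1, h1)}"] by (simp add: h_stable_1 numeral_2_eq_2)
next
  case (Suc p)
  let ?S = "{(2, 1, 1, h1 :: 'a stable)}"
  let ?y = "tensor_st (Suc (Suc p)) 1 (Suc p) 1 1 0 (h_stable (Suc p)) (id_st 1) :: 'a stable"
  have "generated ?S (Suc (Suc p) + 1) (1 + 1) (Suc p + 0) ?y"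
    by (rule generated.tensor [OF Suc generated.id])
  then have y: "generated ?S (Suc (Suc (Suc p))) 2 (Suc p) ?y"
    by (simp add: numeral_2_eq_2)
  have h1: "generated ?S 2 1 1 h1"
    by (rule generated.base) simp
  have "generated ?S (Suc (Suc (Suc p))) 1 (1 + Suc p) (h_stable (Suc (Suc p)))"
    by (rule generated.comp [OF h1 y])
      (use stable_value_self [OF h_stable_stable, of "Suc p"] in \<open>simp add: comp_at_h_stable [simplified]\<close>)
  then show ?case by simp
qed

section \<open>Contractions\<close>

lemma eval_first_Suc:
  "T \<in> arrays n (Suc q) (Suc l) \<Longrightarrow> eval_first (Suc n) T = eval_first n T"
  by (simp add: eval_first_def fun_eq_iff arrays_iff words_Cons)

definition h_bar_stable :: "nat \<Rightarrow> 'k::{comm_ring, comm_monoid_mult} stable" where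
  "h_bar_stable p = (\<lambda>n. coho_class (coef n p 0) p (\<lambda>gs. eval_first n (h_cochain n p gs)))"

lemma h_bar_stable_stable: "h_bar_stable (Suc p) \<in> stable_coho (Suc p) 0 (Suc p)"
  unfolding h_bar_stable_def
proof (rule stable_cohoI)
  show "(\<lambda>gs. eval_first n (h_cochain n (Suc p) gs)) \<in> cocycles (coef n (Suc p) 0) (Suc p)" for n
    using gmod_map.cocycles_map [OF eval_first_map h_cochain_cocycle [simplified]] .
  show "eval_first (Suc n) (h_cochain (Suc n) (Suc p) (map (aut_ext n) gs)) = eval_first n (h_cochain n (Suc p) gs)"
    if "gs \<in> tuples (Aut n) (Suc p)" for n gs
    unfolding h_cochain_ext [OF that] by (rule eval_first_Suc [OF h_cochain_arrays [simplified]])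
qed

lemma eval_first_h_class:
  "coef_map (coef n p 0) p (eval_first n) (coho_class (coef n (Suc p) 1) p (h_cochain n p))
    = coho_class (coef n p 0) p (\<lambda>gs. eval_first n (h_cochain n p gs))"
  using gmod_map.coef_map_class [OF eval_first_map, of n p 0 p "h_cochain n p"] by simp

lemma contract_at_h_stable: "contract_at (p + 1) 1 p 1 1 (h_stable p) = h_bar_stable p"
proof
  fix n
  show "contract_at (p + 1) 1 p 1 1 (h_stable p) n = h_bar_stable p n"
    unfolding contract_at_def contract_arr_1_1 h_stable_def h_bar_stable_def
    using eval_first_h_class by simp
qed

lemma h_bar_Kaw_eq: "h_bar_Kaw n p = h_bar_stable p n"
  unfolding h_bar_Kaw_def h_Kaw_eq h_bar_stable_def by (rule eval_first_h_class)

lemma h_bar_st_eq: "h_bar_st (Suc p) = h_bar_stable (Suc p)"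
  unfolding h_bar_st_def h_st_eq contract_st_def contract_at_h_stable
  using stable_lim_eq [OF h_bar_stable_stable] by simp

lemma h_bar_stable_generated: "generated {(2, 1, 1, h1)} (Suc p) 0 (Suc p) (h_bar_stable (Suc p))"
proof -
  \<comment> \<open>The numbers of factors are left as differences, in the shape of the contraction
    rule.\<close>
  have "stable_value (Suc p + 1 - 1) (1 - 1) (Suc p)
      (contract_at (Suc p + 1) 1 (Suc p) 1 1 (h_stable (Suc p))) (h_bar_stable (Suc p))"
    unfolding contract_at_h_stable using stable_value_self [OF h_bar_stable_stable] by simp
  then have "generated {(2, 1, 1, h1)} (Suc p + 1 - 1) (1 - 1) (Suc p) (h_bar_stable (Suc p))"
    by (rule generated.contract [rotated -1]) (use h_stable_generated [of p] in simp_all)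
  then show ?thesis by simp
qed

theorem proposition7p1:
  fixes p :: nat
  assumes "p \<ge> 1"
  shows "(h_st (p + 1) :: 'k::{comm_ring, comm_monoid_mult} stable) \<in> K (p + 2) 1 (p + 1) \<and>
    (\<forall>\<^sub>F n in sequentially. (h_st (p + 1) :: 'k stable) n = h_Kaw n (p + 1)) \<and>
    (h_bar_st p :: 'k stable) \<in> K p 0 p \<and>
    (\<forall>\<^sub>F n in sequentially. (h_bar_st p :: 'k stable) n = h_bar_Kaw n p)"
\<comment> \<open>Both eventual equalities hold at every \<open>n\<close>.\<close>
proof (intro conjI always_eventually allI)
  show "(h_st (p + 1) :: 'k stable) \<in> K (p + 2) 1 (p + 1)"
    using h_stable_generated [of p] by (simp add: K_def h_st_eq)
  show "(h_st (p + 1) :: 'k stable) n = h_Kaw n (p + 1)" for n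
    by (simp add: h_st_eq h_Kaw_eq h_stable_def)
  obtain r where "p = Suc r" using assms by (cases p) auto
  then show "(h_bar_st p :: 'k stable) \<in> K p 0 p"
    and "(h_bar_st p :: 'k stable) n = h_bar_Kaw n p" for n
    using h_bar_stable_generated [of r] by (simp_all add: K_def h_bar_st_eq h_bar_Kaw_eq)
qed

end
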